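(* For every $\psi\in\mathcal C_{\Lambda_D}$ there exists a unique vector $c_\psi\in\mathcal H_{\mathbf d}$ such that $\mathcal Z_D\psi=c_\psi\,\delta_0$ as a distributional section over the syndrome torus $\mathbb R^{2n}/\Lambda_D^\circ$. Moreover, the map $$\mathcal C_{\Lambda_D}\longrightarrow\mathcal H_{\mathbf d},\qquad \psi\longmapsto c_\psi,$$ is a linear isomorphism.
   Context: Conventions: inner products and the $M^\infty$–$M^1$ pairing $\langle\cdot,\cdot\rangle$ (extending the $L^2$ inner product) are linear in the first and conjugate-linear in the second variable. For $z=(x,\omega)\in\mathbb R^{2n}$: $\rho(x,\omega)=e^{-\pi i x\cdot\omega}M_\omega T_x$ with $(T_xf)(t)=f(t-x)$, $(M_\omega f)(t)=e^{2\pi i\omega\cdot t}f(t)$. The modulation space $M^p(\mathbb R^n)$ is the set of tempered distributions $f$ with $z\mapsto\langle f,\rho(z)\varphi\rangle$ in $L^p(\mathbb R^{2n})$ for a fixed nonzero Schwartz $\varphi$; $M^\infty$ is the dual of $M^1$, and $\langle\rho(z)\psi,h\rangle=\langle\psi,\rho(-z)h\rangle$. $D=\operatorname{diag}(d_1,\dots,d_n)$, positive integers $d_1\mid\cdots\mid d_n$, $d=\prod_jd_j$. $\Lambda_D=D^{1/2}\mathbb Z^n\times D^{1/2}\mathbb Z^n$, $\Lambda_D^\circ=D^{-1/2}\mathbb Z^n\times D^{-1/2}\mathbb Z^n$. $\chi_D(D^{1/2}k,D^{1/2}\ell)=(-1)^{k^TD\ell}$ for $k,\ell\in\mathbb Z^n$,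 $S_\lambda=\chi_D(\lambda)\rho(\lambda)$, and $\mathcal C_{\Lambda_D}=\{\psi\in M^\infty(\mathbb R^n):S_\lambda\psi=\psi\ \forall\lambda\in\Lambda_D\}$. $\mathbb Z_{\mathbf d}=\prod_j\mathbb Z_{d_j}$, $\mathcal H_{\mathbf d}=\bigotimes_j\mathbb C^{d_j}$ with orthonormal basis $(e_r)_{r\in\mathbb Z_{\mathbf d}}$, $\delta_r=D^{-1/2}r$. For $h\in M^1(\mathbb R^n)$, $Z_Dh(x,\omega)=\sum_{\gamma\in D^{1/2}\mathbb Z^n}h(x-\gamma)e^{2\pi i\gamma\cdot\omega}$, and the vector-valued Zak transform is $(\mathcal Z_Dh(x,\omega))_r=e^{-2\pi i\delta_r\cdot\omega}Z_Dh(x+\delta_r,\omega)$, $r\in\mathbb Z_{\mathbf d}$; it is a continuous $\mathcal H_{\mathbf d}$-valued function. The transform extends to $\psi\in M^\infty(\mathbb R^n)$ by duality, $\langle\mathcal Z_D\psi,\mathcal Z_Dh\rangle=\langle\psi,h\rangle$ for $h\in M^1(\mathbb R^n)$, and $c\,\delta_0$ denotes the functional $\mathcal Z_Dh\mapsto\langle c,\mathcal Z_Dh(0,0)\rangle$. Thus $\mathcal Z_D\psi=c\,\delta_0$ means $\langle\psi,h\rangle=\langle c,\mathcal Z_Dh(0,0)\rangle$ for all $h\in M^1(\mathbb R^n)$. *)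

theory Defs
  imports "HOL-Analysis.Analysis"
begin

text \<open>\<open>iter_partial [b\<^sub>1, \<dots>, b\<^sub>m] f\<close> is the iterated partial derivative of \<open>f\<close> in the coordinate
  directions \<open>b\<^sub>m, \<dots>, b\<^sub>1\<close>.\<close>

primrec iter_partial :: "'a::euclidean_space list \<Rightarrow> ('a \<Rightarrow> complex) \<Rightarrow> 'a \<Rightarrow> complex" where
  "iter_partial [] f = f"
| "iter_partial (b # bs) f = (\<lambda>x. frechet_derivative (iter_partial bs f) (at x) b)"

definition schwartz :: "('a::euclidean_space \<Rightarrow> complex) set" where
  "schwartz = {f. \<forall>bs \<in> lists Basis.
      (\<forall>x. iter_partial bs f differentiable at x) \<and>
      (\<forall>N::nat. \<exists>B. \<forall>x. (1 + norm x) ^ N * norm (iter_partial bs f x) \<le> B)}"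

definition antilinear_on :: "('a \<Rightarrow> complex) set \<Rightarrow> (('a \<Rightarrow> complex) \<Rightarrow> complex) \<Rightarrow> bool" where
  "antilinear_on V u \<longleftrightarrow>
     (\<forall>f\<in>V. \<forall>g\<in>V. u (\<lambda>t. f t + g t) = u f + u g) \<and>
     (\<forall>a. \<forall>f\<in>V. u (\<lambda>t. a * f t) = cnj a * u f)"

text \<open>The pairing \<open>\<langle>u, g\<rangle>\<close> is conjugate-linear in \<open>g\<close>, so distributions are represented by the
  antilinear functionals \<open>g \<mapsto> \<langle>u, g\<rangle>\<close>. Only the values on Schwartz functions matter.\<close>

definition tempered_distribution :: "(('a::euclidean_space \<Rightarrow> complex) \<Rightarrow> complex) \<Rightarrow> bool" where
  "tempered_distribution u \<longleftrightarrow> antilinear_on schwartz u \<and>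
     (\<exists>C. \<exists>N::nat. \<forall>g\<in>schwartz. \<forall>B.
        (\<forall>bs\<in>lists Basis. length bs \<le> N \<longrightarrow>
           (\<forall>x. (1 + norm x) ^ N * norm (iter_partial bs g x) \<le> B))
        \<longrightarrow> norm (u g) \<le> C * B)"

definition regular_distribution :: "('a::euclidean_space \<Rightarrow> complex) \<Rightarrow> ('a \<Rightarrow> complex) \<Rightarrow> complex" where
  "regular_distribution h = (\<lambda>g. LINT t|lborel. h t * cnj (g t))"

definition rho :: "(real^'n) \<times> (real^'n) \<Rightarrow> (real^'n \<Rightarrow> complex) \<Rightarrow> real^'n \<Rightarrow> complex" where
  "rho z f = (\<lambda>t. cis (- pi * (fst z \<bullet> snd z)) * (cis (2 * pi * (snd z \<bullet> t)) * f (t - fst z)))"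

definition M1_distributions ::
    "(real^'n \<Rightarrow> complex) \<Rightarrow> ((real^'n \<Rightarrow> complex) \<Rightarrow> complex) set" where
  "M1_distributions \<phi> = {u. tempered_distribution u \<and> integrable lborel (\<lambda>z. u (rho z \<phi>))}"

text \<open>Every distribution in \<open>M\<^sup>1\<close> is given by a unique continuous function, and this function is
  integrable. We let \<open>M\<^sup>1\<close> consist of these functions, since the Zak transform uses their point
  values.\<close>

definition M1 :: "(real^'n \<Rightarrow> complex) \<Rightarrow> (real^'n \<Rightarrow> complex) set" where
  "M1 \<phi> = {h. continuous_on UNIV h \<and> integrable lborel h \<and>
               regular_distribution h \<in> M1_distributions \<phi>}"

definition M1_norm :: "(real^'n \<Rightarrow> complex) \<Rightarrow> (real^'n \<Rightarrow> complex) \<Rightarrow> real" where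
  "M1_norm \<phi> h = (LINT z|lborel. norm (regular_distribution h (rho z \<phi>)))"

text \<open>\<open>M\<^sup>\<infinity>\<close> is the dual of \<open>M\<^sup>1\<close>. An element \<open>\<psi>\<close> is represented by the functional \<open>h \<mapsto> \<langle>\<psi>, h\<rangle>\<close>,
  so the value \<open>\<psi> h\<close> is the pairing \<open>\<langle>\<psi>, h\<rangle>\<close>. It is set to \<open>0\<close> outside \<open>M\<^sup>1\<close>, so that equality in
  \<open>M\<^sup>\<infinity>\<close> is equality of HOL functions.\<close>

definition Minf :: "(real^'n \<Rightarrow> complex) \<Rightarrow> ((real^'n \<Rightarrow> complex) \<Rightarrow> complex) set" where
  "Minf \<phi> = {\<psi>. antilinear_on (M1 \<phi>) \<psi> \<and>
                 (\<exists>C. \<forall>h\<in>M1 \<phi>. norm (\<psi> h) \<le> C * M1_norm \<phi> h) \<and>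
                 (\<forall>h. h \<notin> M1 \<phi> \<longrightarrow> \<psi> h = 0)}"

text \<open>The extension of \<open>\<rho>(z)\<close> to the dual is determined by \<open>\<langle>\<rho>(z)\<psi>, h\<rangle> = \<langle>\<psi>, \<rho>(-z)h\<rangle>\<close>.\<close>

definition rho_dual :: "(real^'n) \<times> (real^'n) \<Rightarrow> ((real^'n \<Rightarrow> complex) \<Rightarrow> complex)
    \<Rightarrow> (real^'n \<Rightarrow> complex) \<Rightarrow> complex" where
  "rho_dual z \<psi> = (\<lambda>h. \<psi> (rho (- z) h))"

text \<open>\<open>D = diag(d\<^sub>j)\<close> is given by \<open>d\<close>; \<open>Dhalf d k = D\<^bsup>1/2\<^esup> k\<close> for \<open>k \<in> \<int>\<^sup>n\<close>. The points of
  \<open>\<Lambda>\<^sub>D\<close> are parametrised as \<open>(D\<^bsup>1/2\<^esup> k, D\<^bsup>1/2\<^esup> l)\<close>.\<close>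

definition Dhalf :: "('n \<Rightarrow> nat) \<Rightarrow> int^'n \<Rightarrow> real^'n" where
  "Dhalf d k = (\<chi> j. sqrt (real (d j)) * of_int (k $ j))"

definition chi_D :: "('n::finite \<Rightarrow> nat) \<Rightarrow> int^'n \<Rightarrow> int^'n \<Rightarrow> complex" where
  "chi_D d k l = (-1) powi (\<Sum>j\<in>UNIV. k $ j * int (d j) * l $ j)"

definition S_op :: "('n::finite \<Rightarrow> nat) \<Rightarrow> int^'n \<Rightarrow> int^'n \<Rightarrow> ((real^'n \<Rightarrow> complex) \<Rightarrow> complex)
    \<Rightarrow> (real^'n \<Rightarrow> complex) \<Rightarrow> complex" where
  "S_op d k l \<psi> = (\<lambda>h. chi_D d k l * rho_dual (Dhalf d k, Dhalf d l) \<psi> h)"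

definition code_space :: "('n::finite \<Rightarrow> nat) \<Rightarrow> (real^'n \<Rightarrow> complex)
    \<Rightarrow> ((real^'n \<Rightarrow> complex) \<Rightarrow> complex) set" where
  "code_space d \<phi> = {\<psi> \<in> Minf \<phi>. \<forall>k l. S_op d k l \<psi> = \<psi>}"

definition Zd :: "('n::finite \<Rightarrow> nat) \<Rightarrow> (nat^'n) set" where
  "Zd d = {r. \<forall>j. r $ j < d j}"

text \<open>A vector of \<open>H\<^sub>d\<close> is given by its coordinates in the orthonormal basis
  \<open>(e\<^sub>r)\<close>, \<open>r \<in> \<int>\<^sub>d\<close>.\<close>

definition Hd :: "('n::finite \<Rightarrow> nat) \<Rightarrow> (nat^'n \<Rightarrow> complex) set" where
  "Hd d = {c. \<forall>r. r \<notin> Zd d \<longrightarrow> c r = 0}"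

definition Hd_inner :: "('n::finite \<Rightarrow> nat) \<Rightarrow> (nat^'n \<Rightarrow> complex) \<Rightarrow> (nat^'n \<Rightarrow> complex) \<Rightarrow> complex" where
  "Hd_inner d c c' = (\<Sum>r\<in>Zd d. c r * cnj (c' r))"

definition delta_shift :: "('n::finite \<Rightarrow> nat) \<Rightarrow> nat^'n \<Rightarrow> real^'n" where
  "delta_shift d r = (\<chi> j. real (r $ j) / sqrt (real (d j)))"

definition zak :: "('n::finite \<Rightarrow> nat) \<Rightarrow> (real^'n \<Rightarrow> complex) \<Rightarrow> (real^'n) \<times> (real^'n) \<Rightarrow> complex" where
  "zak d h z = (\<Sum>\<^sub>\<infinity>\<gamma>\<in>range (Dhalf d). h (fst z - \<gamma>) * cis (2 * pi * (\<gamma> \<bullet> snd z)))"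

definition vzak :: "('n::finite \<Rightarrow> nat) \<Rightarrow> (real^'n \<Rightarrow> complex)
    \<Rightarrow> (real^'n) \<times> (real^'n) \<Rightarrow> nat^'n \<Rightarrow> complex" where
  "vzak d h z = (\<lambda>r. if r \<in> Zd d
     then cis (- 2 * pi * (delta_shift d r \<bullet> snd z)) * zak d h (fst z + delta_shift d r, snd z)
     else 0)"

text \<open>\<open>zak_dual d \<phi> \<psi> \<Phi>\<close> says that the functional \<open>\<Phi>\<close> on sections is the Zak transform of
  \<open>\<psi> \<in> M\<^sup>\<infinity>\<close>. Functionals are tested only on the sections \<open>vzak d h\<close> with \<open>h \<in> M\<^sup>1\<close>.\<close>

definition zak_dual :: "('n::finite \<Rightarrow> nat) \<Rightarrow> (real^'n \<Rightarrow> complex)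
    \<Rightarrow> ((real^'n \<Rightarrow> complex) \<Rightarrow> complex)
    \<Rightarrow> (((real^'n) \<times> (real^'n) \<Rightarrow> nat^'n \<Rightarrow> complex) \<Rightarrow> complex) \<Rightarrow> bool" where
  "zak_dual d \<phi> \<psi> \<Phi> \<longleftrightarrow> (\<forall>h\<in>M1 \<phi>. \<Phi> (vzak d h) = \<psi> h)"

definition delta0 :: "('n::finite \<Rightarrow> nat) \<Rightarrow> (nat^'n \<Rightarrow> complex)
    \<Rightarrow> ((real^'n) \<times> (real^'n) \<Rightarrow> nat^'n \<Rightarrow> complex) \<Rightarrow> complex" where
  "delta0 d c = (\<lambda>F. Hd_inner d c (F (0, 0)))"

definition fun_subspace :: "('a \<Rightarrow> complex) set \<Rightarrow> bool" where
  "fun_subspace V \<longleftrightarrow> (\<lambda>_. 0) \<in> V \<and>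
     (\<forall>u\<in>V. \<forall>v\<in>V. (\<lambda>x. u x + v x) \<in> V) \<and> (\<forall>a. \<forall>u\<in>V. (\<lambda>x. a * u x) \<in> V)"

definition linear_isomorphism_on ::
    "('a \<Rightarrow> complex) set \<Rightarrow> ('b \<Rightarrow> complex) set \<Rightarrow> (('a \<Rightarrow> complex) \<Rightarrow> 'b \<Rightarrow> complex) \<Rightarrow> bool" where
  "linear_isomorphism_on V W T \<longleftrightarrow> fun_subspace V \<and> fun_subspace W \<and> bij_betw T V W \<and>
     (\<forall>u\<in>V. \<forall>v\<in>V. T (\<lambda>x. u x + v x) = (\<lambda>y. T u y + T v y)) \<and>
     (\<forall>a. \<forall>u\<in>V. T (\<lambda>x. a * u x) = (\<lambda>y. a * T u y))"

end

theory Submission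
  imports Defs "HOL-Probability.Characteristic_Functions"
begin

text \<open>A code state \<open>\<psi>\<close> is invariant under the modulations by \<open>D\<^bsup>1/2\<^esup> \<int>\<^sup>n\<close>, so \<open>\<langle>\<psi>, h\<rangle>\<close> does not change when
  \<open>h\<close> is replaced by an average of its modulations over a large box. The \<open>M\<^sup>1\<close>-norm of such an average
  is asymptotically at most the integral over one cell of the periodized short-time Fourier
  transform, and by Poisson summation the latter is bounded by the \<open>\<ell>\<^sup>1\<close>-norm of the values of \<open>h\<close> on
  \<open>D\<^bsup>-1/2\<^esup> \<int>\<^sup>n\<close>. Hence \<open>\<langle>\<psi>, h\<rangle>\<close> depends continuously on these values only, and testing with bump
  functions supported near single lattice points gives
  \<open>\<langle>\<psi>, h\<rangle> = (\<Sum>m. \<langle>\<psi>, u(\<cdot> - m)\<rangle> cnj (h m))\<close>. Invariance under the translations by \<open>D\<^bsup>1/2\<^esup> \<int>\<^sup>n\<close> makes the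
  coefficient depend only on the class of \<open>m\<close> in \<open>D\<^bsup>-1/2\<^esup> \<int>\<^sup>n / D\<^bsup>1/2\<^esup> \<int>\<^sup>n\<close>, and collecting the classes
  turns the sum into the pairing with the Zak transform at the origin. Conversely such a pairing is
  bounded on \<open>M\<^sup>1\<close>, since the values of \<open>h\<close> on a lattice are summable with sum bounded by the norm.\<close>

section \<open>Integration on \<open>real^'n\<close>\<close>

text \<open>Modulation invariance by itself only says that \<psi> lives on D^(-1/2) Z^n, which
  leaves room for derivatives of point masses; the estimate by the l1-norm of the lattice values
  rules these out. The triangle inequality cannot give it, as it bounds an average only by the norm
  of h. The gain comes from cancellation: in l1, averages of a sequence a over growing boxes have
  norms approaching |sum a| instead of sum |a|. For the frequency samples of a short-time Fourier
  transform, sum a is a periodization, that is, a Fourier series with coefficients h(m) cnj(\<phi>(m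
  - x)) up to the volume of a cell; integrating their moduli over x leaves the l1-norm of h on the
  lattice times the L1-norm of \<phi>.

  As everything is integrated over a cell, Poisson summation may hold almost everywhere. It can then
  be drawn from the uniqueness of Fourier coefficients of integrable functions, which suits slices
  known only to be continuous and integrable with integrable transform.

  The window is any nonzero Schwartz function and M1 is tied to it, so bumps are shown to lie in M1
  by integration by parts, with derivatives falling on bump and window alike.\<close>

lemma lborel_vec_prod:
  fixes f :: "'n::finite \<Rightarrow> real \<Rightarrow> 'b::{real_normed_field,banach,second_countable_topology}"
  assumes f: "\<And>j. integrable lborel (f j)"
  shows "integrable lborel (\<lambda>x::real^'n. \<Prod>j\<in>UNIV. f j (x $ j))"
    and "(LINT x|lborel. (\<Prod>j\<in>UNIV. f j ((x::real^'n) $ j))) = (\<Prod>j\<in>UNIV. integral\<^sup>L lborel (f j))"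
proof -
  have [measurable]: "f j \<in> borel_measurable borel" for j using f[of j] by auto
  \<comment> \<open>\<open>lborel_eq\<close> writes Lebesgue measure as the image of a product
    measure indexed by \<open>Basis\<close>, not by coordinates; \<open>ix\<close> recovers the
    coordinate from the basis vector, so that the product can be reindexed.\<close>
  define ix where "ix b = (SOME j. b = axis j (1::real))" for b :: "real^'n"
  have ix: "ix (axis j 1) = j" for j unfolding ix_def by (auto simp: axis_eq_axis)
  have B: "(Basis :: (real^'n) set) = range (\<lambda>j. axis j 1)" by (auto simp: Basis_vec_def)
  have inj: "inj (\<lambda>j::'n. axis j (1::real))" by (auto simp: inj_on_def axis_eq_axis)
  have re: "(\<Prod>j\<in>UNIV. f j (x $ j)) = (\<Prod>b\<in>Basis. f (ix b) (x \<bullet> b))" for x :: "real^'n"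
    unfolding B by (subst prod.reindex[OF inj]) (simp add: ix inner_axis)
  have nth: "(\<Sum>b\<in>Basis. g b *\<^sub>R b) \<bullet> c = g c" if "c \<in> Basis" for g and c :: "real^'n"
    using that by (simp add: inner_sum_left_Basis)
  interpret P: product_sigma_finite "\<lambda>_::real^'n. lborel :: real measure"
    by unfold_locales
  have mT: "(\<lambda>g. \<Sum>b\<in>Basis. g b *\<^sub>R b) \<in> (\<Pi>\<^sub>M b\<in>(Basis::(real^'n) set). lborel) \<rightarrow>\<^sub>M borel"
    by measurable
  have cg: "(\<Prod>b\<in>Basis. f (ix b) ((\<Sum>b\<in>Basis. g b *\<^sub>R b) \<bullet> b)) = (\<Prod>b\<in>Basis. f (ix b) (g b))"
     for g :: "real^'n \<Rightarrow> real" by (rule prod.cong) (auto simp: nth)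
  have "integrable (\<Pi>\<^sub>M b\<in>(Basis::(real^'n) set). lborel) (\<lambda>g. \<Prod>b\<in>Basis. f (ix b) (g b))"
    by (rule P.product_integrable_prod) (auto intro: f)
  then show "integrable lborel (\<lambda>x::real^'n. \<Prod>j\<in>UNIV. f j (x $ j))"
    unfolding re by (subst lborel_eq, subst integrable_distr_eq[OF mT]) (auto simp: cg)
  have "(LINT x|lborel. (\<Prod>j\<in>UNIV. f j ((x::real^'n) $ j)))
      = (LINT g|(\<Pi>\<^sub>M b\<in>(Basis::(real^'n) set). lborel). (\<Prod>b\<in>Basis. f (ix b) (g b)))"
    unfolding re by (subst lborel_eq, subst integral_distr[OF mT]) (auto simp: cg)
  also have "\<dots> = (\<Prod>b\<in>(Basis::(real^'n) set). integral\<^sup>L lborel (f (ix b)))"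
    by (rule P.product_integral_prod) (auto intro: f)
  also have "\<dots> = (\<Prod>j\<in>UNIV. integral\<^sup>L lborel (f j))"
    unfolding B by (subst prod.reindex[OF inj]) (simp add: ix)
  finally show "(LINT x|lborel. (\<Prod>j\<in>UNIV. f j ((x::real^'n) $ j)))
    = (\<Prod>j\<in>UNIV. integral\<^sup>L lborel (f j))" .
qed

lemma nn_integral_lborel_affine:
  fixes f :: "'a::euclidean_space \<Rightarrow> ennreal"
  assumes [measurable]: "f \<in> borel_measurable borel" and c: "c \<noteq> 0"
  shows "(\<integral>\<^sup>+x. f x \<partial>lborel) = (\<integral>\<^sup>+x. ennreal (\<bar>c\<bar> ^ DIM('a)) * f (t + c *\<^sub>R x) \<partial>lborel)"
  by (subst lborel_affine[OF c, of t])
     (simp add: nn_integral_density nn_integral_distr)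

lemma integrable_lborel_affine:
  fixes f :: "'a::euclidean_space \<Rightarrow> 'b::{banach,second_countable_topology}"
  assumes f: "integrable lborel f" and c: "c \<noteq> 0"
  shows "integrable lborel (\<lambda>x. f (t + c *\<^sub>R x))"
proof -
  have [measurable]: "f \<in> borel_measurable borel" using f by auto
  have "integrable (density (distr lborel borel (\<lambda>x. t + c *\<^sub>R x)) (\<lambda>_. ennreal (\<bar>c\<bar>^DIM('a)))) f"
    using f lborel_affine[OF c, of t] by simp
  then have "integrable lborel (\<lambda>x. (\<bar>c\<bar>^DIM('a)) *\<^sub>R f (t + c *\<^sub>R x))"
    by (subst (asm) integrable_density) (simp_all add: integrable_distr_eq)
  from integrable_scaleR_right[OF this, of "inverse (\<bar>c\<bar>^DIM('a))"] c show ?thesis by simp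
qed

lemma integral_lborel_affine:
  fixes f :: "'a::euclidean_space \<Rightarrow> 'b::{banach,second_countable_topology}"
  assumes [measurable]: "f \<in> borel_measurable borel" and c: "c \<noteq> 0"
  shows "integral\<^sup>L lborel f = (\<bar>c\<bar>^DIM('a)) *\<^sub>R (LINT x|lborel. f (t + c *\<^sub>R x))"
  by (subst lborel_affine[OF c, of t])
     (simp add: integral_density integral_distr)

lemmas integrable_lborel_shift = integrable_lborel_affine[where c = 1, simplified]
  and integral_lborel_shift = integral_lborel_affine[where c = 1, simplified]
  and nn_integral_lborel_shift = nn_integral_lborel_affine[where c = 1, simplified]
  and integrable_lborel_reflect = integrable_lborel_affine[where c = "-1", simplified]
  and integral_lborel_reflect = integral_lborel_affine[where c = "-1", simplified]
  and nn_integral_lborel_reflect = nn_integral_lborel_affine[where c = "-1", simplified]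

lemma integrable_mult_bounded:
  fixes f g :: "'a \<Rightarrow> complex"
  assumes f: "integrable M f" and g: "g \<in> borel_measurable M" and b: "\<And>x. norm (g x) \<le> B"
  shows "integrable M (\<lambda>x. f x * g x)"
proof (rule Bochner_Integration.integrable_bound)
  show "integrable M (\<lambda>x. B *\<^sub>R f x)" using f by simp
  show "(\<lambda>x. f x * g x) \<in> borel_measurable M" using f g by (intro borel_measurable_times) auto
  have "B \<ge> 0" using b[of undefined] norm_ge_zero order_trans by blast
  then show "AE x in M. norm (f x * g x) \<le> norm (B *\<^sub>R f x)"
    using b by (intro AE_I2) (simp add: norm_mult mult.commute[of B] mult_left_mono)
qed

lemma integrable_inverse_one_plus_square: "integrable lborel (\<lambda>x::real. 1 / (1 + x\<^sup>2))"
proof -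
  have "(arctan has_real_derivative 1 / (1 + x\<^sup>2)) (at x)" for x
    using DERIV_arctan[of x] by (simp add: inverse_eq_divide)
  then have "set_integrable lborel (einterval (-\<infinity>) \<infinity>) (\<lambda>x. 1 / (1 + x\<^sup>2))"
    using interval_integral_FTC_nonneg(1)[of "-\<infinity>" "\<infinity>" arctan "\<lambda>x. 1 / (1 + x\<^sup>2)" "-pi/2" "pi/2"]
    using tendsto_arctan_at_top tendsto_arctan_at_bot
    by (auto intro!: continuous_intros simp: ereal_tendsto_simps add_nonneg_eq_0_iff)
  then show ?thesis by (simp add: set_integrable_def einterval_def)
qed

lemma integrable_vec_decay:
  "integrable lborel (\<lambda>x::real^'n. \<Prod>j\<in>UNIV. 1 / (1 + (x $ j)\<^sup>2))"
  by (rule lborel_vec_prod(1)) (rule integrable_inverse_one_plus_square)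

text \<open>Each coordinate satisfies 1 + x_j^2 \<le> (1 + norm x)^2, hence the exponent of twice
  the dimension. This reduces radial decay to a product of one-dimensional integrable
  functions.\<close>

lemma decay_le_vec_decay:
  "1 / (1 + norm (x::real^'n)) ^ (2 * CARD('n)) \<le> (\<Prod>j\<in>UNIV. 1 / (1 + (x $ j)\<^sup>2))"
proof -
  have "(\<Prod>j\<in>UNIV. 1 + (x $ j)\<^sup>2) \<le> (\<Prod>j\<in>(UNIV::'n set). (1 + norm x)\<^sup>2)"
  proof (rule prod_mono)
    fix j
    have "(x $ j)\<^sup>2 \<le> (norm x)\<^sup>2" using component_le_norm_cart[of x j] by (simp add: power2_le_iff_abs_le)
    then show "0 \<le> 1 + (x $ j)\<^sup>2 \<and> 1 + (x $ j)\<^sup>2 \<le> (1 + norm x)\<^sup>2"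
      by (auto simp: power2_eq_square algebra_simps intro: add_increasing2)
  qed
  moreover have "(\<Prod>j\<in>UNIV. 1 + (x $ j)\<^sup>2) > 0" by (intro prod_pos) (auto simp: add_pos_nonneg)
  ultimately show ?thesis
    by (simp add: prod_dividef power_mult frac_le)
qed

lemma integrable_decay:
  "integrable lborel (\<lambda>x::real^'n. 1 / (1 + norm x) ^ (2 * CARD('n)))"
  by (rule Bochner_Integration.integrable_bound[OF integrable_vec_decay])
     (auto intro!: AE_I2 decay_le_vec_decay simp: abs_of_nonneg prod_nonneg)

section \<open>Fourier inversion\<close>

definition fourier :: "('a::euclidean_space \<Rightarrow> complex) \<Rightarrow> 'a \<Rightarrow> complex" where
  "fourier f w = (LINT t|lborel. f t * cis (- 2 * pi * (w \<bullet> t)))"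

lemma norm_fourier_le: "norm (fourier f w) \<le> (LINT t|lborel. norm (f t))"
  unfolding fourier_def by (rule order_trans[OF integral_norm_bound]) (simp add: norm_mult)

abbreviation e2pi :: "real \<Rightarrow> complex" where
  "e2pi x \<equiv> cis (2 * pi * x)"

lemma borel_measurable_cis [measurable]:
  assumes [measurable]: "f \<in> borel_measurable M"
  shows "(\<lambda>x. cis (f x)) \<in> borel_measurable M"
  unfolding cis_conv_exp by measurable

lemma integrable_mult_cis:
  fixes f :: "'a \<Rightarrow> complex"
  assumes "integrable M f" and [measurable]: "g \<in> borel_measurable M"
  shows "integrable M (\<lambda>t. f t * cis (g t))"
proof -
  have [measurable]: "f \<in> borel_measurable M" using assms(1) by auto
  show ?thesis by (rule Bochner_Integration.integrable_bound[OF assms(1)]) (auto simp: norm_mult)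
qed

section \<open>The Gaussian and its Fourier transform\<close>

definition gauss :: "'a::euclidean_space \<Rightarrow> real" where
  "gauss x = exp (- (norm x)\<^sup>2 / 2)"

text \<open>This is the characteristic function of the standard normal law, freed of its normalising
  factor \<open>sqrt (2 * pi)\<close>.\<close>

lemma gauss_1d:
  fixes t :: real
  shows "integrable lborel (\<lambda>x. complex_of_real (exp (- x\<^sup>2 / 2)) * cis (t * x))"
    and "(LINT x|lborel. complex_of_real (exp (- x\<^sup>2 / 2)) * cis (t * x))
       = complex_of_real (sqrt (2 * pi) * exp (- t\<^sup>2 / 2))"
proof -
  have s: "std_normal_density x = exp (- x\<^sup>2 / 2) / sqrt (2 * pi)" for x
    by (simp add: std_normal_density_def)
  have "integrable lborel std_normal_density"
    using integrable_normal_density[of 1 0] by simp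
  then have "integrable lborel (\<lambda>x. complex_of_real (sqrt (2*pi) * std_normal_density x))"
    by simp
  then have "integrable lborel (\<lambda>x. complex_of_real (exp (- x\<^sup>2 / 2)))" by (simp add: s)
  then show "integrable lborel (\<lambda>x. complex_of_real (exp (- x\<^sup>2 / 2)) * cis (t * x))"
    by (rule integrable_mult_cis) simp
  have "complex_of_real (exp (- t\<^sup>2 / 2)) = char std_normal_distribution t"
    by (simp add: char_std_normal_distribution)
  also have "\<dots> = (LINT x|lborel. std_normal_density x *\<^sub>R cis (t * x))"
    unfolding char_def by (subst integral_density) (auto simp: cis_conv_exp mult_ac)
  also have "\<dots> = (LINT x|lborel. (complex_of_real (exp (- x\<^sup>2 / 2)) * cis (t * x)) / sqrt (2 * pi))"
    by (simp add: s scaleR_conv_of_real)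
  also have "\<dots> = (LINT x|lborel. (complex_of_real (exp (- x\<^sup>2 / 2)) * cis (t * x))) / sqrt (2 * pi)"
    by simp
  finally show "(LINT x|lborel. complex_of_real (exp (- x\<^sup>2 / 2)) * cis (t * x))
       = complex_of_real (sqrt (2 * pi) * exp (- t\<^sup>2 / 2))"
    by (simp add: field_simps del: of_real_mult) (simp add: field_simps)
qed

lemma cis_sum: "finite A \<Longrightarrow> cis (\<Sum>i\<in>A. f i) = (\<Prod>i\<in>A. cis (f i))"
  by (induction A rule: finite_induct) (simp_all flip: cis_mult)

lemma gauss_prod: "gauss (x::real^'n) = (\<Prod>j\<in>UNIV. exp (- (x $ j)\<^sup>2 / 2))"
  by (simp add: gauss_def norm_vec_def L2_set_def sum_nonneg exp_sum sum_negf sum_divide_distrib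
    flip: sum_negf)

lemma gauss_fourier:
  fixes t :: "real^'n"
  shows "integrable lborel (\<lambda>x. complex_of_real (gauss x) * cis (t \<bullet> x))"
    and "(LINT x|lborel. complex_of_real (gauss x) * cis (t \<bullet> x))
       = complex_of_real (sqrt (2 * pi) ^ CARD('n) * gauss t)"
proof -
  have e: "complex_of_real (gauss x) * cis (t \<bullet> x)
      = (\<Prod>j\<in>UNIV. complex_of_real (exp (- (x $ j)\<^sup>2 / 2)) * cis (t $ j * x $ j))" for x :: "real^'n"
    by (simp add: gauss_prod inner_vec_def cis_sum prod.distrib)
  show "integrable lborel (\<lambda>x. complex_of_real (gauss x) * cis (t \<bullet> x))"
    unfolding e by (rule lborel_vec_prod(1)) (rule gauss_1d(1))
  show "(LINT x|lborel. complex_of_real (gauss x) * cis (t \<bullet> x))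
       = complex_of_real (sqrt (2 * pi) ^ CARD('n) * gauss t)"
    unfolding e lborel_vec_prod(2)[OF gauss_1d(1)] gauss_1d(2)
    by (simp add: gauss_prod prod.distrib)
qed

lemma gauss_le_1: "gauss x \<le> 1" and gauss_pos: "gauss x > 0"
  by (auto simp: gauss_def)

lemma borel_measurable_gauss [measurable]: "gauss \<in> borel_measurable borel"
  unfolding gauss_def[abs_def] by measurable

text \<open>From exp y \<ge> (1 + y / n)^n \<ge> (y / n)^n at y = (norm x)^2 / 2. In
  \<open>fourier_inversion\<close>, order 2n beats the factor N^n of the rescaled kernel and leaves
  an integrable weight.\<close>

lemma gauss_decay:
  assumes "x \<noteq> 0" shows "gauss x \<le> (2 * real n) ^ n / norm x ^ (2 * n)"
proof (cases "n = 0")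
  case True then show ?thesis by (simp add: gauss_le_1)
next
  case False
  have "((norm x)\<^sup>2 / 2 / n) ^ n \<le> (1 + (norm x)\<^sup>2 / 2 / n) ^ n"
    by (intro power_mono) auto
  also have "\<dots> \<le> exp ((norm x)\<^sup>2 / 2)"
    using exp_ge_one_plus_x_over_n_power_n[of n "(norm x)\<^sup>2 / 2"] False
      by (simp add: order_trans[of "- (real n * 2)" 0])
  finally have "norm x ^ (2 * n) / (2 * real n) ^ n \<le> exp ((norm x)\<^sup>2 / 2)"
    by (simp add: power_divide power_mult[symmetric] mult_ac power_mult_distrib)
  then show ?thesis using assms False
    by (simp add: gauss_def exp_minus field_simps)
qed

lemma integrable_pair_mult:
  fixes f :: "'a::euclidean_space \<Rightarrow> complex" and g :: "'b::euclidean_space \<Rightarrow> complex"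
  assumes f: "integrable lborel f" and g: "integrable lborel g"
  shows "integrable (lborel \<Otimes>\<^sub>M lborel) (\<lambda>(x, y). f x * g y)"
proof (rule lborel_pair.Fubini_integrable)
  have [measurable]: "f \<in> borel_measurable borel" "g \<in> borel_measurable borel" using f g by auto
  show "(\<lambda>(x, y). f x * g y) \<in> borel_measurable (lborel \<Otimes>\<^sub>M lborel)" by measurable
qed (use f g in \<open>auto simp: norm_mult\<close>)

text \<open>The Gaussian factor makes the double integral absolutely convergent. Fubini then leaves
  the frequency integral to the Gaussian alone, whose transform is again a Gaussian, now of width
  about 1 / N.\<close>

lemma fourier_inversion_gauss:
  fixes f :: "real^'n \<Rightarrow> complex"
  assumes f: "integrable lborel f" and N: "N > 0"
  shows "(LINT w|lborel. fourier f w * e2pi (w \<bullet> y) * of_real (gauss (w /\<^sub>R N)))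
    = (LINT s|lborel. f (y - s) * of_real (sqrt (2 * pi) ^ CARD('n) * N ^ CARD('n) * gauss ((2 * pi
      * N) *\<^sub>R s)))"
proof -
  have [measurable]: "f \<in> borel_measurable borel" using f by auto
  have gi: "integrable lborel (\<lambda>w::real^'n. complex_of_real (gauss (w /\<^sub>R N)))"
    using integrable_lborel_affine[OF gauss_fourier(1)[of "0::real^'n"], of "inverse N" 0] N by simp
  define H where "H = (\<lambda>(w :: real^'n, t). f t * e2pi (w \<bullet> (y - t)) * of_real (gauss (w /\<^sub>R N)))"
  have "integrable (lborel \<Otimes>\<^sub>M lborel) (\<lambda>(w :: real^'n, t). complex_of_real (gauss (w /\<^sub>R N)) * f t)"
    by (rule integrable_pair_mult[OF gi f])
  then have Hi: "integrable (lborel \<Otimes>\<^sub>M lborel) H"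
    by (rule Bochner_Integration.integrable_bound) (auto simp: H_def norm_mult split_beta intro!:
      borel_measurable_times)
  have "(LINT w|lborel. fourier f w * e2pi (w \<bullet> y) * of_real (gauss (w /\<^sub>R N)))
     = (LINT w|lborel. LINT t|lborel. H (w, t))"
  proof (rule Bochner_Integration.integral_cong[OF refl])
    fix w :: "real^'n"
    have "(LINT t|lborel. H (w, t)) = (LINT t|lborel. (e2pi (w \<bullet> y) * of_real (gauss (w /\<^sub>R N)))
      * (f t * cis (- 2 * pi * (w \<bullet> t))))"
    proof (rule Bochner_Integration.integral_cong[OF refl])
      fix t
      have "e2pi (w \<bullet> (y - t)) = e2pi (w \<bullet> y) * cis (- 2 * pi * (w \<bullet> t))"
        by (simp add: cis_mult inner_diff_right algebra_simps)
      then show "H (w, t) = e2pi (w \<bullet> y) * of_real (gauss (w /\<^sub>R N)) * (f t * cis (- 2 * pi * (w \<bullet> t)))"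
        by (simp add: H_def)
    qed
    then show "fourier f w * e2pi (w \<bullet> y) * of_real (gauss (w /\<^sub>R N)) = (LINT t|lborel. H (w, t))"
      by (simp add: fourier_def)
  qed
  also have "\<dots> = (LINT t|lborel. LINT w|lborel. H (w, t))"
    using lborel_pair.Fubini_integral[of "\<lambda>t w. H (w, t)"] Hi lborel_pair.integrable_product_swap[OF Hi]
    by simp
  also have "\<dots> = (LINT t|lborel. f t * of_real (sqrt (2 * pi) ^ CARD('n) * N ^ CARD('n) * gauss ((2
    * pi * N) *\<^sub>R (y - t))))"
  proof (rule Bochner_Integration.integral_cong[OF refl])
    fix t :: "real^'n"
    have "(LINT w|lborel. H (w, t)) = f t * (LINT w|lborel. complex_of_real (gauss (w /\<^sub>R N))
      * cis ((2 * pi) *\<^sub>R (y - t) \<bullet> w))"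
      unfolding H_def by (simp add: inner_commute mult_ac flip: integral_mult_right_zero)
    also have "(LINT w|lborel. complex_of_real (gauss (w /\<^sub>R N)) * cis ((2 * pi) *\<^sub>R (y - t) \<bullet> w))
      = N ^ CARD('n) *\<^sub>R (LINT w|lborel. complex_of_real (gauss w) * cis ((2 * pi * N) *\<^sub>R (y - t) \<bullet> w))"
      using N by (subst integral_lborel_affine[where c = N and t = 0]) (simp_all add: mult_ac)
    finally show "(LINT w|lborel. H (w, t)) = f t * of_real (sqrt (2 * pi) ^ CARD('n) * N ^ CARD('n)
      * gauss ((2 * pi * N) *\<^sub>R (y - t)))"
      unfolding gauss_fourier(2) by (simp add: scaleR_conv_of_real)
  qed
  also have "\<dots> = (LINT s|lborel. f (y - s) * of_real (sqrt (2 * pi) ^ CARD('n) * N ^ CARD('n)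
    * gauss ((2 * pi * N) *\<^sub>R s)))"
    by (subst integral_lborel_reflect[where t = y]) simp_all
  finally show ?thesis .
qed

text \<open>The regularised integrals \<open>A k\<close> have two limits: the inversion integral, by
  dominated convergence with the integrable \<open>fourier f\<close>, and \<open>f y\<close>, since
  \<open>K k\<close> is an approximate identity and \<open>f\<close> is continuous at
  \<open>y\<close>.\<close>

lemma fourier_inversion:
  fixes f :: "real^'n \<Rightarrow> complex"
  assumes f: "integrable lborel f" "continuous_on UNIV f" and F: "integrable lborel (fourier f)"
  shows "(LINT w|lborel. fourier f w * e2pi (w \<bullet> y)) = f y"
proof -
  define n where "n = CARD('n)"
  have n: "n > 0" by (simp add: n_def)
  have [measurable]: "f \<in> borel_measurable borel" "fourier f \<in> borel_measurable borel" using f F by auto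
  define c where "c = sqrt (2 * pi) ^ n"
  have c: "c > 0" by (simp add: c_def)
  define K where "K k s = c * real (Suc k) ^ n * gauss ((2 * pi * real (Suc k)) *\<^sub>R (s::real^'n))"
    for k s
  define A where "A k = (LINT s|lborel. f (y - s) * of_real (K k s))" for k
  have Km[measurable]: "K k \<in> borel_measurable borel" for k unfolding K_def by measurable
  have K0: "K k s \<ge> 0" for k s using c gauss_pos[of "(2 * pi * real (Suc k)) *\<^sub>R s"]
    by (auto simp: K_def)
  have Kb: "K k s \<le> c * real (Suc k) ^ n" for k s
    unfolding K_def using c by (intro mult_left_le gauss_le_1) auto
  have gi: "integrable lborel (\<lambda>s::real^'n. gauss s)"
    using integrable_norm[OF gauss_fourier(1)[of "0::real^'n"]] by (simp add: abs_of_pos[OF gauss_pos])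
  have Ki: "integrable lborel (K k)" for k
    unfolding K_def using integrable_lborel_affine[OF gi, of "2 * pi * real (Suc k)" 0] by simp
  have g1: "(LINT s|lborel. gauss (s::real^'n)) = c"
    using gauss_fourier(2)[of "0::real^'n"] by (simp add: c_def n_def gauss_def flip: of_real_power)
  \<comment> \<open>Rescaling gives the kernel total mass c * c / (2 * pi)^n, and c is a power of
    \<open>sqrt (2 * pi)\<close> with square (2 * pi)^n.\<close>
  have K1: "integral\<^sup>L lborel (K k) = 1" for k
  proof -
    have "c = (2 * pi * real (Suc k)) ^ n * (LINT s|lborel. gauss ((2 * pi * real (Suc k)) *\<^sub>R
      (s::real^'n)))"
      unfolding g1[symmetric] by (subst integral_lborel_affine[where c
        = "2 * pi * real (Suc k)" and t = 0])
        (simp_all add: n_def)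
    moreover have "integral\<^sup>L lborel (K k) = c * real (Suc k) ^ n * (LINT s|lborel. gauss ((2 * pi
      * real (Suc k)) *\<^sub>R (s::real^'n)))"
      unfolding K_def by simp
    moreover have "c * c = (2 * pi) ^ n"
      unfolding c_def power_mult_distrib[symmetric] by simp
    ultimately have "integral\<^sup>L lborel (K k) * (2 * pi) ^ n = c * c"
      unfolding power_mult_distrib by (simp add: mult_ac)
    then show ?thesis using \<open>c * c = (2 * pi) ^ n\<close> by simp
  qed
  have lim1: "A \<longlonglongrightarrow> (LINT w|lborel. fourier f w * e2pi (w \<bullet> y))"
  proof -
    have A: "A k = (LINT w|lborel. fourier f w * e2pi (w \<bullet> y) * of_real (gauss (w /\<^sub>R real (Suc
      k))))" for k
      unfolding A_def K_def n_def c_def using fourier_inversion_gauss[OF f(1), of "real (Suc k)" y]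
        by simp
    show ?thesis unfolding A
    proof (rule integral_dominated_convergence[where w = "\<lambda>w. norm (fourier f w)"])
      show "AE x in lborel. (\<lambda>k. fourier f x * e2pi (x \<bullet> y) * of_real (gauss (x /\<^sub>R real (Suc k))))
         \<longlonglongrightarrow> fourier f x * e2pi (x \<bullet> y)"
      proof (rule AE_I2)
        fix x :: "real^'n"
        have "(\<lambda>k. complex_of_real (exp (- (norm (x /\<^sub>R real (Suc k)))\<^sup>2 / 2)))
          \<longlonglongrightarrow> complex_of_real (exp (- (norm (0 *\<^sub>R x))\<^sup>2 / 2))"
          by (intro tendsto_intros LIMSEQ_inverse_real_of_nat) auto
        then have "(\<lambda>k. complex_of_real (gauss (x /\<^sub>R real (Suc k)))) \<longlonglongrightarrow> 1" by (simp add: gauss_def)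
        from tendsto_mult[OF tendsto_const this, of "fourier f x * e2pi (x \<bullet> y)"]
        show "(\<lambda>k. fourier f x * e2pi (x \<bullet> y) * of_real (gauss (x /\<^sub>R real (Suc k))))
         \<longlonglongrightarrow> fourier f x * e2pi (x \<bullet> y)" by simp
      qed
      fix k show "AE x in lborel. norm (fourier f x * e2pi (x \<bullet> y) * of_real (gauss (x /\<^sub>R real (Suc
        k)))) \<le> norm (fourier f x)"
        by (intro AE_I2) (simp add: norm_mult abs_of_pos[OF gauss_pos] mult_left_le gauss_le_1)
    qed (use F in auto)
  qed
  have fi: "integrable lborel (\<lambda>s. f (y - s))" by (rule integrable_lborel_reflect[OF f(1)])
  have fK: "integrable lborel (\<lambda>s. f (y - s) * of_real (K k s))" for k
  proof (rule Bochner_Integration.integrable_bound)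
    show "integrable lborel (\<lambda>s. (c * real (Suc k) ^ n) *\<^sub>R f (y - s))" using fi by simp
    show "AE s in lborel. norm (f (y - s) * of_real (K k s)) \<le> norm ((c * real (Suc k) ^ n) *\<^sub>R f (y
      - s))"
    proof (rule AE_I2)
      fix s
      have "K k s * norm (f (y - s)) \<le> (c * real (Suc k) ^ n) * norm (f (y - s))"
        using Kb by (intro mult_right_mono) auto
      then show "norm (f (y - s) * of_real (K k s)) \<le> norm ((c * real (Suc k) ^ n) *\<^sub>R f (y - s))"
        using K0[of k s] c by (simp only: norm_mult norm_of_real norm_scaleR abs_of_nonneg
          mult.commute[of "norm (f (y - s))"]) simp
    qed
  qed measurable
  have "A \<longlonglongrightarrow> f y"
  proof (rule LIMSEQ_I)
    fix e :: real assume e: "e > 0"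
    have "isCont f y" using f(2) by (simp add: continuous_on_eq_continuous_at)
    then obtain \<delta> where \<delta>: "\<delta> > 0" "\<And>x. dist x y < \<delta> \<Longrightarrow> dist (f x) (f y) < e / 2"
      unfolding continuous_at_eps_delta using e by (metis half_gt_zero)
    \<comment> \<open>For norm s \<ge> \<delta> one has 1 + norm s \<le> (1 + 1 / \<delta>) * norm
      s; this factor trades 1 / (norm s)^(2n) for the weight \<open>g s\<close>.\<close>
    define D where "D = c * (2 * real n) ^ n * (1 + 1 / \<delta>) ^ (2 * n)"
    have D: "D > 0" using c n \<delta> by (auto simp: D_def intro!: mult_pos_pos zero_less_power add_pos_pos)
    define g where "g s = 1 / (1 + norm (s::real^'n)) ^ (2 * n)" for s
    have wi: "integrable lborel g" unfolding g_def n_def by (rule integrable_decay)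
    have w1: "g s \<le> 1" "g s \<ge> 0" for s by (auto simp: g_def divide_le_eq one_le_power)
    \<comment> \<open>\<open>f\<close> may be unbounded, so it is not enough that the kernel has
      small mass away from 0: its values must be small there. The weight \<open>g\<close> is bounded
      by 1, for the term f (y - s), and integrable, for the constant term f y.\<close>
    have far: "K k s \<le> D / real (Suc k) ^ n * g s" if "norm s \<ge> \<delta>" for k s
    proof -
      have s: "norm s > 0" using that \<delta> by linarith
      have "K k s \<le> c * real (Suc k) ^ n * ((2 * real n) ^ n / norm ((2 * pi * real (Suc k)) *\<^sub>R s) ^
        (2 * n))"
        unfolding K_def using c s by (intro mult_left_mono gauss_decay) auto
      also have "\<dots> \<le> c * real (Suc k) ^ n * ((2 * real n) ^ n / (real (Suc k) * norm s) ^ (2 * n))"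
      proof (intro mult_left_mono divide_left_mono power_mono)
        show "real (Suc k) * norm s \<le> norm ((2 * pi * real (Suc k)) *\<^sub>R s)"
          using s pi_ge_two by (auto simp: abs_mult intro!: mult_right_mono)
      qed (use c s in auto)
      also have "\<dots> = c * (2 * real n) ^ n / real (Suc k) ^ n * (1 / norm s ^ (2 * n))"
        unfolding power_mult_distrib mult_2 power_add by (simp del: of_nat_Suc)
      also have "\<dots> \<le> c * (2 * real n) ^ n / real (Suc k) ^ n * ((1 + 1 / \<delta>) ^ (2 * n) * g s)"
      proof (intro mult_left_mono)
        have "1 + norm s \<le> (1 + 1 / \<delta>) * norm s" using that \<delta> s by (simp add: field_simps)
        then have "(1 + norm s) ^ (2*n) \<le> ((1 + 1 / \<delta>) * norm s) ^ (2*n)" by (intro power_mono) auto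
        then show "1 / norm s ^ (2 * n) \<le> (1 + 1 / \<delta>) ^ (2 * n) * g s"
          using s by (simp add: g_def power_mult_distrib divide_simps add_pos_pos)
      qed (use c in auto)
      finally show ?thesis by (simp add: D_def mult_ac)
    qed
    define J where "J = (LINT s|lborel. norm (f (y - s)) + norm (f y) * g s)"
    have Ji: "integrable lborel (\<lambda>s. norm (f (y - s)) + norm (f y) * g s)" using fi wi by simp
    have bound: "norm (A k - f y) \<le> e / 2 + D * J / real (Suc k) ^ n" for k
    proof -
      have "f y = (LINT s|lborel. f y * of_real (K k s))"
        using K1[of k] by (simp add: integral_complex_of_real)
      then have "A k - f y = (LINT s|lborel. f (y - s) * of_real (K k s) - f y * of_real (K k s))"
        unfolding A_def using fK Ki[of k] by (subst Bochner_Integration.integral_diff) auto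
      also have "norm \<dots> \<le> (LINT s|lborel. e / 2 * K k s + D / real (Suc k) ^ n * (norm (f (y - s))
        + norm (f y) * g s))"
      proof (rule order_trans[OF integral_norm_bound], rule integral_mono)
        show "integrable lborel (\<lambda>s. norm (f (y - s) * of_real (K k s) - f y * of_real (K k s)))"
          using fK[of k] Ki[of k] by auto
        show "integrable lborel (\<lambda>s. e / 2 * K k s + D / real (Suc k) ^ n * (norm (f (y - s))
          + norm (f y) * g s))"
          using Ki[of k] Ji by simp
        fix s :: "real^'n"
        have eq: "norm (f (y - s) * of_real (K k s) - f y * of_real (K k s))
          = norm (f (y - s) - f y) * K k s"
          using K0[of k s] by (simp add: norm_mult flip: left_diff_distrib)
        show "norm (f (y - s) * of_real (K k s) - f y * of_real (K k s))
          \<le> e / 2 * K k s + D / real (Suc k) ^ n * (norm (f (y - s)) + norm (f y) * g s)"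
        proof (cases "norm s < \<delta>")
          case True
          then have "norm (f (y - s) - f y) \<le> e / 2" using \<delta>(2)[of "y - s"]
            by (simp add: dist_norm less_imp_le)
          then have "norm (f (y - s) - f y) * K k s \<le> e / 2 * K k s" using K0
            by (intro mult_right_mono) auto
          moreover have "0 \<le> D / real (Suc k) ^ n * (norm (f (y - s)) + norm (f y) * g s)"
            using D w1 by auto
          ultimately show ?thesis unfolding eq by linarith
        next
          case False
          have "norm (f (y - s) - f y) * K k s \<le> (norm (f (y - s)) + norm (f y)) * (D / real (Suc k)
            ^ n * g s)"
            using False far[of s k] K0[of k s] by (intro mult_mono norm_triangle_ineq4) auto
          also have "\<dots> = D / real (Suc k) ^ n * (norm (f (y - s)) * g s + norm (f y) * g s)"
            by (simp add: algebra_simps add_divide_distrib)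
          also have "\<dots> \<le> D / real (Suc k) ^ n * (norm (f (y - s)) + norm (f y) * g s)"
            using D w1 by (intro mult_left_mono add_right_mono mult_left_le) auto
          finally show ?thesis unfolding eq using e K0[of k s] by (simp add: add_increasing)
        qed
      qed
      also have "\<dots> = e / 2 + D / real (Suc k) ^ n * J"
        using Ki[of k] Ji K1[of k] unfolding J_def by (subst Bochner_Integration.integral_add) auto
      finally show ?thesis by simp
    qed
    have "(\<lambda>k. D * J * inverse (real (Suc k)) ^ n) \<longlonglongrightarrow> D * J * 0 ^ n"
      by (intro tendsto_intros LIMSEQ_inverse_real_of_nat)
    then have "(\<lambda>k. D * J / real (Suc k) ^ n) \<longlonglongrightarrow> 0" using n by (simp add: field_simps power_0_left)
    from LIMSEQ_D[OF this half_gt_zero[OF e]]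
    obtain k0 where "\<And>k. k \<ge> k0 \<Longrightarrow> \<bar>D * J / real (Suc k) ^ n\<bar> < e / 2" by auto
    then show "\<exists>no. \<forall>k\<ge>no. norm (A k - f y) < e"
      using bound by (intro exI[of _ k0]) (smt (verit) field_sum_of_halves)
  qed
  with lim1 show ?thesis by (rule LIMSEQ_unique)
qed

section \<open>Lattices and periodization\<close>

abbreviation counting :: "'a measure" where
  "counting \<equiv> count_space UNIV"

abbreviation nn_sum :: "('a \<Rightarrow> ennreal) \<Rightarrow> ennreal" (binder "\<Sum>\<^sup>+" [60] 60) where
  "nn_sum f \<equiv> integral\<^sup>N counting f"

abbreviation int_sum :: "('a \<Rightarrow> 'b::{banach,second_countable_topology}) \<Rightarrow> 'b" (binder "\<Sum>\<^sup>L" [60] 60) where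
  "int_sum f \<equiv> integral\<^sup>L counting f"

lemma measurable_pair_count_space:
  fixes f :: "'a \<Rightarrow> 'i::countable \<Rightarrow> 'b"
  assumes "\<And>i. (\<lambda>x. f x i) \<in> M \<rightarrow>\<^sub>M N"
  shows "(\<lambda>(x, i). f x i) \<in> M \<Otimes>\<^sub>M count_space (UNIV :: 'i set) \<rightarrow>\<^sub>M N"
proof -
  have "(\<lambda>(i, x). f x i) \<in> count_space (UNIV :: 'i set) \<Otimes>\<^sub>M M \<rightarrow>\<^sub>M N"
    using assms by (intro measurable_pair_measure_countable1) auto
  from measurable_pair_swap[OF this] show ?thesis by simp
qed

lemma borel_measurable_nn_integral_count_space [measurable (raw)]:
  fixes f :: "'i::countable \<Rightarrow> 'a \<Rightarrow> ennreal"
  assumes "\<And>i. f i \<in> borel_measurable M"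
  shows "(\<lambda>x. \<integral>\<^sup>+i. f i x \<partial>counting) \<in> borel_measurable M"
proof -
  interpret C: sigma_finite_measure "count_space (UNIV :: 'i set)"
    by (rule sigma_finite_measure_count_space)
  have "(\<lambda>(x, i). f i x) \<in> borel_measurable (M \<Otimes>\<^sub>M count_space (UNIV :: 'i set))"
    using assms by (rule measurable_pair_count_space)
  then show ?thesis by (rule C.borel_measurable_nn_integral)
qed

lemma nn_integral_count_space_swap:
  fixes f :: "'i::countable \<Rightarrow> 'a \<Rightarrow> ennreal"
  assumes "sigma_finite_measure M" "\<And>i. f i \<in> borel_measurable M"
  shows "(\<Sum>\<^sup>+ i. \<integral>\<^sup>+x. f i x \<partial>M) = (\<integral>\<^sup>+x. \<integral>\<^sup>+i. f i x \<partial>counting \<partial>M)"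
proof -
  interpret M: sigma_finite_measure M by fact
  interpret C: sigma_finite_measure "count_space (UNIV :: 'i set)"
    by (rule sigma_finite_measure_count_space)
  interpret P: pair_sigma_finite M "count_space (UNIV :: 'i set)" ..
  show ?thesis
    using P.Fubini'[of "\<lambda>x i. f i x"] measurable_pair_count_space[of "\<lambda>x i. f i x" M borel] assms(2)
      by simp
qed

text \<open>The spacing is a parameter because both D^(1/2) Z^n and its dual D^(-1/2) Z^n
  occur.\<close>

definition lat :: "('n \<Rightarrow> real) \<Rightarrow> int^'n \<Rightarrow> real^'n" where
  "lat s k = (\<chi> j. s j * of_int (k $ j))"

definition cell :: "('n::finite \<Rightarrow> real) \<Rightarrow> (real^'n) set" where
  "cell s = {w. \<forall>j. 0 \<le> w $ j \<and> w $ j < s j}"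

text \<open>A density rather than a restricted space: the carrier stays \<open>UNIV\<close>, so
  periodic functions are integrated over a cell without changing their domain.\<close>

definition cell_measure :: "('n::finite \<Rightarrow> real) \<Rightarrow> (real^'n) measure" where
  "cell_measure s = density lborel (indicator (cell s))"

lemma lat_add: "lat s (k + l) = lat s k + lat s l"
  and lat_diff: "lat s (k - l) = lat s k - lat s l"
  and lat_minus: "lat s (- k) = - lat s k"
  and lat_0 [simp]: "lat s 0 = 0"
  by (auto simp: lat_def vec_eq_iff algebra_simps)

lemma lat_inner_dual:
  assumes "\<And>j. s j > 0"
  shows "lat (\<lambda>j. 1 / s j) k \<bullet> lat s l = of_int (\<Sum>j\<in>UNIV. k $ j * l $ j)"
  unfolding lat_def inner_vec_def using assms by (simp add: less_imp_neq[symmetric])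

lemma sets_cell [measurable]: "cell s \<in> sets borel"
  unfolding cell_def by measurable

lemma sets_cell_measure [measurable_cong, simp]: "sets (cell_measure s) = sets borel"
  and space_cell_measure [simp]: "space (cell_measure s) = UNIV"
  by (auto simp: cell_measure_def)

lemma AE_cell_measure: "(AE x in cell_measure s. P x) \<longleftrightarrow> (AE x in lborel. x \<in> cell s \<longrightarrow> P x)"
  unfolding cell_measure_def by (subst AE_density) (auto simp: indicator_def)

lemma emeasure_cell_measure_finite: "emeasure (cell_measure s) (space (cell_measure s)) < \<infinity>"
proof -
  have "cell s \<subseteq> cbox 0 (\<chi> j. s j)" by (auto simp: cell_def mem_box_cart less_imp_le)
  then have b: "bounded (cell s)" by (rule bounded_subset[OF bounded_cbox])
  have "emeasure (cell_measure s) UNIV = (\<integral>\<^sup>+x. indicator (cell s) x \<partial>lborel)"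
    unfolding cell_measure_def by (subst emeasure_density) (auto intro!: nn_integral_cong)
  also have "\<dots> = emeasure lborel (cell s)"
    by (rule nn_integral_indicator) (simp add: sets_cell)
  also have "\<dots> < \<infinity>" by (rule emeasure_bounded_finite[OF b])
  finally show ?thesis unfolding space_cell_measure .
qed

interpretation cell: finite_measure "cell_measure s" for s :: "'n::finite \<Rightarrow> real"
  by (rule finite_measureI) (use emeasure_cell_measure_finite[of s] in \<open>metis less_irrefl\<close>)

lemma cell_unique:
  assumes s: "\<And>j. s j > 0"
  shows "w - lat s l \<in> cell s \<longleftrightarrow> l = (\<chi> j. \<lfloor>w $ j / s j\<rfloor>)"
proof -
  have "(0 \<le> w $ j - s j * of_int (l $ j) \<and> w $ j - s j * of_int (l $ j) < s j) \<longleftrightarrow> l $ j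
    = \<lfloor>w $ j / s j\<rfloor>" for j
    using s[of j] unfolding floor_eq_iff eq_commute[of "l $ j"] by (auto simp: field_simps)
  then show ?thesis by (simp add: cell_def lat_def vec_eq_iff)
qed

text \<open>Every point lies in exactly one translate of the half-open cell. As an equality of
  measures this transfers nonnegative integrals, integrability and Bochner integrals at once, with
  Fubini on the product of cell and lattice.\<close>

lemma tiling:
  fixes s :: "'n::finite \<Rightarrow> real"
  assumes s: "\<And>j. s j > 0"
  shows "distr (cell_measure s \<Otimes>\<^sub>M counting) lborel (\<lambda>(w, l). w + lat s l) = lborel"
proof (rule measure_eqI)
  interpret C: sigma_finite_measure "count_space (UNIV :: (int^'n) set)"
    by (rule sigma_finite_measure_count_space)
  interpret P: pair_sigma_finite "cell_measure s" "count_space (UNIV :: (int^'n) set)" ..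
  have T: "(\<lambda>(w, l). w + lat s l) \<in> cell_measure s \<Otimes>\<^sub>M counting \<rightarrow>\<^sub>M lborel"
    by (rule measurable_pair_count_space) simp
  fix A assume "A \<in> sets (distr (cell_measure s \<Otimes>\<^sub>M counting) lborel (\<lambda>(w, l). w + lat s l))"
  then have A[measurable]: "A \<in> sets borel" and A': "A \<in> sets lborel" by simp_all
  have "emeasure (distr (cell_measure s \<Otimes>\<^sub>M counting) lborel (\<lambda>(w, l). w + lat s l)) A
    = (\<Sum>\<^sup>+ l. emeasure (cell_measure s) ((\<lambda>w. (w, l)) -` ((\<lambda>(w, l). w + lat s l) -` A \<inter> space
      (cell_measure s \<Otimes>\<^sub>M counting))))"
    unfolding emeasure_distr[OF T A']
    by (rule P.emeasure_pair_measure_alt2[OF measurable_sets[OF T A']])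
  also have "\<dots> = (\<Sum>\<^sup>+ l. \<integral>\<^sup>+w. indicator (cell s) (w - lat s l) * indicator A w \<partial>lborel)"
  proof (rule nn_integral_cong)
    fix l :: "int^'n"
    define f where "f w = (indicator (cell s) w * indicator A (w + lat s l) :: ennreal)" for w
    have fm: "f \<in> borel_measurable borel" unfolding f_def by measurable
    have B: "{w. w + lat s l \<in> A} \<in> sets borel" by measurable
    have "(\<lambda>w. (w, l)) -` ((\<lambda>(w, l). w + lat s l) -` A \<inter> space (cell_measure s \<Otimes>\<^sub>M counting))
      = {w. w + lat s l \<in> A}"
      by (auto simp: space_pair_measure)
    also have "emeasure (cell_measure s) {w. w + lat s l \<in> A} = (\<integral>\<^sup>+w. f w \<partial>lborel)"
      unfolding cell_measure_def f_def using B
      by (subst emeasure_density) (auto intro!: nn_integral_cong simp: indicator_def)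
    also have "\<dots> = (\<integral>\<^sup>+w. f (- lat s l + w) \<partial>lborel)"
      by (rule nn_integral_lborel_shift[OF fm])
    also have "\<dots> = (\<integral>\<^sup>+w. indicator (cell s) (w - lat s l) * indicator A w \<partial>lborel)"
      unfolding f_def by simp
    finally show "emeasure (cell_measure s) ((\<lambda>w. (w, l)) -` ((\<lambda>(w, l). w + lat s l) -` A \<inter> space
      (cell_measure s \<Otimes>\<^sub>M counting)))
       = (\<integral>\<^sup>+w. indicator (cell s) (w - lat s l) * indicator A w \<partial>lborel)" .
  qed
  also have "\<dots> = (\<integral>\<^sup>+w. \<integral>\<^sup>+l. indicator (cell s) (w - lat s l) * indicator A w \<partial>counting \<partial>lborel)"
    by (rule nn_integral_count_space_swap) (auto intro: sigma_finite_lborel)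
  also have "\<dots> = (\<integral>\<^sup>+w. indicator A w \<partial>lborel)"
  proof (rule nn_integral_cong)
    fix w :: "real^'n"
    have "(\<Sum>\<^sup>+ l. indicator (cell s) (w - lat s l) * indicator A w)
       = (\<Sum>\<^sup>+ l. indicator A w * indicator {\<chi> j. \<lfloor>w $ j / s j\<rfloor>} l)"
      by (rule nn_integral_cong) (simp add: indicator_def cell_unique[OF s])
    also have "\<dots> = indicator A w"
      by (subst nn_integral_cmult_indicator) (auto simp: emeasure_count_space)
    finally show "(\<Sum>\<^sup>+ l. indicator (cell s) (w - lat s l) * indicator A w) = indicator A w" .
  qed
  finally show "emeasure (distr (cell_measure s \<Otimes>\<^sub>M counting) lborel (\<lambda>(w, l). w + lat s l)) A
    = emeasure lborel A"
    by simp
qed simp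

lemma measurable_tile: "(\<lambda>(w, l). w + lat s l) \<in> cell_measure s \<Otimes>\<^sub>M counting \<rightarrow>\<^sub>M borel"
  by (rule measurable_pair_count_space) simp

lemma nn_integral_tile:
  fixes g :: "real^'n \<Rightarrow> ennreal"
  assumes s: "\<And>j. s j > 0" and [measurable]: "g \<in> borel_measurable borel"
  shows "(\<integral>\<^sup>+w. g w \<partial>lborel) = (\<integral>\<^sup>+w. \<integral>\<^sup>+l. g (w + lat s l) \<partial>counting \<partial>cell_measure s)"
proof -
  interpret C: sigma_finite_measure "count_space (UNIV :: (int^'n) set)"
    by (rule sigma_finite_measure_count_space)
  have T: "(\<lambda>(w, l). w + lat s l) \<in> cell_measure s \<Otimes>\<^sub>M counting \<rightarrow>\<^sub>M lborel"
    using measurable_tile[of s] by simp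
  have gm: "g \<in> borel_measurable lborel" using assms(2) by simp
  have gm': "g \<in> borel_measurable (distr (cell_measure s \<Otimes>\<^sub>M counting) lborel (\<lambda>(w, l). w + lat s l))"
    unfolding tiling[OF s] by (rule gm)
  have "(\<integral>\<^sup>+w. g w \<partial>lborel) = (\<integral>\<^sup>+p. g ((\<lambda>(w, l). w + lat s l) p) \<partial>(cell_measure s \<Otimes>\<^sub>M counting))"
    by (subst tiling[OF s, symmetric], rule nn_integral_distr[OF T gm'])
  also have "\<dots> = (\<integral>\<^sup>+w. \<integral>\<^sup>+l. g (w + lat s l) \<partial>counting \<partial>cell_measure s)"
    using C.nn_integral_fst[OF measurable_compose[OF T gm]]
    unfolding case_prod_unfold fst_conv snd_conv by (rule sym)
  finally show ?thesis .
qed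

lemma integral_tile:
  fixes g :: "real^'n \<Rightarrow> complex"
  assumes s: "\<And>j. s j > 0" and g: "integrable lborel g"
  shows "AE w in cell_measure s. integrable counting (\<lambda>l. g (w + lat s l))"
    and "integrable (cell_measure s) (\<lambda>w. \<Sum>\<^sup>L l. g (w + lat s l))"
    and "(LINT w|cell_measure s. \<Sum>\<^sup>L l. g (w + lat s l)) = integral\<^sup>L lborel g"
proof -
  interpret C: sigma_finite_measure "count_space (UNIV :: (int^'n) set)"
    by (rule sigma_finite_measure_count_space)
  interpret P: pair_sigma_finite "cell_measure s" "count_space (UNIV :: (int^'n) set)" ..
  have T: "(\<lambda>(w, l). w + lat s l) \<in> cell_measure s \<Otimes>\<^sub>M counting \<rightarrow>\<^sub>M lborel"
    using measurable_tile[of s] by simp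
  have gm: "g \<in> borel_measurable lborel" using g by auto
  have "integrable (distr (cell_measure s \<Otimes>\<^sub>M counting) lborel (\<lambda>(w, l). w + lat s l)) g"
    using g unfolding tiling[OF s] .
  from integrable_distr[OF T this]
  have i: "integrable (cell_measure s \<Otimes>\<^sub>M counting) (\<lambda>(w, l). g (w + lat s l))"
    by (simp add: case_prod_unfold)
  show "AE w in cell_measure s. integrable counting (\<lambda>l. g (w + lat s l))"
    using P.AE_integrable_fst[OF i] .
  show "integrable (cell_measure s) (\<lambda>w. \<Sum>\<^sup>L l. g (w + lat s l))"
    using P.integrable_fst[OF i] .
  have "integral\<^sup>L lborel g = (LINT p|(cell_measure s \<Otimes>\<^sub>M counting). g ((\<lambda>(w, l). w + lat s l) p))"
    by (subst tiling[OF s, symmetric], rule integral_distr[OF T gm])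
  also have "\<dots> = (LINT w|cell_measure s. \<Sum>\<^sup>L l. g (w + lat s l))"
    using P.integral_fst[OF i] by (simp add: case_prod_unfold)
  finally show "(LINT w|cell_measure s. \<Sum>\<^sup>L l. g (w + lat s l)) = integral\<^sup>L lborel g" by simp
qed

section \<open>Fourier series on the torus\<close>

abbreviation dual :: "('n \<Rightarrow> real) \<Rightarrow> 'n \<Rightarrow> real" where
  "dual s \<equiv> (\<lambda>j. 1 / s j)"

abbreviation dlat :: "('n \<Rightarrow> real) \<Rightarrow> int^'n \<Rightarrow> real^'n" where
  "dlat s \<equiv> lat (dual s)"

definition null_coeffs :: "('n::finite \<Rightarrow> real) \<Rightarrow> (real^'n \<Rightarrow> complex) \<Rightarrow> bool" where
  "null_coeffs s G \<longleftrightarrow> integrable (cell_measure s) G \<and>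
     (\<forall>k. (LINT w|cell_measure s. G w * e2pi (dlat s k \<bullet> w)) = 0)"

text \<open>The quotient of R^n by the lattice, realised as a product of unit circles in C^n. Its
  coordinates are characters, so polynomials in their real and imaginary parts are trigonometric
  polynomials.\<close>

definition torus_map :: "('n \<Rightarrow> real) \<Rightarrow> real^'n \<Rightarrow> complex^'n" where
  "torus_map s w = (\<chi> j. e2pi (w $ j / s j))"

lemma continuous_torus_map: "continuous_on A (torus_map s)"
  unfolding torus_map_def[abs_def] cis_conv_exp divide_inverse by (intro continuous_intros)

lemma null_coeffs_add: "null_coeffs s G \<Longrightarrow> null_coeffs s H \<Longrightarrow> null_coeffs s (\<lambda>w. G w + H w)"
  by (simp add: null_coeffs_def distrib_right integrable_mult_cis)

lemma null_coeffs_cmult: "null_coeffs s G \<Longrightarrow> null_coeffs s (\<lambda>w. G w * c)"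
  by (simp add: null_coeffs_def mult.assoc[of _ c] mult.commute[of c])
     (simp flip: mult.assoc)

text \<open>Multiplication by a character only shifts the index of the coefficients, so the
  functions with vanishing coefficients form a module over the trigonometric polynomials.\<close>

lemma null_coeffs_character:
  assumes G: "null_coeffs s G"
  shows "null_coeffs s (\<lambda>w. G w * e2pi (dlat s k \<bullet> w))"
proof -
  have e: "G w * e2pi (dlat s k \<bullet> w) * e2pi (dlat s l \<bullet> w)
     = G w * e2pi (dlat s (k + l) \<bullet> w)" for w l
    by (simp add: cis_mult lat_add inner_add_left distrib_left)
  show ?thesis using G unfolding null_coeffs_def e by (auto intro: integrable_mult_cis)
qed

lemma torus_map_coord:
  "torus_map s w $ j = e2pi (dlat s (axis j 1) \<bullet> w)"
  "cnj (torus_map s w $ j) = e2pi (dlat s (- axis j 1) \<bullet> w)"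
proof -
  have "dlat s (axis j 1) = axis j (1 / s j)"
    by (simp add: lat_def vec_eq_iff axis_def)
  then show "torus_map s w $ j = e2pi (dlat s (axis j 1) \<bullet> w)"
    "cnj (torus_map s w $ j) = e2pi (dlat s (- axis j 1) \<bullet> w)"
    by (simp_all add: torus_map_def lat_minus inner_axis' cis_cnj)
qed

lemma eq_0_if_norm_le_eps:
  fixes x :: "'a::real_normed_vector"
  assumes "\<And>e. e > 0 \<Longrightarrow> norm x \<le> e"
  shows "x = 0"
proof (rule ccontr)
  assume "x \<noteq> 0"
  then have "norm x > 0" by simp
  then show False using assms[of "norm x / 2"] by simp
qed

text \<open>Stone-Weierstrass on the compact product of circles: \<open>b\<close> is uniformly
  approximated by functions that annihilate \<open>G\<close>, and \<open>G\<close> is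
  integrable.\<close>

lemma null_coeffs_continuous:
  fixes b :: "complex^'n \<Rightarrow> real"
  assumes G: "null_coeffs s G" and b: "continuous_on UNIV b"
  shows "(LINT w|cell_measure s. G w * of_real (b (torus_map s w))) = 0"
proof -
  define S :: "(complex^'n) set" where "S = {z. \<forall>j. norm (z $ j) = 1}"
  have S: "torus_map s w \<in> S" for w by (simp add: S_def torus_map_def)
  have "closed S" unfolding S_def by (intro closed_Collect_all closed_Collect_eq continuous_intros)
  moreover have "bounded S"
  proof -
    have "norm z \<le> real CARD('n)" if "z \<in> S" for z
      using L2_set_le_sum[of UNIV "\<lambda>j. norm (z $ j)"] that by (simp add: S_def norm_vec_def)
    then show ?thesis unfolding bounded_iff by blast
  qed
  ultimately have cS: "compact S" by (simp add: compact_eq_bounded_closed)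
  \<comment> \<open>The quantifier over \<open>G\<close> matters: annihilating one given
    \<open>G\<close> is not stable under products, while preserving \<open>null_coeffs\<close> is.
    This makes the functions satisfying \<open>P\<close> an algebra.\<close>
  define P where "P f \<longleftrightarrow> continuous_on UNIV f \<and>
      (\<forall>G. null_coeffs s G \<longrightarrow> null_coeffs s (\<lambda>w. G w * of_real (f (torus_map s w))))"
        for f :: "complex^'n \<Rightarrow> real"
  have PRe: "P (\<lambda>z. Re (z $ j))" and PIm: "P (\<lambda>z. Im (z $ j))" for j
  proof -
    have re: "complex_of_real (Re (torus_map s w $ j)) = (torus_map s w $ j + cnj (torus_map s w $
      j)) * (1 / 2)"
      and im: "complex_of_real (Im (torus_map s w $ j)) = (torus_map s w $ j + cnj (torus_map s w $
        j) * (- 1)) * (1 / (2 * \<i>))" for w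
      by (simp_all add: complex_eq_iff)
    { fix G assume G: "null_coeffs s G"
      note c = null_coeffs_character[OF G, of "axis j 1", folded torus_map_coord]
        null_coeffs_character[OF G, of "- axis j 1", folded torus_map_coord]
      from null_coeffs_cmult[OF null_coeffs_add[OF c], of "1/2"]
      have "null_coeffs s (\<lambda>w. G w * of_real (Re (torus_map s w $ j)))"
        unfolding re by (simp add: algebra_simps)
      moreover from null_coeffs_cmult[OF null_coeffs_add[OF c(1) null_coeffs_cmult[OF c(2), of
        "-1"]], of "1/(2 * \<i>)"]
      have "null_coeffs s (\<lambda>w. G w * of_real (Im (torus_map s w $ j)))"
        unfolding im by (simp add: algebra_simps)
      ultimately have "null_coeffs s (\<lambda>w. G w * of_real (Re (torus_map s w $ j)))"
        "null_coeffs s (\<lambda>w. G w * of_real (Im (torus_map s w $ j)))" by auto }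
    then show "P (\<lambda>z. Re (z $ j))" "P (\<lambda>z. Im (z $ j))"
      unfolding P_def by (auto intro!: continuous_intros)
  qed
  have Gi: "integrable (cell_measure s) G" using G by (simp add: null_coeffs_def)
  have zero: "(LINT w|cell_measure s. G w * of_real (g (torus_map s w))) = 0" if "P g" for g
  proof -
    have "null_coeffs s (\<lambda>w. G w * of_real (g (torus_map s w)))" using that G by (simp add: P_def)
    then show ?thesis unfolding null_coeffs_def by (auto dest!: spec[of _ 0])
  qed
  have int: "integrable (cell_measure s) (\<lambda>w. G w * of_real (g (torus_map s w)))"
    if "continuous_on UNIV g" for g
  proof -
    have "compact (g ` S)" by (intro compact_continuous_image cS continuous_on_subset[OF that]) auto
    then have "bounded (g ` S)" by (rule compact_imp_bounded)
    then obtain B where B: "\<And>z. z \<in> S \<Longrightarrow> \<bar>g z\<bar> \<le> B"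
      unfolding bounded_iff by auto
    have "(\<lambda>w. complex_of_real (g (torus_map s w))) \<in> borel_measurable borel"
      by (intro borel_measurable_continuous_onI continuous_intros continuous_on_compose2[OF that
        continuous_torus_map]) auto
    then show ?thesis by (intro integrable_mult_bounded[OF Gi, where B = B]) (use B S in auto)
  qed
  define L where "L = (LINT w|cell_measure s. norm (G w))"
  have L: "L \<ge> 0" by (simp add: L_def)
  have "norm (LINT w|cell_measure s. G w * of_real (b (torus_map s w))) \<le> e" if e: "e > 0" for e
  proof -
    have "e / (L + 1) > 0" using e L by simp
    then have "\<exists>g. P g \<and> (\<forall>x\<in>S. \<bar>b x - g x\<bar> < e / (L + 1))"
    proof (intro Stone_Weierstrass_HOL[of S P b])
      show "P (\<lambda>x. c)" for c by (auto simp: P_def intro: null_coeffs_cmult)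
      show "P f \<Longrightarrow> continuous_on S f" for f unfolding P_def by (blast intro: continuous_on_subset)
      show "P f \<and> P g \<Longrightarrow> P (\<lambda>x. f x + g x)" for f g
        unfolding P_def by (auto intro!: continuous_intros null_coeffs_add simp: distrib_left)
      show "P (\<lambda>x. f x * g x)" if "P f \<and> P g" for f g
        unfolding P_def
      proof (intro conjI allI impI)
        show "continuous_on UNIV (\<lambda>x. f x * g x)" using that
          by (auto simp: P_def intro!: continuous_intros)
        fix G assume "null_coeffs s G"
        then have "null_coeffs s (\<lambda>w. G w * of_real (f (torus_map s w)))" using that
          by (auto simp: P_def)
        then have "null_coeffs s (\<lambda>w. G w * of_real (f (torus_map s w)) * of_real (g (torus_map s w)))"
          using that by (auto simp: P_def)
        then show "null_coeffs s (\<lambda>w. G w * of_real (f (torus_map s w) * g (torus_map s w)))"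
          by (simp add: mult.assoc)
      qed
      show "\<exists>f. P f \<and> f x \<noteq> f y" if "x \<in> S \<and> y \<in> S \<and> x \<noteq> y" for x y
      proof -
        from that obtain j where "Re (x $ j) \<noteq> Re (y $ j) \<or> Im (x $ j) \<noteq> Im (y $ j)"
          by (auto simp: vec_eq_iff complex_eq_iff)
        then show ?thesis using PRe[of j] PIm[of j] by blast
      qed
    qed (use cS continuous_on_subset[OF b, of S] in auto)
    then obtain g where g: "P g" "\<And>x. x \<in> S \<Longrightarrow> \<bar>b x - g x\<bar> < e / (L + 1)" by auto
    have gc: "continuous_on UNIV g" using g by (simp add: P_def)
    have "(LINT w|cell_measure s. G w * of_real (b (torus_map s w)))
        = (LINT w|cell_measure s. G w * of_real (b (torus_map s w)) - G w * of_real (g (torus_map s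
          w)))"
      unfolding Bochner_Integration.integral_diff[OF int[OF b] int[OF gc]] zero[OF g(1)] by simp
    also have "norm \<dots> \<le> (LINT w|cell_measure s. norm (G w) * (e / (L + 1)))"
    proof (rule order_trans[OF integral_norm_bound], rule integral_mono)
      show "integrable (cell_measure s) (\<lambda>w. norm (G w * of_real (b (torus_map s w)) - G w
        * of_real (g (torus_map s w))))"
        using int[OF b] int[OF gc] by (intro integrable_norm Bochner_Integration.integrable_diff)
      show "integrable (cell_measure s) (\<lambda>w. norm (G w) * (e / (L + 1)))" using Gi by simp
      fix w
      have "norm (G w * of_real (b (torus_map s w)) - G w * of_real (g (torus_map s w)))
         = norm (G w) * \<bar>b (torus_map s w) - g (torus_map s w)\<bar>"
        unfolding right_diff_distrib[symmetric] of_real_diff[symmetric] norm_mult norm_of_real ..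
      also have "\<dots> \<le> norm (G w) * (e / (L + 1))"
        using g(2)[OF S[of w]] by (intro mult_left_mono) auto
      finally show "norm (G w * of_real (b (torus_map s w)) - G w * of_real (g (torus_map s w)))
        \<le> norm (G w) * (e / (L + 1))" .
    qed
    also have "\<dots> = L * (e / (L + 1))" unfolding L_def by (rule integral_mult_left_zero)
    also have "\<dots> \<le> e" using L e by (simp add: divide_le_eq mult.commute mult_left_mono)
    finally show ?thesis .
  qed
  then show ?thesis by (rule eq_0_if_norm_le_eps)
qed

lemma cis_inj_unit:
  assumes "cis (2 * pi * a) = cis (2 * pi * b)" "0 \<le> a" "a < 1" "0 \<le> b" "b < 1"
  shows "a = b"
proof -
  have "cos (2 * pi * a) = cos (2 * pi * b)" "sin (2 * pi * a) = sin (2 * pi * b)"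
    using assms(1) by (metis cis.sel)+
  then have "cos (2 * pi * a - 2 * pi * b) = 1" by (simp only: cos_diff sin_cos_squared_add3)
  then obtain n :: int where n: "2 * pi * a - 2 * pi * b = real_of_int n * 2 * pi"
    unfolding cos_one_2pi_int by auto
  then have "2 * pi * (a - b) = 2 * pi * real_of_int n" by (simp add: algebra_simps)
  then have "a - b = real_of_int n" by simp
  moreover from this assms have "\<bar>real_of_int n\<bar> < 1" by linarith
  then have "n = 0" by linarith
  ultimately show ?thesis by simp
qed

lemma torus_map_inj:
  assumes s: "\<And>j. s j > 0" and "w \<in> cell s" "\<eta> \<in> cell s" "torus_map s w = torus_map s \<eta>"
  shows "w = \<eta>"
proof -
  have "w $ j / s j = \<eta> $ j / s j" for j
    using assms by (intro cis_inj_unit) (auto simp: torus_map_def cell_def vec_eq_iff field_simps)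
  then show ?thesis using s by (auto simp: vec_eq_iff) (metis less_irrefl)
qed

text \<open>The indicator of \<open>K\<close> is a pointwise limit, on the cell, of continuous
  functions of the distance to the image of \<open>K\<close>. The distance is taken on the torus,
  where the opposite faces of the cell are glued; injectivity of \<open>torus_map\<close> on the
  half-open cell separates \<open>K\<close> from its complement there.\<close>

lemma null_coeffs_compact:
  fixes K :: "(real^'n) set"
  assumes s: "\<And>j. s j > 0" and G: "null_coeffs s G" and K: "compact K" "K \<subseteq> cell s"
  shows "(LINT w|cell_measure s. G w * indicator K w) = 0"
proof (cases "K = {}")
  case False
  define T where "T = torus_map s ` K"
  have T: "closed T" "T \<noteq> {}"
    using K False by (auto simp: T_def intro!: compact_imp_closed compact_continuous_image
      continuous_torus_map)
  define b where "b n z = max 0 (1 - real n * infdist z T)" for n z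
  have bc: "continuous_on UNIV (b n)" for n unfolding b_def by (intro continuous_intros)
  have Gi: "integrable (cell_measure s) G" using G by (simp add: null_coeffs_def)
  have b01: "0 \<le> b n z" "b n z \<le> 1" for n z by (auto simp: b_def infdist_nonneg)
  have Gm: "G \<in> borel_measurable (cell_measure s)" using Gi by auto
  have bm: "(\<lambda>w. b n (torus_map s w)) \<in> borel_measurable borel" for n
    by (intro borel_measurable_continuous_onI continuous_on_compose2[OF bc continuous_torus_map]) auto
  have "(\<lambda>n. LINT w|cell_measure s. G w * of_real (b n (torus_map s w)))
    \<longlonglongrightarrow> (LINT w|cell_measure s. G w * indicator K w)"
  proof (rule integral_dominated_convergence[where w = "\<lambda>w. norm (G w)"])
    have "(\<lambda>w. indicator K w :: complex) \<in> borel_measurable borel"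
      using K(1) by (intro borel_measurable_indicator borel_compact)
    then show "(\<lambda>w. G w * indicator K w) \<in> borel_measurable (cell_measure s)"
      using Gm by (intro borel_measurable_times) auto
    show "(\<lambda>w. G w * of_real (b n (torus_map s w))) \<in> borel_measurable (cell_measure s)" for n
      using Gm bm[of n] by (intro borel_measurable_times) auto
    show "integrable (cell_measure s) (\<lambda>w. norm (G w))" using Gi by simp
    show "AE w in cell_measure s. norm (G w * of_real (b n (torus_map s w))) \<le> norm (G w)" for n
      using b01[of n] by (intro AE_I2) (simp add: norm_mult mult_left_le)
    show "AE w in cell_measure s. (\<lambda>n. G w * of_real (b n (torus_map s w))) \<longlonglongrightarrow> G w * indicator K w"
      unfolding AE_cell_measure
    proof (intro AE_I2 impI tendsto_mult tendsto_const)
      fix w assume w: "w \<in> cell s"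
      have inT: "torus_map s w \<in> T \<longleftrightarrow> w \<in> K"
        using torus_map_inj[OF s w] K(2) by (auto simp: T_def)
      show "(\<lambda>n. complex_of_real (b n (torus_map s w))) \<longlonglongrightarrow> indicator K w"
      proof (cases "w \<in> K")
        case True
        then have "b n (torus_map s w) = 1" for n using inT by (simp add: b_def)
        then show ?thesis using True by simp
      next
        case False
        then have "infdist (torus_map s w) T > 0"
          using inT T by (metis in_closed_iff_infdist_zero infdist_nonneg less_eq_real_def)
        then obtain n0 where n0: "1 < real n0 * infdist (torus_map s w) T" using reals_Archimedean3
          by blast
        have "b n (torus_map s w) = 0" if "n \<ge> n0" for n
        proof -
          have "real n0 * infdist (torus_map s w) T \<le> real n * infdist (torus_map s w) T"
            using that by (intro mult_right_mono) (auto simp: infdist_nonneg)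
          then show ?thesis using n0 by (simp add: b_def)
        qed
        then have "eventually (\<lambda>n. complex_of_real (b n (torus_map s w)) = indicator K w) sequentially"
          using False by (auto simp: eventually_sequentially)
        then show ?thesis by (rule tendsto_eventually)
      qed
    qed
  qed
  then have "(\<lambda>n. 0 :: complex) \<longlonglongrightarrow> (LINT w|cell_measure s. G w * indicator K w)"
    by (simp add: null_coeffs_continuous[OF G bc])
  then show ?thesis using LIMSEQ_const_iff by metis
qed simp

text \<open>Inner regularity passes from compact sets to Borel sets, and an integrable function
  whose integrals over all Borel sets vanish is zero almost everywhere.\<close>

lemma null_coeffs_AE_zero:
  fixes s :: "'n::finite \<Rightarrow> real"
  assumes s: "\<And>j. s j > 0" and G: "null_coeffs s G"
  shows "AE w in cell_measure s. G w = 0"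
proof (rule cell.density_zero)
  show Gi: "integrable (cell_measure s) G" using G by (simp add: null_coeffs_def)
  then have Gm: "G \<in> borel_measurable (cell_measure s)" by auto
  \<comment> \<open>Regularity is applied to the finite measure with density |G|, so that the part
    of a set missed by a compact subset directly bounds the missing part of the integral of
    \<open>G\<close>.\<close>
  define M where "M = density (cell_measure s) (\<lambda>w. ennreal (norm (G w)))"
  have setsM: "sets M = sets borel" by (simp add: M_def)
  have emM: "emeasure M B = ennreal (LINT w|cell_measure s. norm (G w) * indicator B w)"
    if B: "B \<in> sets borel" for B
  proof -
    have "emeasure M B = (\<integral>\<^sup>+w. ennreal (norm (G w) * indicator B w) \<partial>cell_measure s)"
      unfolding M_def using Gm B by (subst emeasure_density) (auto intro!: nn_integral_cong simp:
        indicator_def)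
    also have "\<dots> = ennreal (LINT w|cell_measure s. norm (G w) * indicator B w)"
      using Gi B by (intro nn_integral_eq_integral integrable_mult_indicator[where f
        = "\<lambda>x. norm (G x)", simplified mult.commute[of "indicator _ _"] real_scaleR_def]) auto
    finally show ?thesis .
  qed
  fix A assume "A \<in> sets (cell_measure s)"
  then have A: "A \<in> sets borel" by simp
  \<comment> \<open>\<open>null_coeffs_compact\<close> asks for compact sets inside the cell;
    outside the cell the measure is zero.\<close>
  define B where "B = A \<inter> cell s"
  have B: "B \<in> sets borel" using A sets_cell by (auto simp: B_def)
  have fin: "emeasure M (space M) \<noteq> \<infinity>"
    unfolding sets_eq_imp_space_eq[OF setsM] space_borel emM[OF sets.top[of borel, unfolded
      space_borel]] by (rule ennreal_neq_top[folded infinity_ennreal_def])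
  have gi: "integrable (cell_measure s) (\<lambda>w. G w * indicator C w)" if C: "C \<in> sets borel" for C
    using C by (intro integrable_mult_bounded[OF Gi, where B = 1]) (auto simp: indicator_def)
  have "set_lebesgue_integral (cell_measure s) A G = (LINT w|cell_measure s. G w * indicator B w)"
    unfolding set_lebesgue_integral_def
  proof (rule integral_cong_AE)
    show "AE w in cell_measure s. indicator A w *\<^sub>R G w = G w * indicator B w"
      unfolding AE_cell_measure by (intro AE_I2) (auto simp: B_def indicator_def)
    show "(\<lambda>w. G w * indicator B w) \<in> borel_measurable (cell_measure s)" using gi[OF B] by auto
    show "(\<lambda>w. indicator A w *\<^sub>R G w) \<in> borel_measurable (cell_measure s)" using Gm A
      by (intro borel_measurable_scaleR borel_measurable_indicator) auto
  qed
  moreover have "norm (LINT w|cell_measure s. G w * indicator B w) \<le> e" if e: "e > 0" for e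
  proof -
    define m where "m C = (LINT w|cell_measure s. norm (G w) * indicator C w)" for C
    have m0: "m C \<ge> 0" for C by (simp add: m_def)
    have "\<exists>K. K \<subseteq> B \<and> compact K \<and> m B \<le> m K + e"
    proof (cases "m B \<le> e")
      case True
      then show ?thesis using m0[of "{}"] by (intro exI[of _ "{}"]) auto
    next
      case False
      have "ennreal (m B - e) < ennreal (m B)" using e False by (intro ennreal_lessI) auto
      also have "ennreal (m B) = (SUP K \<in> {K. K \<subseteq> B \<and> compact K}. emeasure M K)"
        using inner_regular[OF setsM fin B] emM[OF B] by (simp add: m_def)
      finally obtain K where K: "K \<subseteq> B" "compact K" "ennreal (m B - e) < emeasure M K"
        unfolding less_SUP_iff by auto
      then have "ennreal (m B - e) < ennreal (m K)" using emM[of K] by (simp add: m_def borel_compact)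
      then have "m B - e < m K" using m0[of K] by (subst (asm) ennreal_less_iff) (use False in auto)
      then show ?thesis using K by (intro exI[of _ K]) auto
    qed
    then obtain K where K: "K \<subseteq> B" "compact K" and le: "m B \<le> m K + e" by blast
    have Km: "K \<in> sets borel" using K by (simp add: borel_compact)
    have nn: "norm (G w * indicator C w) = norm (G w) * indicator C w" for C w
      by (simp add: indicator_def)
    have ni: "integrable (cell_measure s) (\<lambda>w. norm (G w) * indicator C w)" if "C \<in> sets borel" for C
      using integrable_norm[OF gi[OF that]] unfolding nn .
    have "(LINT w|cell_measure s. G w * indicator B w) = (LINT w|cell_measure s. G w * indicator B w
      - G w * indicator K w)"
      using null_coeffs_compact[OF s G K(2)] K(1) gi[OF B] gi[OF Km] by (simp add: B_def)
    also have "norm \<dots> \<le> (LINT w|cell_measure s. norm (G w) * indicator B w - norm (G w) * indicator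
      K w)"
    proof (rule order_trans[OF integral_norm_bound], rule integral_mono)
      show "integrable (cell_measure s) (\<lambda>w. norm (G w * indicator B w - G w * indicator K w))"
        using gi[OF B] gi[OF Km] by (intro integrable_norm Bochner_Integration.integrable_diff)
      show "integrable (cell_measure s) (\<lambda>w. norm (G w) * indicator B w - norm (G w) * indicator K w)"
        using ni[OF B] ni[OF Km] by (intro Bochner_Integration.integrable_diff)
      show "norm (G w * indicator B w - G w * indicator K w) \<le> norm (G w) * indicator B w
        - norm (G w) * indicator K w" for w
        using K(1) by (auto simp: indicator_def)
    qed
    also have "\<dots> \<le> e" using le ni[OF B] ni[OF Km] by (simp add: m_def)
    finally show ?thesis .
  qed
  then have "(LINT w|cell_measure s. G w * indicator B w) = 0"
    by (rule eq_0_if_norm_le_eps)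
  ultimately show "set_lebesgue_integral (cell_measure s) A G = 0" by simp
qed

section \<open>Orthogonality of characters and Poisson summation\<close>

lemma cis_2pi_int [simp]: "cis (2 * pi * real_of_int k) = 1"
  by (metis cis_multiple_2pi Ints_of_int)

lemma interval_character:
  fixes s :: real
  assumes s: "s > 0"
  shows "integrable lborel (\<lambda>x. complex_of_real (indicator {0..<s} x) * e2pi (of_int k / s * x))"
    and "(LINT x|lborel. complex_of_real (indicator {0..<s} x) * e2pi (of_int k / s * x)) = (if k
      = 0 then of_real s else 0)"
proof -
  let ?c = "\<lambda>x. e2pi (of_int k / s * x)"
  have "integrable lborel (\<lambda>x. complex_of_real (indicator {0..<s} x))"
    using s by (intro integrable_of_real integrable_real_indicator) auto
  then show "integrable lborel (\<lambda>x. complex_of_real (indicator {0..<s} x) * ?c x)"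
    by (rule integrable_mult_cis) simp
  show "(LINT x|lborel. complex_of_real (indicator {0..<s} x) * ?c x) = (if k
    = 0 then of_real s else 0)"
  proof (cases "k = 0")
    case True
    have "(LINT x|lborel. complex_of_real (indicator {0..<s} x))
      = complex_of_real (LINT x|lborel. indicator {0..<s} x)"
      by (rule integral_complex_of_real)
    then show ?thesis using True s by (simp add: measure_def)
  next
    case False
    define a where "a = 2 * pi * of_int k / s"
    have a: "a \<noteq> 0" using False s by (simp add: a_def)
    have ca: "?c x = cis (a * x)" for x by (simp add: a_def mult.assoc)
    have "(LINT x|lborel. complex_of_real (indicator {0..<s} x) * ?c x)
      = (LINT x|lborel. indicator {0..s} x *\<^sub>R ?c x)"
    proof (rule integral_cong_AE)
      have "AE x in lborel. x \<noteq> s" by (rule AE_lborel_singleton)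
      then show "AE x in lborel. complex_of_real (indicator {0..<s} x) * ?c x
        = indicator {0..s} x *\<^sub>R ?c x"
        by eventually_elim (auto simp: indicator_def)
    qed simp_all
    also have "\<dots> = - \<i> / a * cis (a * s) - - \<i> / a * cis (a * 0)"
      unfolding ca
    proof (rule integral_FTC_Icc)
      have "((\<lambda>x. - \<i> / of_real a * exp (\<i> * of_real (a * x))) has_vector_derivative exp (\<i>
        * of_real (a * x))) (at x within {0..s})" for x
      proof -
        have "((\<lambda>z. - \<i> / of_real a * exp (\<i> * (of_real a * z))) has_field_derivative exp (\<i>
          * (of_real a * of_real x))) (at (of_real x))"
          using a by (auto intro!: derivative_eq_intros)
        from has_vector_derivative_real_field[OF this, of "{0..s}"] show ?thesis
          by (simp add: o_def)
      qed
      then show "((\<lambda>x. - \<i> / of_real a * cis (a * x)) has_vector_derivative cis (a * x)) (at x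
        within {0..s})" for x
        by (simp add: cis_conv_exp)
      show "continuous_on {0..s} (\<lambda>x. cis (a * x))" unfolding cis_conv_exp by (intro continuous_intros)
    qed (use s in simp)
    also have "\<dots> = 0" using s by (simp add: a_def)
    finally show ?thesis using False by simp
  qed
qed

lemma cell_character:
  fixes s :: "'n::finite \<Rightarrow> real"
  assumes s: "\<And>j. s j > 0"
  shows "(LINT w|cell_measure s. e2pi (dlat s k \<bullet> w)) = (if k = 0 then of_real (\<Prod>j\<in>UNIV. s j) else 0)"
proof -
  have "(LINT w|cell_measure s. e2pi (dlat s k \<bullet> w))
     = (LINT w|density lborel (\<lambda>x. ennreal (indicator (cell s) x)). e2pi (dlat s k \<bullet> w))"
    unfolding cell_measure_def by (simp add: ennreal_indicator)
  also have "\<dots> = (LINT w|lborel. indicator (cell s) w *\<^sub>R e2pi (dlat s k \<bullet> w))"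
    by (rule integral_density) (auto simp: sets_cell)
  also have "\<dots> = (LINT w|lborel. (\<Prod>j\<in>UNIV. complex_of_real (indicator {0..<s j} (w $ j))
    * e2pi (of_int (k $ j) / s j * w $ j)))"
  proof (rule Bochner_Integration.integral_cong[OF refl])
    fix w :: "real^'n"
    have "(\<Prod>j\<in>UNIV. complex_of_real (indicator {0..<s j} (w $ j))) = indicator (cell s) w"
      by (auto simp: cell_def indicator_def prod_zero_iff intro!: prod.neutral)
    moreover have "2 * pi * (dlat s k \<bullet> w) = (\<Sum>j\<in>UNIV. 2 * pi * (of_int (k $ j) / s j * w $ j))"
      by (simp add: lat_def inner_vec_def sum_distrib_left)
    ultimately show "indicator (cell s) w *\<^sub>R e2pi (dlat s k \<bullet> w)
      = (\<Prod>j\<in>UNIV. complex_of_real (indicator {0..<s j} (w $ j)) * e2pi (of_int (k $ j) / s j * w $ j))"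
      by (simp add: prod.distrib cis_sum indicator_def)
  qed
  also have "\<dots> = (\<Prod>j\<in>UNIV. if k $ j = 0 then complex_of_real (s j) else 0)"
    unfolding lborel_vec_prod(2)[OF interval_character(1)[OF s]] interval_character(2)[OF s] ..
  also have "\<dots> = (if k = 0 then of_real (\<Prod>j\<in>UNIV. s j) else 0)"
    by (auto simp: vec_eq_iff prod_zero_iff intro!: prod.cong)
  finally show ?thesis .
qed

lemma character_lat:
  fixes s :: "'n::finite \<Rightarrow> real"
  assumes s: "\<And>j. s j > 0"
  shows "e2pi (dlat s k \<bullet> (w + lat s l)) = e2pi (dlat s k \<bullet> w)"
proof -
  have "2 * pi * (dlat s k \<bullet> (w + lat s l)) = 2 * pi * (dlat s k \<bullet> w) + 2 * pi * real_of_int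
    (\<Sum>j\<in>UNIV. k $ j * l $ j)"
    unfolding inner_add_right lat_inner_dual[of s, OF s] by (simp only: distrib_left)
  then show ?thesis by (simp only: cis_mult[symmetric] cis_2pi_int mult_1_right)
qed

text \<open>Poisson summation: the periodization of \<open>fourier f\<close> and the Fourier series with
  coefficients \<open>f\<close> have the same Fourier coefficients.\<close>

lemma poisson_bound:
  fixes f :: "real^'n \<Rightarrow> complex" and s :: "'n \<Rightarrow> real"
  assumes s: "\<And>j. s j > 0" and f: "integrable lborel f" "continuous_on UNIV f" and F: "integrable
    lborel (fourier f)"
    and sm: "integrable counting (\<lambda>k. f (dlat s k))"
  shows "AE w in cell_measure s. (\<Prod>j\<in>UNIV. s j) * norm (\<Sum>\<^sup>L l. fourier f (w + lat s l))
     \<le> (\<Sum>\<^sup>L k. norm (f (dlat s k)))"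
proof -
  define V where "V = (\<Prod>j\<in>UNIV. s j)"
  have V: "V > 0" using s by (simp add: V_def prod_pos)
  define PF where "PF w = (\<Sum>\<^sup>L l. fourier f (w + lat s l))" for w
  define c where "c k = f (dlat s k)" for k
  have ci: "integrable counting c" using sm unfolding c_def[abs_def] .
  define e where "e k w = e2pi (dlat s k \<bullet> w)" for k w
  \<comment> \<open>The minus sign is forced by inversion: the integral of
    \<open>fourier f w * e m w\<close> is the value of \<open>f\<close> at \<open>dlat s m\<close>,
    so pairing \<open>H\<close> with \<open>e m\<close> has to isolate \<open>c m\<close>.\<close>
  define H where "H w = (\<Sum>\<^sup>L k. c k * e (- k) w)" for w
  interpret C: sigma_finite_measure "count_space (UNIV :: (int^'n) set)"
    by (rule sigma_finite_measure_count_space)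
  interpret P: pair_sigma_finite "cell_measure s" "count_space (UNIV :: (int^'n) set)" ..
  have em: "e k \<in> borel_measurable borel" for k unfolding e_def by measurable
  have ne: "norm (e k w) = 1" for k w by (simp add: e_def)
  \<comment> \<open>The case m = 0 makes \<open>H\<close> integrable; general m permits the termwise
    computation of its coefficients.\<close>
  have hi: "integrable (cell_measure s \<Otimes>\<^sub>M counting) (\<lambda>(w, k). c k * e (m - k) w)" for m
  proof (rule P.Fubini_integrable)
    have "(\<lambda>w. c k * e (m - k) w) \<in> borel_measurable (cell_measure s)" for k
      using em by (intro borel_measurable_times) auto
    then show "(\<lambda>(w, k). c k * e (m - k) w) \<in> borel_measurable (cell_measure s \<Otimes>\<^sub>M counting)"
      by (rule measurable_pair_count_space)
    show "integrable (cell_measure s) (\<lambda>w. \<Sum>\<^sup>L k. norm (case (w, k) of (w, k) \<Rightarrow> c k * e (m - k) w))"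
      by (simp add: norm_mult ne)
    show "AE w in cell_measure s. integrable counting (\<lambda>k. case (w, k) of (w, k) \<Rightarrow> c k * e (m - k) w)"
      by (intro AE_I2) (auto intro!: Bochner_Integration.integrable_bound[OF ci] simp: norm_mult ne)
  qed
  have Hi: "integrable (cell_measure s) H"
    using P.integrable_fst[OF hi[of 0]] unfolding H_def by simp
  have Hc: "(LINT w|cell_measure s. H w * e m w) = V * c m" for m
  proof -
    have eq: "H w * e m w = (\<Sum>\<^sup>L k. c k * e (m - k) w)" for w
    proof -
      have "e (- k) w * e m w = e (m - k) w" for k
        by (simp add: e_def cis_mult lat_diff lat_minus inner_diff_left algebra_simps)
      then have "(\<lambda>k. c k * e (m - k) w) = (\<lambda>k. c k * e (- k) w * e m w)" by (simp add: mult.assoc)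
      then show ?thesis unfolding H_def by simp
    qed
    have "(LINT w|cell_measure s. H w * e m w) = (\<Sum>\<^sup>L k. LINT w|cell_measure s. c k * e (m - k) w)"
      unfolding eq using P.Fubini_integral[of "\<lambda>w k. c k * e (m - k) w"] hi[of m] by simp
    also have "\<dots> = (\<Sum>\<^sup>L k. (if k = m then V * c m else 0))"
    proof (rule Bochner_Integration.integral_cong[OF refl])
      fix k
      have "(LINT w|cell_measure s. c k * e (m - k) w) = c k * (LINT w|cell_measure s. e (m - k) w)"
        by (rule integral_mult_right_zero)
      also have "\<dots> = (if k = m then V * c m else 0)"
        unfolding e_def cell_character[of s, OF s] by (auto simp: V_def)
      finally show "(LINT w|cell_measure s. c k * e (m - k) w) = (if k = m then V * c m else 0)" .
    qed
    also have "\<dots> = V * c m"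
      by (subst lebesgue_integral_count_space_finite_support) (auto simp: sum.If_cases)
    finally show ?thesis .
  qed
  have PFi: "integrable (cell_measure s) PF"
    unfolding PF_def by (rule integral_tile(2)[OF s F])
  have PFc: "(LINT w|cell_measure s. PF w * e m w) = c m" for m
  proof -
    have "PF w * e m w = (\<Sum>\<^sup>L l. fourier f (w + lat s l) * e m (w + lat s l))" for w
      unfolding e_def character_lat[of s, OF s] PF_def by (rule integral_mult_left_zero[symmetric])
    then have "(LINT w|cell_measure s. PF w * e m w) = (LINT w|lborel. fourier f w * e m w)"
      using integral_tile(3)[OF s, of "\<lambda>w. fourier f w * e m w"] integrable_mult_cis[OF F, of "\<lambda>w. 2
        * pi * (dlat s m \<bullet> w)"]
      by (simp add: e_def)
    also have "\<dots> = c m" unfolding e_def c_def by (subst inner_commute) (rule fourier_inversion[OF f F])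
    finally show ?thesis .
  qed
  \<comment> \<open>Against each \<open>e m\<close> both terms give \<open>V * c m\<close>: on the
    side of \<open>PF\<close> by inversion, on the side of \<open>H\<close> because the constant
    character integrates to the cell volume \<open>V\<close>.\<close>
  have "null_coeffs s (\<lambda>w. V * PF w - H w)"
    unfolding null_coeffs_def
  proof (intro conjI allI)
    show "integrable (cell_measure s) (\<lambda>w. V * PF w - H w)" using PFi Hi by simp
    fix m
    have i: "integrable (cell_measure s) (\<lambda>w. PF w * e m w)" "integrable (cell_measure s) (\<lambda>w. H w
      * e m w)"
      using PFi Hi unfolding e_def by (auto intro!: integrable_mult_cis)
    have "(LINT w|cell_measure s. (V * PF w - H w) * e m w) = (LINT w|cell_measure s. V * (PF w
      * e m w) - H w * e m w)"
      by (simp add: algebra_simps)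
    also have "\<dots> = V * c m - V * c m"
      using i by (subst Bochner_Integration.integral_diff) (simp_all add: PFc Hc)
    finally show "(LINT w|cell_measure s. (V * PF w - H w) * e2pi (dlat s m \<bullet> w)) = 0"
      by (simp add: e_def)
  qed
  from null_coeffs_AE_zero[OF s this] show ?thesis
  proof eventually_elim
    fix w assume "V * PF w - H w = 0"
    then have "norm (V * PF w) = norm (H w)" by simp
    then have "V * norm (PF w) = norm (H w)" using V by (simp add: norm_mult)
    also have "\<dots> \<le> (\<Sum>\<^sup>L k. norm (c k))"
      unfolding H_def by (rule order_trans[OF integral_norm_bound]) (simp add: norm_mult ne)
    finally show "(\<Prod>j\<in>UNIV. s j) * norm (\<Sum>\<^sup>L l. fourier f (w + lat s l)) \<le> (\<Sum>\<^sup>L k. norm (f (dlat s k)))"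
      by (simp add: V_def PF_def c_def)
  qed
qed

section \<open>Averages over large boxes\<close>

definition int_box :: "nat \<Rightarrow> (int^'n) set" where
  "int_box N = {l. \<forall>j. 0 \<le> l $ j \<and> l $ j < int N}"

lemma card_vec_box:
  fixes A :: "'n::finite \<Rightarrow> 'a set"
  assumes "\<And>j. finite (A j)"
  shows "finite {l :: 'a^'n. \<forall>j. l $ j \<in> A j}" "card {l :: 'a^'n. \<forall>j. l $ j \<in> A j}
    = (\<Prod>j\<in>UNIV. card (A j))"
proof -
  have eq: "{l :: 'a^'n. \<forall>j. l $ j \<in> A j} = vec_lambda ` (Pi\<^sub>E UNIV A)"
  proof safe
    fix l :: "'a^'n" assume "\<forall>j. l $ j \<in> A j"
    then have "vec_nth l \<in> Pi\<^sub>E UNIV A" by auto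
    then show "l \<in> vec_lambda ` (Pi\<^sub>E UNIV A)" by (metis vec_nth_inverse image_eqI)
  qed auto
  have inj: "inj_on vec_lambda (Pi\<^sub>E UNIV A)" by (auto simp: inj_on_def vec_eq_iff fun_eq_iff)
  show "finite {l :: 'a^'n. \<forall>j. l $ j \<in> A j}" unfolding eq using assms
    by (intro finite_imageI finite_PiE) auto
  show "card {l :: 'a^'n. \<forall>j. l $ j \<in> A j} = (\<Prod>j\<in>UNIV. card (A j))"
    unfolding eq card_image[OF inj] by (rule card_PiE) simp
qed

lemma finite_int_box: "finite (int_box N :: (int^'n) set)"
  and card_int_box: "card (int_box N :: (int^'n) set) = N ^ CARD('n)"
proof -
  have eq: "int_box N = {l :: int^'n. \<forall>j. l $ j \<in> {0..<int N}}" by (auto simp: int_box_def)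
  show "finite (int_box N :: (int^'n) set)" unfolding eq by (rule card_vec_box(1)) simp
  show "card (int_box N :: (int^'n) set) = N ^ CARD('n)" unfolding eq by (subst card_vec_box(2)) auto
qed

text \<open>The Folner property of boxes: a box and its translate by a fixed k share a proportion of
  points tending to 1, because each side loses only |k_j| of its N + 1 points.\<close>

lemma int_box_shift_tendsto:
  fixes k :: "int^'n"
  shows "(\<lambda>N. real (card {l \<in> int_box (Suc N). l - k \<in> int_box (Suc N)}) / real (Suc N) ^ CARD('n)) \<longlonglongrightarrow> 1"
proof -
  have c: "card {x. 0 \<le> x \<and> x < int N \<and> 0 \<le> x - m \<and> x - m < int N} = nat (int N - \<bar>m\<bar>)"
    for N and m :: int
  proof -
    have "{x. 0 \<le> x \<and> x < int N \<and> 0 \<le> x - m \<and> x - m < int N} = {max 0 m..<min (int N) (int N + m)}"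
      by auto
    then show ?thesis by (simp add: min_def max_def)
  qed
  have fin: "finite {x. 0 \<le> x \<and> x < int N \<and> 0 \<le> x - m \<and> x - m < int N}" for N and m :: int
    by (rule finite_subset[of _ "{0..<int N}"]) auto
  have "{l \<in> int_box N. l - k \<in> int_box N} = {l. \<forall>j. l $ j \<in> {x. 0 \<le> x \<and> x < int N \<and> 0
    \<le> x - k $ j \<and> x - k $ j < int N}}" for N
    by (auto simp: int_box_def)
  then have card: "card {l \<in> int_box N. l - k \<in> int_box N} = (\<Prod>j\<in>UNIV. nat (int N - \<bar>k $ j\<bar>))" for N
    unfolding c[symmetric] by (simp only: card_vec_box(2)[OF fin])
  have "(\<lambda>N. \<Prod>j\<in>UNIV. real (nat (int (Suc N) - \<bar>k $ j\<bar>)) / real (Suc N)) \<longlonglongrightarrow> (\<Prod>j\<in>(UNIV::'n set). 1)"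
  proof (rule tendsto_prod)
    fix j
    have "(\<lambda>N. 1 - of_int \<bar>k $ j\<bar> * inverse (real (Suc N))) \<longlonglongrightarrow> 1 - of_int \<bar>k $ j\<bar> * 0"
      by (intro tendsto_intros LIMSEQ_inverse_real_of_nat)
    then have "(\<lambda>N. 1 - of_int \<bar>k $ j\<bar> / real (Suc N)) \<longlonglongrightarrow> 1" by (simp add: divide_inverse)
    moreover have "eventually (\<lambda>N. 1 - of_int \<bar>k $ j\<bar> / real (Suc N)
      = real (nat (int (Suc N) - \<bar>k $ j\<bar>)) / real (Suc N)) sequentially"
      using eventually_ge_at_top[of "nat \<bar>k $ j\<bar>"]
    proof eventually_elim
      fix N assume "nat \<bar>k $ j\<bar> \<le> N"
      then have "real (nat (int (Suc N) - \<bar>k $ j\<bar>)) = real (Suc N) - of_int \<bar>k $ j\<bar>" by linarith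
      then show "1 - of_int \<bar>k $ j\<bar> / real (Suc N) = real (nat (int (Suc N) - \<bar>k $ j\<bar>)) / real (Suc N)"
        by (simp add: diff_divide_distrib)
    qed
    ultimately show "(\<lambda>N. real (nat (int (Suc N) - \<bar>k $ j\<bar>)) / real (Suc N)) \<longlonglongrightarrow> 1"
      by (rule Lim_transform_eventually)
  qed
  then show ?thesis unfolding card by (simp add: prod_dividef)
qed

text \<open>Convolution with the uniform probability weight on a box; the side \<open>Suc N\<close>
  keeps the divisor nonzero for every N.\<close>

definition box_average :: "(int^'n \<Rightarrow> complex) \<Rightarrow> nat \<Rightarrow> int^'n \<Rightarrow> complex" where
  "box_average a N m = (\<Sum>l\<in>int_box (Suc N). a (m - l)) / of_nat (Suc N) ^ CARD('n)"

lemma nn_integral_count_space_shift: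
  fixes g :: "'a::ab_group_add \<Rightarrow> ennreal"
  shows "(\<Sum>\<^sup>+ m. g (m - l)) = (\<Sum>\<^sup>+ m. g m)"
proof (rule nn_integral_bij_count_space)
  show "bij_betw (\<lambda>m. m - l) UNIV UNIV" by (rule bij_betwI[where g = "\<lambda>m. m + l"]) auto
qed

text \<open>Convolution with a probability weight is a contraction of l1. In
  \<open>modulation_invariant_bound\<close> this provides the integrable majorant for interchanging
  limsup and integral.\<close>

lemma box_average_le:
  fixes a :: "int^'n \<Rightarrow> complex"
  shows "(\<Sum>\<^sup>+ m. ennreal (norm (box_average a N m))) \<le> (\<Sum>\<^sup>+ m. ennreal (norm (a m)))"
proof -
  define c where "c = inverse (real (Suc N) ^ CARD('n))"
  have c: "c > 0" by (simp add: c_def del: of_nat_Suc)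
  have "(\<Sum>\<^sup>+ m. ennreal (norm (box_average a N m)))
    \<le> (\<Sum>\<^sup>+ m. ennreal c * (\<Sum>l\<in>int_box (Suc N). ennreal (norm (a (m - l)))))"
  proof (rule nn_integral_mono)
    fix m
    have "norm (box_average a N m) = c * norm (\<Sum>l\<in>int_box (Suc N). a (m - l))"
      by (simp add: box_average_def norm_divide norm_power c_def divide_inverse mult.commute
        norm_mult norm_inverse del: of_nat_Suc)
    also have "\<dots> \<le> c * (\<Sum>l\<in>int_box (Suc N). norm (a (m - l)))"
      using c by (intro mult_left_mono norm_sum) auto
    finally have "ennreal (norm (box_average a N m)) \<le> ennreal (c * (\<Sum>l\<in>int_box (Suc N). norm (a (m
      - l))))"
      by (rule ennreal_leI)
    also have "\<dots> = ennreal c * (\<Sum>l\<in>int_box (Suc N). ennreal (norm (a (m - l))))"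
      using c by (simp add: ennreal_mult sum_nonneg)
    finally show "ennreal (norm (box_average a N m)) \<le> ennreal c * (\<Sum>l\<in>int_box (Suc N). ennreal
      (norm (a (m - l))))" .
  qed
  also have "\<dots> = ennreal c * (\<Sum>l\<in>(int_box (Suc N) :: (int^'n) set). \<integral>\<^sup>+m. ennreal (norm (a (m
    - l))) \<partial>counting)"
    by (subst nn_integral_cmult, simp, subst nn_integral_sum) simp_all
  also have "\<dots> = ennreal c * (of_nat (Suc N ^ CARD('n)) * (\<Sum>\<^sup>+ m. ennreal (norm (a m))))"
    unfolding nn_integral_count_space_shift[of "\<lambda>m. ennreal (norm (a m))"] sum_constant card_int_box ..
  also have "\<dots> = ennreal (c * real (Suc N) ^ CARD('n)) * (\<Sum>\<^sup>+ m. ennreal (norm (a m)))"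
    using c by (simp add: ennreal_mult mult.assoc ennreal_of_nat_eq_real_of_nat del: of_nat_Suc)
  also have "c * real (Suc N) ^ CARD('n) = 1" by (simp add: c_def del: of_nat_Suc)
  finally show ?thesis by simp
qed

text \<open>In l1 the average approaches (sum of a) times the normalised indicator of the box, a
  sequence of norm |sum a|. Replacing the box shifted by k with the box itself costs |a k| times
  their relative symmetric difference, which is at most 2 and tends to 0.\<close>

lemma box_average_limsup:
  fixes a :: "int^'n \<Rightarrow> complex"
  assumes a: "integrable counting a"
  shows "limsup (\<lambda>N. \<integral>\<^sup>+m. ennreal (norm (box_average a N m)) \<partial>counting)
    \<le> ennreal (norm (integral\<^sup>L counting a))"
proof -
  define x where "x N l = (indicator (int_box (Suc N)) l :: real)" for N and l :: "int^'n"
  define c where "c N = inverse (real (Suc N) ^ CARD('n))" for N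
  have c: "c N > 0" for N by (simp add: c_def del: of_nat_Suc)
  define S where "S = integral\<^sup>L counting a"
  \<comment> \<open>The symmetric difference of the box and its translate by k.\<close>
  define D where "D N k = {l. (l - k \<in> int_box (Suc N)) \<noteq> (l \<in> (int_box (Suc N) :: (int^'n) set))}"
    for N k
  have finD: "finite (D N k)" for N k
  proof (rule finite_subset)
    show "D N k \<subseteq> int_box (Suc N) \<union> (\<lambda>l. l + k) ` int_box (Suc N)"
      by (auto simp: D_def image_iff) (metis diff_add_cancel)
  qed (simp add: finite_int_box)
  have cardD: "real (card (D N k)) = 2 * (real (Suc N) ^ CARD('n) - real (card {l \<in> int_box (Suc N).
    l - k \<in> int_box (Suc N)}))" for N k
  proof -
    define A B where "A = (int_box (Suc N) :: (int^'n) set)" and "B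
      = (\<lambda>l. l + k) ` (int_box (Suc N) :: (int^'n) set)"
    have B: "l \<in> B \<longleftrightarrow> l - k \<in> int_box (Suc N)" for l
      by (auto simp: B_def image_iff) (metis diff_add_cancel)
    have fin: "finite A" "finite B" by (auto simp: A_def B_def finite_int_box)
    have card: "card A = Suc N ^ CARD('n)" "card B = Suc N ^ CARD('n)"
      by (auto simp: A_def B_def card_int_box card_image simp del: power_Suc)
    have AB: "A \<inter> B = {l \<in> int_box (Suc N). l - k \<in> int_box (Suc N)}" using B by (auto simp: A_def)
    have "D N k = (A - A \<inter> B) \<union> (B - A \<inter> B)" using B by (auto simp: D_def A_def)
    then have "card (D N k) = card (A - A \<inter> B) + card (B - A \<inter> B)"
      using fin by (simp add: card_Un_disjoint[of "A - A \<inter> B" "B - A \<inter> B"] disjoint_iff)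
    also have "real \<dots> = (real (card A) - real (card (A \<inter> B))) + (real (card B) - real (card (A \<inter> B)))"
    proof -
      have "card (A \<inter> B) \<le> card A" "card (A \<inter> B) \<le> card B" using fin by (auto intro: card_mono)
      then show ?thesis using fin by (simp add: card_Diff_subset del: card_Diff_subset_Int)
    qed
    finally show ?thesis unfolding AB card by simp
  qed
  have lim: "(\<lambda>N. c N * real (card (D N k))) \<longlonglongrightarrow> 0" for k
  proof -
    have "(\<lambda>N. 2 * (1 - real (card {l \<in> int_box (Suc N). l - k \<in> int_box (Suc N)}) / real (Suc N) ^
      CARD('n))) \<longlonglongrightarrow> 2 * (1 - 1)"
      by (intro tendsto_intros int_box_shift_tendsto)
    then show ?thesis unfolding cardD c_def by (simp add: algebra_simps divide_inverse del: of_nat_Suc)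
  qed
  have le2: "c N * real (card (D N k)) \<le> 2" for N k
    unfolding cardD c_def by (simp add: algebra_simps del: of_nat_Suc)
  have conv: "(\<Sum>l\<in>int_box (Suc N). a (m - l)) = (\<Sum>\<^sup>L k. a k * of_real (x N (m - k)))" for N m
  proof -
    have sub: "{k \<in> UNIV. a k * of_real (x N (m - k)) \<noteq> 0} \<subseteq> (\<lambda>l. m - l) ` int_box (Suc N)"
      by (auto simp: x_def indicator_def image_iff split: if_splits) (metis diff_diff_eq2
        add_diff_cancel_left')
    have fin: "finite ((\<lambda>l. m - l) ` (int_box (Suc N) :: (int^'n) set))" by (simp add: finite_int_box)
    have "(\<Sum>\<^sup>L k. a k * of_real (x N (m - k))) = (\<Sum>k\<in>{k \<in> UNIV. a k * of_real (x N (m - k)) \<noteq> 0}. a k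
      * of_real (x N (m - k)))"
      using finite_subset[OF sub fin] by (intro lebesgue_integral_count_space_finite_support) auto
    also have "\<dots> = (\<Sum>k\<in>(\<lambda>l. m - l) ` int_box (Suc N). a k * of_real (x N (m - k)))"
      using sub fin by (intro sum.mono_neutral_left) auto
    also have "\<dots> = (\<Sum>l\<in>int_box (Suc N). a (m - l))"
      by (subst sum.reindex) (auto simp: inj_on_def x_def)
    finally show ?thesis by simp
  qed
  \<comment> \<open>The total replacement error. It tends to 0 by dominated convergence over k with
    majorant 2 |a k|.\<close>
  define R where "R N = (\<Sum>\<^sup>+ k. ennreal (norm (a k)) * ennreal (c N * real (card (D N k))))" for N
  have bound: "(\<Sum>\<^sup>+ m. ennreal (norm (box_average a N m))) \<le> R N + ennreal (norm S)" for N
  proof -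
    have pw: "ennreal (norm (box_average a N m)) \<le> (\<Sum>\<^sup>+ k. ennreal (c N) * (ennreal (norm (a k))
      * indicator (D N k) m)) + ennreal (c N) * (ennreal (norm S) * indicator (int_box (Suc N)) m)"
        for m
    proof -
      have i1: "integrable counting (\<lambda>k. a k * of_real (x N (m - k)))"
        and i2: "integrable counting (\<lambda>k. a k * of_real (x N m))"
        by (auto intro!: Bochner_Integration.integrable_bound[OF a] simp: norm_mult x_def indicator_def)
      have i3: "integrable counting (\<lambda>k. norm (a k) * indicator (D N k) m)"
        by (auto intro!: Bochner_Integration.integrable_bound[OF integrable_norm[OF a]] simp:
          norm_mult indicator_def)
      \<comment> \<open>The convolution is compared with its main term, in which the indicator of
        the box is evaluated at m instead of m - k and the sum over k becomes
        \<open>S\<close>.\<close>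
      have "(\<Sum>l\<in>int_box (Suc N). a (m - l)) = (\<Sum>\<^sup>L k. a k * of_real (x N (m - k)) - a k * of_real (x
        N m)) + S * of_real (x N m)"
        unfolding conv S_def Bochner_Integration.integral_diff[OF i1 i2] by simp
      also have "norm \<dots> \<le> (\<Sum>\<^sup>L k. norm (a k) * indicator (D N k) m) + norm S * x N m"
      proof (rule norm_triangle_mono)
        show "norm (\<Sum>\<^sup>L k. a k * of_real (x N (m - k)) - a k * of_real (x N m))
          \<le> (\<Sum>\<^sup>L k. norm (a k) * indicator (D N k) m)"
        proof (rule order_trans[OF integral_norm_bound], rule integral_mono)
          show "integrable counting (\<lambda>k. norm (a k * of_real (x N (m - k)) - a k * of_real (x N m)))"
            by (rule integrable_norm[OF Bochner_Integration.integrable_diff[OF i1 i2]])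
          show "norm (a k * of_real (x N (m - k)) - a k * of_real (x N m))
            \<le> norm (a k) * indicator (D N k) m" for k
            by (auto simp: x_def D_def indicator_def)
        qed (rule i3)
        show "norm (S * of_real (x N m)) \<le> norm S * x N m" by (simp add: norm_mult x_def)
      qed
      finally have "c N * norm (\<Sum>l\<in>int_box (Suc N). a (m - l))
        \<le> c N * ((\<Sum>\<^sup>L k. norm (a k) * indicator (D N k) m) + norm S * x N m)"
        using c[of N] by (intro mult_left_mono) auto
      moreover have "norm (box_average a N m) = c N * norm (\<Sum>l\<in>int_box (Suc N). a (m - l))"
        by (simp add: box_average_def norm_divide norm_power c_def divide_inverse mult.commute
          norm_mult norm_inverse del: of_nat_Suc)
      ultimately have "ennreal (norm (box_average a N m)) \<le> ennreal (c N * ((\<Sum>\<^sup>L k. norm (a k)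
        * indicator (D N k) m) + norm S * x N m))"
        by (intro ennreal_leI) simp
      also have "\<dots> = ennreal (c N) * ennreal (\<Sum>\<^sup>L k. norm (a k) * indicator (D N k) m) + ennreal (c
        N) * (ennreal (norm S) * indicator (int_box (Suc N)) m)"
        using c[of N] by (simp add: ennreal_mult ennreal_plus distrib_left x_def ennreal_indicator
          integral_nonneg_AE)
      also have "ennreal (\<Sum>\<^sup>L k. norm (a k) * indicator (D N k) m) = (\<Sum>\<^sup>+ k. ennreal (norm (a k)
        * indicator (D N k) m))"
        by (rule nn_integral_eq_integral[symmetric, OF i3]) simp
      also have "\<dots> = (\<Sum>\<^sup>+ k. ennreal (norm (a k)) * indicator (D N k) m)"
        by (simp add: ennreal_mult ennreal_indicator)
      finally show ?thesis by (simp add: nn_integral_cmult)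
    qed
    have "(\<Sum>\<^sup>+ m. ennreal (norm (box_average a N m))) \<le> (\<Sum>\<^sup>+ m. (\<integral>\<^sup>+k. ennreal (c N) * (ennreal (norm
      (a k)) * indicator (D N k) m) \<partial>counting) + ennreal (c N) * (ennreal (norm S) * indicator
        (int_box (Suc N)) m))"
      by (rule nn_integral_mono) (rule pw)
    also have "\<dots> = (\<Sum>\<^sup>+ m. \<integral>\<^sup>+k. ennreal (c N) * (ennreal (norm (a k)) * indicator (D N k) m) \<partial>counting)
       + ennreal (c N) * (ennreal (norm S) * (\<Sum>\<^sup>+ m. indicator (int_box (Suc N) :: (int^'n) set) m))"
      by (simp add: nn_integral_add nn_integral_cmult)
    also have "(\<Sum>\<^sup>+ m. \<integral>\<^sup>+k. ennreal (c N) * (ennreal (norm (a k)) * indicator (D N k) m) \<partial>counting)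
       = (\<Sum>\<^sup>+ k. \<integral>\<^sup>+m. ennreal (c N) * (ennreal (norm (a k)) * indicator (D N k) m) \<partial>counting)"
      by (rule nn_integral_count_space_swap) (auto intro: sigma_finite_measure_count_space)
    also have "\<dots> = R N"
    proof (unfold R_def, rule nn_integral_cong)
      fix k
      have "(\<Sum>\<^sup>+ m. indicator (D N k) m) = ennreal (real (card (D N k)))"
        using finD[of N k] by (simp add: emeasure_count_space ennreal_of_nat_eq_real_of_nat)
      then show "(\<Sum>\<^sup>+ m. ennreal (c N) * (ennreal (norm (a k)) * indicator (D N k) m))
        = ennreal (norm (a k)) * ennreal (c N * real (card (D N k)))"
        using c[of N] by (simp add: nn_integral_cmult ennreal_mult mult_ac)
    qed
    also have "ennreal (c N) * (ennreal (norm S) * (\<Sum>\<^sup>+ m. indicator (int_box (Suc N) :: (int^'n)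
      set) m)) = ennreal (norm S)"
    proof -
      have "(\<Sum>\<^sup>+ m. indicator (int_box (Suc N) :: (int^'n) set) m) = ennreal (real (Suc N) ^ CARD('n))"
        by (simp add: emeasure_count_space finite_int_box card_int_box ennreal_of_nat_eq_real_of_nat
          del: of_nat_Suc power_Suc)
      moreover have "ennreal (c N) * ennreal (real (Suc N) ^ CARD('n)) = 1"
        using c[of N] unfolding ennreal_1[symmetric] by (subst ennreal_mult[symmetric]) (simp_all
          add: c_def del: of_nat_Suc)
      ultimately show ?thesis by (simp add: mult.assoc mult.left_commute[of "ennreal (c N)"])
    qed
    finally show ?thesis .
  qed
  have "R \<longlonglongrightarrow> (\<integral>\<^sup>+k. 0 \<partial>count_space (UNIV :: (int^'n) set))"
    unfolding R_def
  proof (rule nn_integral_dominated_convergence[where w = "\<lambda>k. ennreal (norm (a k)) * 2"])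
    show "AE k in counting. ennreal (norm (a k)) * ennreal (c N * real (card (D N k)))
      \<le> ennreal (norm (a k)) * 2" for N
      using le2 by (intro AE_I2 mult_left_mono) (metis ennreal_leI ennreal_numeral zero_le_numeral,
        simp)
    have "(\<Sum>\<^sup>+ k. ennreal (norm (a k))) < \<infinity>"
      using a unfolding integrable_iff_bounded by simp
    then show "(\<Sum>\<^sup>+ k. ennreal (norm (a k)) * 2) < \<infinity>"
      by (subst nn_integral_multc) (auto simp: ennreal_mult_less_top)
    show "AE k in counting. (\<lambda>N. ennreal (norm (a k)) * ennreal (c N * real (card (D N k)))) \<longlonglongrightarrow> 0"
    proof (rule AE_I2)
      fix k
      have "(\<lambda>N. norm (a k) * (c N * real (card (D N k)))) \<longlonglongrightarrow> norm (a k) * 0"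
        by (intro tendsto_mult tendsto_const lim)
      then have "(\<lambda>N. ennreal (norm (a k) * (c N * real (card (D N k))))) \<longlonglongrightarrow> ennreal 0"
        by (intro tendsto_ennrealI) simp
      then show "(\<lambda>N. ennreal (norm (a k)) * ennreal (c N * real (card (D N k)))) \<longlonglongrightarrow> 0"
        using c by (simp add: ennreal_mult less_imp_le)
    qed
  qed auto
  then have "(\<lambda>N. R N + ennreal (norm S)) \<longlonglongrightarrow> 0 + ennreal (norm S)"
    by (intro tendsto_add tendsto_const) simp
  then have "limsup (\<lambda>N. R N + ennreal (norm S)) = ennreal (norm S)"
    by (intro lim_imp_Limsup) auto
  moreover have "limsup (\<lambda>N. \<integral>\<^sup>+m. ennreal (norm (box_average a N m)) \<partial>counting)
    \<le> limsup (\<lambda>N. R N + ennreal (norm S))"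
    by (intro Limsup_mono always_eventually allI bound)
  ultimately show ?thesis by (simp add: S_def)
qed

section \<open>The short-time Fourier transform and \<open>M\<^sup>1\<close>\<close>

lemma schwartz_iter_partial:
  fixes f :: "real^'n \<Rightarrow> complex"
  assumes "f \<in> schwartz" "bs \<in> lists Basis"
  shows "continuous_on UNIV (iter_partial bs f)"
    and "\<exists>B\<ge>0. \<forall>x. norm (iter_partial bs f x) \<le> B / (1 + norm x) ^ N"
    and "iter_partial bs f differentiable at x"
proof -
  show d: "iter_partial bs f differentiable at x" for x using assms by (auto simp: schwartz_def)
  then show "continuous_on UNIV (iter_partial bs f)"
    by (simp add: continuous_on_eq_continuous_at differentiable_imp_continuous_within)
  have "\<exists>B. \<forall>x. (1 + norm x) ^ N * norm (iter_partial bs f x) \<le> B"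
    using assms unfolding schwartz_def by blast
  then obtain B where B: "\<And>x. (1 + norm x) ^ N * norm (iter_partial bs f x) \<le> B" by blast
  have "B \<ge> 0" by (rule order_trans[OF _ B[of 0]]) simp
  moreover have "norm (iter_partial bs f x) \<le> B / (1 + norm x) ^ N" for x
    using B[of x] by (subst pos_le_divide_eq) (auto simp: mult.commute add_pos_nonneg)
  ultimately show "\<exists>B\<ge>0. \<forall>x. norm (iter_partial bs f x) \<le> B / (1 + norm x) ^ N" by blast
qed

lemma schwartz_bounded:
  fixes f :: "real^'n \<Rightarrow> complex"
  assumes "f \<in> schwartz" obtains B where "\<And>x. norm (f x) \<le> B"
  using schwartz_iter_partial(2)[of f "[]" 0] assms by auto

lemma borel_measurable_cnj [measurable (raw)]:
  assumes "f \<in> borel_measurable M" shows "(\<lambda>x. cnj (f x)) \<in> borel_measurable M"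
  by (rule measurable_compose[OF assms borel_measurable_continuous_onI]) (intro continuous_intros)

text \<open>The sup norm of the test function, the seminorm of order 0, is enough. For integrable
  \<open>h\<close>, membership in \<open>M1_distributions\<close> thereby becomes integrability of
  its short-time Fourier transform.\<close>

lemma tempered_regular_distribution:
  fixes h :: "real^'n \<Rightarrow> complex"
  assumes h: "integrable lborel h"
  shows "tempered_distribution (regular_distribution h)"
proof -
  have i: "integrable lborel (\<lambda>t. h t * cnj (g t))" if g: "g \<in> schwartz" for g
  proof -
    obtain B where B: "\<And>x. norm (g x) \<le> B" using schwartz_bounded[OF g] by blast
    have "continuous_on UNIV (\<lambda>t. cnj (g t))"
      using schwartz_iter_partial(1)[OF g, of "[]"] by (auto intro: continuous_intros)
    then have "(\<lambda>t. cnj (g t)) \<in> borel_measurable lborel" by (simp add: borel_measurable_continuous_onI)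
    then show ?thesis by (rule integrable_mult_bounded[OF h, where B = B]) (use B in auto)
  qed
  have "antilinear_on schwartz (regular_distribution h)"
    unfolding antilinear_on_def
  proof (intro conjI ballI allI)
    fix f g :: "real^'n \<Rightarrow> complex" and a assume f: "f \<in> schwartz" and g: "g \<in> schwartz"
    show "regular_distribution h (\<lambda>t. f t + g t) = regular_distribution h f + regular_distribution h g"
      unfolding regular_distribution_def Bochner_Integration.integral_add[OF i[OF f] i[OF g], symmetric]
      by (simp add: distrib_left)
  next
    fix f :: "real^'n \<Rightarrow> complex" and a
    have "regular_distribution h (\<lambda>t. a * f t) = (LINT t|lborel. cnj a * (h t * cnj (f t)))"
      by (simp add: regular_distribution_def mult_ac)
    then show "regular_distribution h (\<lambda>t. a * f t) = cnj a * regular_distribution h f"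
      by (simp add: regular_distribution_def)
  qed
  moreover have "norm (regular_distribution h g) \<le> (LINT t|lborel. norm (h t)) * B"
    if g: "g \<in> schwartz" and B: "\<forall>bs\<in>lists Basis. length bs \<le> 0 \<longrightarrow> (\<forall>x. (1 + norm x) ^ 0
      * norm (iter_partial bs g x) \<le> B)" for g B
  proof -
    have gB: "norm (g x) \<le> B" for x using B[rule_format, of "[]" x] by simp
    have "norm (regular_distribution h g) \<le> (LINT t|lborel. norm (h t) * B)"
      unfolding regular_distribution_def
    proof (rule order_trans[OF integral_norm_bound], rule integral_mono)
      show "integrable lborel (\<lambda>t. norm (h t * cnj (g t)))" using i[OF g] by (rule integrable_norm)
      show "integrable lborel (\<lambda>t. norm (h t) * B)" using h by simp
      show "norm (h t * cnj (g t)) \<le> norm (h t) * B" for t using gB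
        by (simp add: norm_mult mult_left_mono)
    qed
    then show ?thesis by simp
  qed
  ultimately show ?thesis unfolding tempered_distribution_def
    by (intro conjI exI[of _ "LINT t|lborel. norm (h t)"] exI[of _ 0]) auto
qed

locale window =
  fixes \<phi> :: "real^'n::finite \<Rightarrow> complex"
  assumes phi: "\<phi> \<in> schwartz" "\<phi> \<noteq> (\<lambda>_. 0)"
begin

lemma continuous_phi: "continuous_on UNIV \<phi>"
  using schwartz_iter_partial(1)[OF phi(1), of "[]"] by simp

lemma measurable_phi [measurable]: "\<phi> \<in> borel_measurable borel"
  by (rule borel_measurable_continuous_onI[OF continuous_phi])

lemma integrable_phi: "integrable lborel \<phi>"
proof -
  obtain B where B: "\<And>x. norm (\<phi> x) \<le> B / (1 + norm x) ^ (2 * CARD('n))"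
    using schwartz_iter_partial(2)[OF phi(1), of "[]"] by auto
  show ?thesis
  proof (rule Bochner_Integration.integrable_bound)
    show "integrable lborel (\<lambda>x::real^'n. B * (1 / (1 + norm x) ^ (2 * CARD('n))))"
      by (rule integrable_mult_right[OF integrable_decay])
    show "AE x in lborel. norm (\<phi> x) \<le> norm (B * (1 / (1 + norm x) ^ (2 * CARD('n))))"
    proof (rule AE_I2)
      fix x
      have "norm (\<phi> x) \<le> B * (1 / (1 + norm x) ^ (2 * CARD('n)))" using B[of x] by simp
      then show "norm (\<phi> x) \<le> norm (B * (1 / (1 + norm x) ^ (2 * CARD('n))))"
        unfolding real_norm_def by linarith
    qed
  qed simp
qed

text \<open>The slice of \<open>h\<close> seen through the window at x. Its Fourier transform at w
  is \<open>V h (x, w)\<close> up to a unimodular phase (\<open>V_eq\<close>), so norms are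
  estimated slice by slice.\<close>

definition cut :: "(real^'n \<Rightarrow> complex) \<Rightarrow> real^'n \<Rightarrow> real^'n \<Rightarrow> complex" where
  "cut h x t = h t * cnj (\<phi> (t - x))"

definition V :: "(real^'n \<Rightarrow> complex) \<Rightarrow> (real^'n) \<times> (real^'n) \<Rightarrow> complex" where
  "V h z = regular_distribution h (rho z \<phi>)"

lemma V_eq: "V h (x, w) = cis (pi * (x \<bullet> w)) * fourier (cut h x) w"
proof -
  have "V h (x, w) = (LINT t|lborel. cis (pi * (x \<bullet> w)) * (cut h x t * cis (- 2 * pi * (w \<bullet> t))))"
    by (simp add: V_def regular_distribution_def rho_def cut_def cis_cnj mult_ac)
  then show ?thesis by (simp add: fourier_def)
qed

lemma norm_V: "norm (V h (x, w)) = norm (fourier (cut h x) w)"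
  by (simp add: V_eq norm_mult)

lemma integrable_cut:
  assumes h: "integrable lborel h" shows "integrable lborel (cut h x)"
proof -
  obtain B where B: "\<And>x. norm (\<phi> x) \<le> B" using schwartz_bounded[OF phi(1)] by blast
  have "(\<lambda>t. cnj (\<phi> (t - x))) \<in> borel_measurable lborel"
    by (auto intro!: borel_measurable_continuous_onI continuous_intros continuous_on_compose2[OF
      continuous_phi])
  then show ?thesis unfolding cut_def[abs_def] by (rule integrable_mult_bounded[OF h, where B
    = B]) (use B in auto)
qed

lemma continuous_cut: "continuous_on UNIV h \<Longrightarrow> continuous_on UNIV (cut h x)"
  unfolding cut_def[abs_def]
  by (intro continuous_intros continuous_on_compose2[OF continuous_phi]) auto

lemma M1_iff: "h \<in> M1 \<phi> \<longleftrightarrow> continuous_on UNIV h \<and> integrable lborel h \<and> integrable lborel (V h)"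
  by (auto simp: M1_def M1_distributions_def tempered_regular_distribution V_def[abs_def])

lemma M1_norm_eq: "M1_norm \<phi> h = (LINT z|lborel. norm (V h z))"
  by (simp add: M1_norm_def V_def)

lemma V_add:
  assumes "integrable lborel h" "integrable lborel g"
  shows "V (\<lambda>t. h t + g t) z = V h z + V g z"
proof -
  have i: "integrable lborel (\<lambda>t. f t * cnj (rho z \<phi> t))" if f: "integrable lborel f" for f
  proof -
    obtain B where B: "\<And>x. norm (\<phi> x) \<le> B" using schwartz_bounded[OF phi(1)] by blast
    have "(\<lambda>t. cnj (rho z \<phi> t)) \<in> borel_measurable lborel"
      using continuous_phi unfolding rho_def cis_conv_exp
      by (auto intro!: borel_measurable_continuous_onI continuous_intros continuous_on_compose2[of
        UNIV \<phi>])
    then show ?thesis by (rule integrable_mult_bounded[OF f, where B = B]) (use B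
      in \<open>auto simp: rho_def norm_mult\<close>)
  qed
  show ?thesis
    unfolding V_def regular_distribution_def Bochner_Integration.integral_add[OF i[OF assms(1)] i[OF
      assms(2)], symmetric]
    by (simp add: distrib_right)
qed

lemma V_cmult: "V (\<lambda>t. a * h t) z = a * V h z"
  by (simp add: V_def regular_distribution_def mult.assoc)

lemma M1_add: "h \<in> M1 \<phi> \<Longrightarrow> g \<in> M1 \<phi> \<Longrightarrow> (\<lambda>t. h t + g t) \<in> M1 \<phi>"
proof -
  assume h: "h \<in> M1 \<phi>" and g: "g \<in> M1 \<phi>"
  then have "V (\<lambda>t. h t + g t) = (\<lambda>z. V h z + V g z)" by (auto simp: M1_iff V_add)
  then show ?thesis using h g unfolding M1_iff by (auto intro!: continuous_intros)
qed

lemma M1_cmult: "h \<in> M1 \<phi> \<Longrightarrow> (\<lambda>t. a * h t) \<in> M1 \<phi>"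
proof -
  assume h: "h \<in> M1 \<phi>"
  have "V (\<lambda>t. a * h t) = (\<lambda>z. a * V h z)" by (auto simp: V_cmult)
  then show ?thesis using h unfolding M1_iff by (auto intro!: continuous_intros)
qed

lemma M1_zero: "(\<lambda>t. 0) \<in> M1 \<phi>"
  unfolding M1_iff by (simp add: V_def[abs_def] regular_distribution_def)

lemma M1_sum: "finite I \<Longrightarrow> (\<And>i. i \<in> I \<Longrightarrow> h i \<in> M1 \<phi>) \<Longrightarrow> (\<lambda>t. \<Sum>i\<in>I. h i t) \<in> M1 \<phi>"
  by (induction I rule: finite_induct) (auto intro: M1_zero M1_add)

lemma antilinear_add: "antilinear_on W \<psi> \<Longrightarrow> h \<in> W \<Longrightarrow> g \<in> W \<Longrightarrow> \<psi> (\<lambda>t. h t + g t) = \<psi> h + \<psi> g"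
  and antilinear_cmult: "antilinear_on W \<psi> \<Longrightarrow> h \<in> W \<Longrightarrow> \<psi> (\<lambda>t. a * h t) = cnj a * \<psi> h"
  by (simp_all add: antilinear_on_def)

lemma antilinear_sum:
  assumes "antilinear_on (M1 \<phi>) \<psi>" "finite I" "\<And>i. i \<in> I \<Longrightarrow> h i \<in> M1 \<phi>"
  shows "\<psi> (\<lambda>t. \<Sum>i\<in>I. h i t) = (\<Sum>i\<in>I. \<psi> (h i))"
  using assms(2,3)
proof (induction I rule: finite_induct)
  case empty
  have "\<psi> (\<lambda>t. 0 * 0) = cnj 0 * \<psi> (\<lambda>t. 0)"
    using antilinear_cmult[OF assms(1) M1_zero, of 0] .
  then show ?case by simp
next
  case (insert i I)
  then have "\<psi> (\<lambda>t. h i t + (\<Sum>i\<in>I. h i t)) = \<psi> (h i) + \<psi> (\<lambda>t. \<Sum>i\<in>I. h i t)"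
    by (intro antilinear_add[OF assms(1)] M1_sum) auto
  then show ?case using insert by simp
qed

lemma rho_continuous:
  assumes "continuous_on UNIV h" shows "continuous_on UNIV (rho z h)"
proof -
  have "continuous_on UNIV (\<lambda>t. h (t - fst z))"
    by (rule continuous_on_compose2[OF assms]) (auto intro!: continuous_intros)
  then show ?thesis unfolding rho_def cis_conv_exp by (intro continuous_intros)
qed

lemma rho_integrable:
  assumes "integrable lborel h" shows "integrable lborel (rho z h)"
proof -
  have "integrable lborel (\<lambda>t. h (- fst z + t))"
    by (rule integrable_lborel_shift[OF assms])
  then have "integrable lborel (\<lambda>t. h (t - fst z) * e2pi (snd z \<bullet> t))"
    by (intro integrable_mult_cis) simp_all
  then have "integrable lborel (\<lambda>t. cis (- pi * (fst z \<bullet> snd z)) * (h (t - fst z) * e2pi (snd z \<bullet> t)))"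
    by (rule integrable_mult_right)
  then show ?thesis unfolding rho_def mult.commute[of "h _"] .
qed

text \<open>Covariance: a time-frequency shift translates the short-time Fourier transform up to a
  phase. Hence \<open>M1\<close> is invariant under \<open>rho\<close>.\<close>

lemma V_rho:
  assumes "h \<in> borel_measurable borel"
  shows "V (rho (a, b) h) (x, w) = cis (pi * (b \<bullet> x - a \<bullet> w)) * V h (x - a, w - b)"
proof -
  have m[measurable]: "h \<in> borel_measurable borel" by fact
  have c: "cut (rho (a, b) h) x \<in> borel_measurable borel"
    unfolding cut_def[abs_def] rho_def
    by (intro borel_measurable_times borel_measurable_cnj borel_measurable_cis) auto
  have "fourier (cut (rho (a, b) h) x) w = (LINT t|lborel. cut (rho (a, b) h) x (a + t) * cis (- 2
    * pi * (w \<bullet> (a + t))))"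
    unfolding fourier_def using c by (intro integral_lborel_shift) simp
  also have "\<dots> = (LINT t|lborel. cis (pi * (a \<bullet> b) - 2 * pi * (a \<bullet> w)) * (cut h (x - a) t * cis (- 2
    * pi * ((w - b) \<bullet> t))))"
  proof (rule Bochner_Integration.integral_cong[OF refl])
    fix t
    have "cis (- pi * (a \<bullet> b)) * e2pi (b \<bullet> (a + t)) * cis (- 2 * pi * (w \<bullet> (a + t)))
       = cis (pi * (a \<bullet> b) - 2 * pi * (a \<bullet> w)) * cis (- 2 * pi * ((w - b) \<bullet> t))"
    proof -
      have "- pi * (a \<bullet> b) + 2 * pi * (b \<bullet> (a + t)) + - 2 * pi * (w \<bullet> (a + t))
        = pi * (a \<bullet> b) - 2 * pi * (a \<bullet> w) + - 2 * pi * ((w - b) \<bullet> t)"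
        by (simp add: inner_diff_left inner_add_right inner_commute[of b a] inner_commute[of w a]
          algebra_simps)
      then show ?thesis by (simp only: cis_mult)
    qed
    then show "cut (rho (a, b) h) x (a + t) * cis (- 2 * pi * (w \<bullet> (a + t)))
      = cis (pi * (a \<bullet> b) - 2 * pi * (a \<bullet> w)) * (cut h (x - a) t * cis (- 2 * pi * ((w - b) \<bullet> t)))"
      by (simp add: cut_def rho_def mult_ac diff_diff_eq2 add.commute)
  qed
  also have "\<dots> = cis (pi * (a \<bullet> b) - 2 * pi * (a \<bullet> w)) * fourier (cut h (x - a)) (w - b)"
    by (simp add: fourier_def)
  finally have "V (rho (a, b) h) (x, w) = cis (pi * (x \<bullet> w)) * cis (pi * (a \<bullet> b) - 2 * pi * (a \<bullet> w))
    * fourier (cut h (x - a)) (w - b)"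
    by (simp add: V_eq)
  also have "cis (pi * (x \<bullet> w)) * cis (pi * (a \<bullet> b) - 2 * pi * (a \<bullet> w)) = cis (pi * (b \<bullet> x - a \<bullet> w))
    * cis (pi * ((x - a) \<bullet> (w - b)))"
  proof -
    have "pi * (x \<bullet> w) + (pi * (a \<bullet> b) - 2 * pi * (a \<bullet> w)) = pi * (b \<bullet> x - a \<bullet> w) + pi * ((x
      - a) \<bullet> (w - b))"
      by (simp add: inner_diff_left inner_diff_right inner_commute[of b x] algebra_simps)
    then show ?thesis by (simp only: cis_mult)
  qed
  finally show ?thesis by (simp only: V_eq mult.assoc)
qed

lemma M1_rho:
  assumes "h \<in> M1 \<phi>" shows "rho z h \<in> M1 \<phi>"
proof -
  obtain a b where z: "z = (a, b)" by fastforce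
  have h: "continuous_on UNIV h" "integrable lborel h" "integrable lborel (V h)" using assms
    by (auto simp: M1_iff)
  have hm: "h \<in> borel_measurable borel" by (rule borel_measurable_continuous_onI[OF h(1)])
  have "integrable lborel (\<lambda>p. V h (- z + p))" by (rule integrable_lborel_shift[OF h(3)])
  then have "integrable lborel (\<lambda>p. V h (p - z))" by simp
  then have "integrable lborel (\<lambda>p. V h (p - z) * cis (pi * (b \<bullet> fst p - a \<bullet> snd p)))"
    by (rule integrable_mult_cis) (auto intro!: borel_measurable_continuous_onI continuous_intros)
  moreover have "V (rho z h) = (\<lambda>p. V h (p - z) * cis (pi * (b \<bullet> fst p - a \<bullet> snd p)))"
  proof
    fix p show "V (rho z h) p = V h (p - z) * cis (pi * (b \<bullet> fst p - a \<bullet> snd p))"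
      using V_rho[OF hm, of a b "fst p" "snd p"] by (simp add: z mult.commute minus_prod_def)
  qed
  ultimately have "integrable lborel (V (rho z h))" by simp
  then show ?thesis using h by (simp add: M1_iff rho_continuous rho_integrable)
qed

text \<open>Cancelling the unimodular phase in \<open>V\<close> leaves a jointly integrable family
  of Fourier transforms; Fubini makes almost every slice eligible for
  \<open>fourier_inversion\<close>.\<close>

lemma M1_integrable_pair:
  assumes h: "h \<in> M1 \<phi>"
  shows "integrable (lborel \<Otimes>\<^sub>M lborel) (\<lambda>(x, w). fourier (cut h x) w)"
    and "M1_norm \<phi> h = (LINT x|lborel. LINT w|lborel. norm (fourier (cut h x) w))"
    and "AE x in lborel. integrable lborel (fourier (cut h x))"
proof -
  have V: "integrable (lborel \<Otimes>\<^sub>M lborel) (V h)" using h by (simp add: M1_iff lborel_prod)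
  have "(\<lambda>z. - pi * (fst z \<bullet> snd z)) \<in> borel_measurable (lborel \<Otimes>\<^sub>M lborel :: ((real^'n) \<times> (real^'n))
    measure)"
    by (auto simp: lborel_prod intro!: borel_measurable_continuous_onI continuous_intros)
  from integrable_mult_cis[OF V this]
  have "integrable (lborel \<Otimes>\<^sub>M lborel) (\<lambda>z. V h z * cis (- pi * (fst z \<bullet> snd z)))" .
  moreover have "(\<lambda>z. V h z * cis (- pi * (fst z \<bullet> snd z))) = (\<lambda>(x, w). fourier (cut h x) w)"
  proof
    fix z :: "(real^'n) \<times> (real^'n)"
    have "cis (pi * (fst z \<bullet> snd z)) * cis (- pi * (fst z \<bullet> snd z)) = 1" by (simp add: cis_mult)
    then show "V h z * cis (- pi * (fst z \<bullet> snd z)) = (case z of (x, w) \<Rightarrow> fourier (cut h x) w)"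
      by (cases z) (simp add: V_eq)
  qed
  ultimately show i: "integrable (lborel \<Otimes>\<^sub>M lborel) (\<lambda>(x, w). fourier (cut h x) w)" by simp
  show "AE x in lborel. integrable lborel (fourier (cut h x))"
    using lborel_pair.AE_integrable_fst[OF i] .
  have "M1_norm \<phi> h = (LINT z|(lborel \<Otimes>\<^sub>M lborel). norm (case z of (x, w) \<Rightarrow> fourier (cut h x) w))"
    unfolding M1_norm_eq lborel_prod[symmetric] by (rule Bochner_Integration.integral_cong[OF refl])
      (auto simp: norm_V)
  also have "\<dots> = (LINT z|(lborel \<Otimes>\<^sub>M lborel). (case z of (x, w) \<Rightarrow> norm (fourier (cut h x) w)))"
    by (simp add: case_prod_unfold)
  also have "\<dots> = (LINT x|lborel. LINT w|lborel. norm (fourier (cut h x) w))"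
    using integrable_norm[OF i] by (intro lborel_pair.integral_fst[symmetric]) (simp add:
      case_prod_unfold)
  finally show "M1_norm \<phi> h = (LINT x|lborel. LINT w|lborel. norm (fourier (cut h x) w))" .
qed

end

lemma measurable_ennreal_norm:
  "f \<in> borel_measurable M \<Longrightarrow> (\<lambda>x. ennreal (norm (f x))) \<in> borel_measurable M"
  by measurable

context window begin

lemma nn_integral_M1:
  assumes h: "h \<in> M1 \<phi>"
  shows "(\<integral>\<^sup>+x. \<integral>\<^sup>+w. ennreal (norm (fourier (cut h x) w)) \<partial>lborel \<partial>lborel) = ennreal (M1_norm \<phi> h)"
proof -
  let ?F = "\<lambda>(x, w). fourier (cut h x) w"
  have i: "integrable (lborel \<Otimes>\<^sub>M lborel) ?F" by (rule M1_integrable_pair(1)[OF h])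
  have n: "norm (?F z) = (case z of (x, w) \<Rightarrow> norm (fourier (cut h x) w))" for z by (cases z) simp
  have in': "integrable (lborel \<Otimes>\<^sub>M lborel) (\<lambda>(x, w). norm (fourier (cut h x) w))"
    using integrable_norm[OF i] unfolding n .
  have m: "(\<lambda>z. ennreal (norm (?F z))) \<in> borel_measurable (lborel \<Otimes>\<^sub>M lborel)"
    by (rule measurable_ennreal_norm[OF borel_measurable_integrable[OF i]])
  have "(\<integral>\<^sup>+x. \<integral>\<^sup>+w. ennreal (norm (fourier (cut h x) w)) \<partial>lborel \<partial>lborel)
      = (\<integral>\<^sup>+z. ennreal (norm (?F z)) \<partial>(lborel \<Otimes>\<^sub>M lborel))"
    using lborel.nn_integral_fst[OF m] by simp
  also have "\<dots> = ennreal (LINT z|(lborel \<Otimes>\<^sub>M lborel). norm (?F z))"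
    by (rule nn_integral_eq_integral[OF integrable_norm[OF i]]) simp
  also have "(LINT z|(lborel \<Otimes>\<^sub>M lborel). norm (?F z)) = M1_norm \<phi> h"
    unfolding n M1_integrable_pair(2)[OF h] by (rule lborel_pair.integral_fst[symmetric, OF in'])
  finally show ?thesis .
qed

lemma M1_norm_nonneg: "M1_norm \<phi> h \<ge> 0"
  by (simp add: M1_norm_def)

text \<open>By Fourier inversion \<open>\<bar>h t\<bar> \<bar>\<phi> (t - x)\<bar>\<close> is at most the \<open>L\<^sup>1\<close>-norm of the short-time Fourier
  transform in the frequency variable. Integrate over those \<open>x\<close> for which \<open>t - x\<close> lies in a ball
  where \<open>\<bar>\<phi>\<bar>\<close> is bounded below; the balls belonging to distinct lattice points are disjoint.\<close>

lemma lattice_values_bound: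
  assumes s: "\<And>j. s j > 0"
  shows "\<exists>C\<ge>0. \<forall>h\<in>M1 \<phi>. integrable counting (\<lambda>k. h (lat s k)) \<and>
    (\<Sum>\<^sup>L k. norm (h (lat s k))) \<le> C * M1_norm \<phi> h"
proof -
  obtain y0 where y0: "\<phi> y0 \<noteq> 0" using phi(2) by auto
  define c where "c = norm (\<phi> y0) / 2"
  have c: "c > 0" using y0 by (simp add: c_def)
  have "isCont \<phi> y0" using continuous_phi by (simp add: continuous_on_eq_continuous_at)
  then obtain r1 where r1: "r1 > 0" "\<And>y. dist y y0 < r1 \<Longrightarrow> dist (\<phi> y) (\<phi> y0) < c"
    unfolding continuous_at_eps_delta using c by blast
  \<comment> \<open>The bound \<open>r1\<close> keeps |\<phi>| \<ge> c on the ball; half the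
    smallest spacing ensures that at most one lattice point k has \<open>lat s k - x\<close> in the
    ball.\<close>
  define r where "r = min r1 (Min (range s) / 2)"
  have ms: "Min (range s) > 0" "\<And>j. Min (range s) \<le> s j" using s by (auto simp: Min_gr_iff)
  have r: "r > 0" using r1 ms by (simp add: r_def)
  define B where "B = ball y0 r"
  have Bm: "B \<in> sets borel" by (simp add: B_def)
  have phi_c: "norm (\<phi> y) \<ge> c" if "y \<in> B" for y
  proof -
    have "norm (\<phi> y - \<phi> y0) < c" using r1(2)[of y] that
      by (simp add: B_def r_def dist_norm dist_commute norm_minus_commute)
    then show ?thesis using norm_triangle_ineq2[of "\<phi> y0" "\<phi> y"] unfolding c_def
      by (simp add: norm_minus_commute)
  qed
  define b where "b = measure lborel B"
  have b: "b > 0" unfolding b_def B_def by (rule content_ball_pos[OF r])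
  have emB: "emeasure lborel B = ennreal b"
    using emeasure_lborel_ball_finite[of y0 r] unfolding b_def B_def
      by (intro emeasure_eq_ennreal_measure) auto
  have disj: "k = k'" if "lat s k - x \<in> B" "lat s k' - x \<in> B" for k k' x
  proof (rule ccontr)
    assume "k \<noteq> k'"
    then obtain j where j: "k $ j \<noteq> k' $ j" by (auto simp: vec_eq_iff)
    have "dist (lat s k - x) (lat s k' - x) < 2 * r"
      using that dist_triangle_half_r[of y0 "lat s k - x" "2 * r" "lat s k' - x"] by (simp add: B_def)
    then have n: "norm (lat s k - lat s k') < 2 * r" by (simp add: dist_norm)
    have "s j * 1 \<le> s j * \<bar>real_of_int (k $ j - k' $ j)\<bar>"
      using s[of j] j by (intro mult_left_mono) linarith+
    also have "\<dots> = \<bar>(lat s k - lat s k') $ j\<bar>"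
      using s[of j] by (simp add: lat_def abs_mult flip: right_diff_distrib)
    also have "\<dots> \<le> norm (lat s k - lat s k')" by (rule component_le_norm_cart)
    finally have "s j < 2 * r" using n by simp
    moreover have "2 * r \<le> Min (range s)"
      using min.cobounded2[of r1 "Min (range s) / 2"] unfolding r_def by linarith
    ultimately show False using ms(2)[of j] by linarith
  qed
  \<comment> \<open>Each lattice value h(m) is seen on a set of x of volume \<open>b\<close>, where
    |h(m) \<phi>(m - x)| \<ge> c |h(m)|.\<close>
  define C where "C = 1 / (c * b)"
  have C: "C > 0" using c b by (simp add: C_def)
  have "integrable counting (\<lambda>k. h (lat s k)) \<and> (\<Sum>\<^sup>L k. norm (h (lat s k))) \<le> C * M1_norm \<phi> h"
    if h: "h \<in> M1 \<phi>" for h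
  proof -
    have hc: "continuous_on UNIV h" and hi: "integrable lborel h" using h by (auto simp: M1_iff)
    define I where "I x = (\<integral>\<^sup>+w. ennreal (norm (fourier (cut h x) w)) \<partial>lborel)" for x
    have inv: "AE x in lborel. \<forall>k. ennreal (norm (cut h x (lat s k))) \<le> I x"
      using M1_integrable_pair(3)[OF h]
    proof eventually_elim
      fix x assume F: "integrable lborel (fourier (cut h x))"
      show "\<forall>k. ennreal (norm (cut h x (lat s k))) \<le> I x"
      proof
        fix k
        have "norm (cut h x (lat s k)) = norm (LINT w|lborel. fourier (cut h x) w * e2pi (w \<bullet> lat s k))"
          using fourier_inversion[OF integrable_cut[OF hi] continuous_cut[OF hc] F] by simp
        also have "\<dots> \<le> (LINT w|lborel. norm (fourier (cut h x) w))"
          by (rule order_trans[OF integral_norm_bound]) (simp add: norm_mult)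
        finally have "ennreal (norm (cut h x (lat s k))) \<le> ennreal (LINT w|lborel. norm (fourier
          (cut h x) w))"
          by (rule ennreal_leI)
        also have "\<dots> = I x" unfolding I_def
          by (rule nn_integral_eq_integral[OF integrable_norm[OF F], symmetric]) simp
        finally show "ennreal (norm (cut h x (lat s k))) \<le> I x" .
      qed
    qed
    have indm: "(\<lambda>x. indicator B (lat s k - x) :: ennreal) \<in> borel_measurable borel" for k
      using Bm by (intro measurable_compose[OF _ borel_measurable_indicator[OF Bm]]) auto
    have "ennreal (c * b) * (\<Sum>\<^sup>+ k. ennreal (norm (h (lat s k))))
       = (\<Sum>\<^sup>+ k. \<integral>\<^sup>+x. ennreal (c * norm (h (lat s k))) * indicator B (lat s k - x) \<partial>lborel)"
    proof -
      have "(\<integral>\<^sup>+x. ennreal (c * norm (h (lat s k))) * indicator B (lat s k - x) \<partial>lborel)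
        = ennreal (c * b) * ennreal (norm (h (lat s k)))" for k
      proof -
        have "(\<integral>\<^sup>+x. indicator B (lat s k - x) \<partial>lborel) = (\<integral>\<^sup>+x. indicator B x \<partial>lborel)"
          by (rule nn_integral_lborel_reflect[symmetric]) (rule borel_measurable_indicator[OF Bm])
        also have "\<dots> = ennreal b" using Bm emB by simp
        finally show ?thesis using c b indm[of k] by (subst nn_integral_cmult) (simp_all add:
          ennreal_mult mult_ac)
      qed
      then show ?thesis by (simp add: nn_integral_cmult)
    qed
    also have "\<dots> = (\<integral>\<^sup>+x. \<integral>\<^sup>+k. ennreal (c * norm (h (lat s k))) * indicator B (lat s k - x) \<partial>counting
      \<partial>lborel)"
      using indm by (intro nn_integral_count_space_swap sigma_finite_lborel
        borel_measurable_times_ennreal) auto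
    also have "\<dots> \<le> (\<integral>\<^sup>+x. I x \<partial>lborel)"
    proof (rule nn_integral_mono_AE)
      show "AE x in lborel. (\<Sum>\<^sup>+ k. ennreal (c * norm (h (lat s k))) * indicator B (lat s k - x)) \<le> I x"
        using inv
      proof eventually_elim
        fix x assume inv: "\<forall>k. ennreal (norm (cut h x (lat s k))) \<le> I x"
        have pt: "ennreal (c * norm (h (lat s k))) \<le> I x" if "lat s k - x \<in> B" for k
        proof -
          have "c * norm (h (lat s k)) \<le> norm (cut h x (lat s k))"
            using phi_c[OF that] by (simp add: cut_def norm_mult mult.commute[of c] mult_left_mono)
          then have "ennreal (c * norm (h (lat s k))) \<le> ennreal (norm (cut h x (lat s k)))"
            by (rule ennreal_leI)
          then show ?thesis using inv by (meson order_trans)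
        qed
        show "(\<Sum>\<^sup>+ k. ennreal (c * norm (h (lat s k))) * indicator B (lat s k - x)) \<le> I x"
        proof (cases "\<exists>k. lat s k - x \<in> B")
          case True
          then obtain k0 where k0: "lat s k0 - x \<in> B" by blast
          have "(\<Sum>\<^sup>+ k. ennreal (c * norm (h (lat s k))) * indicator B (lat s k - x))
            \<le> (\<Sum>\<^sup>+ k. I x * indicator {k0} k)"
          proof (rule nn_integral_mono)
            fix k
            show "ennreal (c * norm (h (lat s k))) * indicator B (lat s k - x) \<le> I x * indicator {k0} k"
            proof (cases "lat s k - x \<in> B")
              case True
              then have "k = k0" using disj[OF k0] by simp
              then show ?thesis using pt[OF True] True by simp
            next
              case False then show ?thesis by simp
            qed
          qed
          also have "\<dots> = I x" by (subst nn_integral_cmult_indicator) (auto simp: emeasure_count_space)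
          finally show ?thesis .
        next
          case False then show ?thesis by simp
        qed
      qed
    qed
    also have "\<dots> = ennreal (M1_norm \<phi> h)" unfolding I_def by (rule nn_integral_M1[OF h])
    finally have *: "ennreal (c * b) * (\<Sum>\<^sup>+ k. ennreal (norm (h (lat s k)))) \<le> ennreal (M1_norm \<phi> h)" .
    have "(\<Sum>\<^sup>+ k. ennreal (norm (h (lat s k)))) = ennreal C * (ennreal (c * b) * (\<Sum>\<^sup>+ k. ennreal (norm
      (h (lat s k)))))"
    proof -
      have "ennreal C * ennreal (c * b) = ennreal (C * (c * b))" using C c b
        by (subst ennreal_mult) auto
      also have "C * (c * b) = 1" using c b by (simp add: C_def)
      finally show ?thesis by (simp add: mult.assoc[symmetric])
    qed
    also have "\<dots> \<le> ennreal C * ennreal (M1_norm \<phi> h)" by (intro mult_left_mono *) simp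
    also have "\<dots> = ennreal (C * M1_norm \<phi> h)" using C M1_norm_nonneg[of h] by (simp add: ennreal_mult)
    finally have le: "(\<Sum>\<^sup>+ k. ennreal (norm (h (lat s k)))) \<le> ennreal (C * M1_norm \<phi> h)" .
    then have i: "integrable counting (\<lambda>k. h (lat s k))"
      unfolding integrable_iff_bounded by (auto intro: le_less_trans)
    have "ennreal (\<Sum>\<^sup>L k. norm (h (lat s k))) \<le> ennreal (C * M1_norm \<phi> h)"
      using le nn_integral_eq_integral[OF integrable_norm[OF i]] by simp
    then have "(\<Sum>\<^sup>L k. norm (h (lat s k))) \<le> C * M1_norm \<phi> h"
      using C M1_norm_nonneg[of h] by (subst (asm) ennreal_le_iff) auto
    with i show ?thesis by blast
  qed
  then show ?thesis using C by (intro exI[of _ C]) auto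
qed

lemma fourier_cut_modulate:
  "fourier (cut (rho (0, b) h) x) w = fourier (cut h x) (w - b)"
proof -
  have "cut (rho (0, b) h) x t * cis (- 2 * pi * (w \<bullet> t)) = cut h x t * cis (- 2 * pi * ((w
    - b) \<bullet> t))" for t
  proof -
    have "2 * pi * (b \<bullet> t) + - 2 * pi * (w \<bullet> t) = - 2 * pi * ((w - b) \<bullet> t)"
      by (simp add: inner_diff_left algebra_simps)
    then have "e2pi (b \<bullet> t) * cis (- 2 * pi * (w \<bullet> t)) = cis (- 2 * pi * ((w - b) \<bullet> t))"
      by (simp only: cis_mult)
    then show ?thesis by (simp add: cut_def rho_def mult_ac)
  qed
  then show ?thesis by (simp add: fourier_def)
qed

lemma fourier_cut_sum:
  assumes "finite I" "\<And>i. i \<in> I \<Longrightarrow> integrable lborel (h i)"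
  shows "fourier (cut (\<lambda>t. \<Sum>i\<in>I. c * h i t) x) w = c * (\<Sum>i\<in>I. fourier (cut (h i) x) w)"
proof -
  have "cut (\<lambda>t. \<Sum>i\<in>I. c * h i t) x t * cis (- 2 * pi * (w \<bullet> t))
    = c * (\<Sum>i\<in>I. cut (h i) x t * cis (- 2 * pi * (w \<bullet> t)))" for t
    by (simp add: cut_def sum_distrib_left sum_distrib_right mult.assoc)
  moreover have "integrable lborel (\<lambda>t. cut (h i) x t * cis (- 2 * pi * (w \<bullet> t)))" if "i \<in> I" for i
    by (intro integrable_mult_cis integrable_cut assms that) simp
  ultimately show ?thesis by (simp add: fourier_def Bochner_Integration.integral_sum)
qed

text \<open>Replace \<open>h\<close> by averages of its modulations, which does not change \<open>\<psi> h\<close>. The \<open>M\<^sup>1\<close>-norms of the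
  averages are asymptotically bounded by the integral of the periodized short-time Fourier
  transform over one cell, which the Poisson bound controls.\<close>

lemma modulation_invariant_bound:
  fixes s :: "'n \<Rightarrow> real"
  assumes s: "\<And>j. s j > 0" and anti: "antilinear_on (M1 \<phi>) \<psi>"
    and bdd: "\<And>h. h \<in> M1 \<phi> \<Longrightarrow> norm (\<psi> h) \<le> C * M1_norm \<phi> h"
    and inv: "\<And>l h. h \<in> M1 \<phi> \<Longrightarrow> \<psi> (rho (0, lat s l) h) = \<psi> h"
  shows "\<exists>K\<ge>0. \<forall>h\<in>M1 \<phi>. norm (\<psi> h) \<le> K * (\<Sum>\<^sup>L k. norm (h (dlat s k)))"
proof -
  \<comment> \<open>The given \<open>C\<close> may fail to be positive, and the estimate divides by
    this constant.\<close>
  define C' where "C' = \<bar>C\<bar> + 1"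
  have C': "C' > 0" by (simp add: C'_def)
  define v where "v = (\<Prod>j\<in>UNIV. s j)"
  have v: "v > 0" using s by (simp add: v_def prod_pos)
  define p where "p = (LINT x|lborel. norm (\<phi> x))"
  have ds: "\<And>j. dual s j > 0" using s by simp
  have "norm (\<psi> h) \<le> C' * p * (\<Sum>\<^sup>L k. norm (h (dlat s k)))" if h: "h \<in> M1 \<phi>" for h
  proof -
    have hc: "continuous_on UNIV h" and hi: "integrable lborel h" using h by (auto simp: M1_iff)
    have hL: "integrable counting (\<lambda>k. h (dlat s k))"
      using lattice_values_bound[of "dual s", OF ds] h by blast
    define L where "L = (\<Sum>\<^sup>L k. norm (h (dlat s k)))"
    have L: "L \<ge> 0" by (simp add: L_def)
    define F where "F x w = fourier (cut h x) w" for x w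
    have Fm: "(\<lambda>(x, w). F x w) \<in> borel_measurable (lborel \<Otimes>\<^sub>M lborel)"
      using M1_integrable_pair(1)[OF h] unfolding F_def by auto
    define a where "a x w l = F x (w + lat s l)" for x w l
    have am: "(\<lambda>z. a (fst z) (snd z) l) \<in> borel_measurable (lborel \<Otimes>\<^sub>M cell_measure s)" for l
    proof -
      have "(\<lambda>z. (fst z, snd z + lat s l)) \<in> lborel \<Otimes>\<^sub>M cell_measure s \<rightarrow>\<^sub>M lborel \<Otimes>\<^sub>M lborel"
        by measurable
      from measurable_compose[OF this Fm] show ?thesis by (simp add: a_def)
    qed
    define c where "c N = inverse (of_nat (Suc N) ^ CARD('n) :: complex)" for N
    define g where "g N = (\<lambda>t. \<Sum>l\<in>int_box (Suc N). c N * rho (0, lat s l) h t)" for N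
    have rM: "(\<lambda>t. c N * rho (0, lat s l) h t) \<in> M1 \<phi>" for N l by (intro M1_cmult M1_rho h)
    have gM: "g N \<in> M1 \<phi>" for N
      unfolding g_def by (rule M1_sum[OF finite_int_box rM])
    have psi: "\<psi> (g N) = \<psi> h" for N
    proof -
      have "\<psi> (g N) = (\<Sum>l\<in>(int_box (Suc N) :: (int^'n) set). cnj (c N) * \<psi> h)"
        unfolding g_def antilinear_sum[OF anti finite_int_box rM]
        by (simp add: antilinear_cmult[OF anti M1_rho[OF h]] inv[OF h])
      also have "\<dots> = of_nat (Suc N ^ CARD('n)) * (cnj (c N) * \<psi> h)"
        by (simp only: sum_constant card_int_box)
      also have "\<dots> = \<psi> h" by (simp add: c_def del: of_nat_Suc)
      finally show ?thesis .
    qed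
    \<comment> \<open>Modulation by a lattice vector translates each slice transform by that vector.
      On a coset w + \<open>lat s m\<close>, averaging modulations of \<open>h\<close> is therefore
      box averaging of the sequence of samples.\<close>
    have Fg: "fourier (cut (g N) x) (w + lat s m) = box_average (a x w) N m" for N x w m
    proof -
      have "fourier (cut (g N) x) (w + lat s m) = c N * (\<Sum>l\<in>int_box (Suc N). F x (w + lat s m
        - lat s l))"
        unfolding g_def F_def fourier_cut_modulate[symmetric]
        by (rule fourier_cut_sum[OF finite_int_box rho_integrable[OF hi]])
      then show ?thesis by (simp add: box_average_def a_def c_def lat_diff divide_inverse
        mult.commute add_diff_eq)
    qed
    \<comment> \<open>Splitting frequency space into cosets turns the M1-norm into an integral over
      x and one cell of l1-norms: \<open>u N\<close> is the integrand for the average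
      \<open>g N\<close>, and \<open>W\<close> the one for \<open>h\<close>.\<close>
    define u where "u N z = (\<Sum>\<^sup>+ m. ennreal (norm (box_average (a (fst z) (snd z)) N m)))" for N z
    define W where "W z = (\<Sum>\<^sup>+ m. ennreal (norm (a (fst z) (snd z) m)))" for z
    have um: "u N \<in> borel_measurable (lborel \<Otimes>\<^sub>M cell_measure s)" for N
    proof -
      have "(\<lambda>z. box_average (a (fst z) (snd z)) N m) \<in> borel_measurable (lborel \<Otimes>\<^sub>M cell_measure s)"
        for m
        unfolding box_average_def by (intro borel_measurable_divide borel_measurable_sum am
          borel_measurable_const)
      then show ?thesis unfolding u_def
        by (intro borel_measurable_nn_integral_count_space measurable_ennreal_norm)
    qed
    have wm: "W \<in> borel_measurable (lborel \<Otimes>\<^sub>M cell_measure s)"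
      unfolding W_def by (intro borel_measurable_nn_integral_count_space measurable_ennreal_norm am)
    have tile: "(\<integral>\<^sup>+x. \<integral>\<^sup>+w. \<integral>\<^sup>+m. ennreal (norm (fourier (cut f x) (w + lat s m))) \<partial>counting
      \<partial>cell_measure s \<partial>lborel) = ennreal (M1_norm \<phi> f)"
      if f: "f \<in> M1 \<phi>" for f
    proof -
      have "(\<integral>\<^sup>+w. \<integral>\<^sup>+m. ennreal (norm (fourier (cut f x) (w + lat s m))) \<partial>counting \<partial>cell_measure s)
         = (\<integral>\<^sup>+w. ennreal (norm (fourier (cut f x) w)) \<partial>lborel)" for x
      proof (rule nn_integral_tile[symmetric, OF s])
        have "(\<lambda>(x, w). fourier (cut f x) w) \<in> borel_measurable (lborel \<Otimes>\<^sub>M lborel)"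
          using M1_integrable_pair(1)[OF f] by auto
        from measurable_Pair2[OF this] have "fourier (cut f x) \<in> borel_measurable borel" by simp
        then show "(\<lambda>w. ennreal (norm (fourier (cut f x) w))) \<in> borel_measurable borel"
          by (rule measurable_ennreal_norm)
      qed
      then show ?thesis using nn_integral_M1[OF f] by simp
    qed
    have uint: "integral\<^sup>N (lborel \<Otimes>\<^sub>M cell_measure s) (u N) = ennreal (M1_norm \<phi> (g N))" for N
      unfolding cell.nn_integral_fst[OF um, symmetric] tile[OF gM, symmetric] Fg by (simp add: u_def)
    have wint: "integral\<^sup>N (lborel \<Otimes>\<^sub>M cell_measure s) W = ennreal (M1_norm \<phi> h)"
      unfolding cell.nn_integral_fst[OF wm, symmetric] tile[OF h, symmetric]
        by (simp add: W_def a_def F_def)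
    have "ennreal (norm (\<psi> h) / C') \<le> integral\<^sup>N (lborel \<Otimes>\<^sub>M cell_measure s) (u N)" for N
    proof -
      have "norm (\<psi> h) \<le> C * M1_norm \<phi> (g N)" using bdd[OF gM[of N]] by (simp add: psi)
      also have "\<dots> \<le> C' * M1_norm \<phi> (g N)" unfolding C'_def
        by (intro mult_right_mono M1_norm_nonneg) simp
      finally show ?thesis unfolding uint using C' by (intro ennreal_leI) (simp add: divide_le_eq
        mult.commute)
    qed
    then have "limsup (\<lambda>N. ennreal (norm (\<psi> h) / C'))
      \<le> limsup (\<lambda>N. integral\<^sup>N (lborel \<Otimes>\<^sub>M cell_measure s) (u N))"
      by (intro Limsup_mono always_eventually allI)
    then have "ennreal (norm (\<psi> h) / C') \<le> limsup (\<lambda>N. integral\<^sup>N (lborel \<Otimes>\<^sub>M cell_measure s) (u N))"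
      by (simp add: Limsup_const)
    \<comment> \<open>Reverse Fatou. It needs the majorant \<open>W\<close>, whose integral is the
      finite M1-norm of \<open>h\<close>.\<close>
    also have "\<dots> \<le> (\<integral>\<^sup>+z. limsup (\<lambda>N. u N z) \<partial>(lborel \<Otimes>\<^sub>M cell_measure s))"
    proof (rule nn_integral_limsup[where w = W])
      show "AE z in lborel \<Otimes>\<^sub>M cell_measure s. u N z \<le> W z" for N
        unfolding u_def W_def by (intro AE_I2 box_average_le)
      show "integral\<^sup>N (lborel \<Otimes>\<^sub>M cell_measure s) W < \<infinity>" unfolding wint by simp
    qed (use um wm in auto)
    also have "(\<integral>\<^sup>+z. limsup (\<lambda>N. u N z) \<partial>(lborel \<Otimes>\<^sub>M cell_measure s))
      = (\<integral>\<^sup>+x. \<integral>\<^sup>+w. limsup (\<lambda>N. u N (x, w)) \<partial>cell_measure s \<partial>lborel)"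
      using um by (intro cell.nn_integral_fst[symmetric] borel_measurable_limsup)
    also have "\<dots> \<le> (\<integral>\<^sup>+x. (\<Sum>\<^sup>+ k. ennreal (norm (cut h x (dlat s k)))) \<partial>lborel)"
    proof (rule nn_integral_mono_AE)
      show "AE x in lborel. (\<integral>\<^sup>+w. limsup (\<lambda>N. u N (x, w)) \<partial>cell_measure s)
        \<le> (\<Sum>\<^sup>+ k. ennreal (norm (cut h x (dlat s k))))"
        using M1_integrable_pair(3)[OF h]
      proof eventually_elim
        fix x assume Fi: "integrable lborel (fourier (cut h x))"
        obtain B where B: "\<And>x. norm (\<phi> x) \<le> B" using schwartz_bounded[OF phi(1)] by blast
        have ci: "integrable counting (\<lambda>k. cut h x (dlat s k))"
          unfolding cut_def by (rule integrable_mult_bounded[OF hL, where B = B]) (use B in auto)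
        define Q where "Q = (\<Sum>\<^sup>L k. norm (cut h x (dlat s k)))"
        have Q: "Q \<ge> 0" by (simp add: Q_def)
        \<comment> \<open>The limsup is at most the modulus of the periodized slice transform, which
          Poisson summation bounds by the lattice values of the slice divided by the cell volume
          \<open>v\<close>. The integral over the cell cancels \<open>v\<close>.\<close>
        have "AE w in cell_measure s. limsup (\<lambda>N. u N (x, w)) \<le> ennreal (Q / v)"
          using poisson_bound[of s, OF s integrable_cut[OF hi] continuous_cut[OF hc] Fi ci]
            integral_tile(1)[of s, OF s Fi]
        proof eventually_elim
          fix w
          assume pb: "(\<Prod>j\<in>UNIV. s j) * norm (\<Sum>\<^sup>L l. fourier (cut h x) (w + lat s l))
            \<le> (\<Sum>\<^sup>L k. norm (cut h x (dlat s k)))"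
            and ai: "integrable counting (\<lambda>l. fourier (cut h x) (w + lat s l))"
          have ai': "integrable counting (a x w)" using ai unfolding a_def[abs_def] F_def .
          have "limsup (\<lambda>N. u N (x, w)) \<le> ennreal (norm (integral\<^sup>L counting (a x w)))"
            using box_average_limsup[OF ai'] by (simp add: u_def)
          also have "\<dots> \<le> ennreal (Q / v)"
            using pb v by (intro ennreal_leI) (simp add: Q_def v_def[symmetric] a_def[abs_def] F_def
              field_simps)
          finally show "limsup (\<lambda>N. u N (x, w)) \<le> ennreal (Q / v)" .
        qed
        then have "(\<integral>\<^sup>+w. limsup (\<lambda>N. u N (x, w)) \<partial>cell_measure s)
          \<le> (\<integral>\<^sup>+w. ennreal (Q / v) \<partial>cell_measure s)"
          by (rule nn_integral_mono_AE)
        also have "\<dots> = ennreal (Q / v) * emeasure (cell_measure s) UNIV" by simp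
        also have "emeasure (cell_measure s) UNIV = ennreal v"
        proof -
          \<comment> \<open>The cell volume is read off from the integral of the trivial
            character.\<close>
          have "complex_of_real (measure (cell_measure s) UNIV) = complex_of_real v"
            using cell_character[of s 0, OF s] by (simp add: v_def scaleR_conv_of_real)
          then have "measure (cell_measure s) UNIV = v" by (simp only: of_real_eq_iff)
          then show ?thesis using cell.emeasure_eq_measure[of s UNIV] by simp
        qed
        also have "ennreal (Q / v) * ennreal v = ennreal Q" using Q v by (simp flip: ennreal_mult)
        also have "\<dots> = (\<Sum>\<^sup>+ k. ennreal (norm (cut h x (dlat s k))))"
          unfolding Q_def by (rule nn_integral_eq_integral[symmetric, OF integrable_norm[OF ci]]) simp
        finally show "(\<integral>\<^sup>+w. limsup (\<lambda>N. u N (x, w)) \<partial>cell_measure s)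
          \<le> (\<Sum>\<^sup>+ k. ennreal (norm (cut h x (dlat s k))))" .
      qed
    qed
    also have "\<dots> = (\<Sum>\<^sup>+ k. \<integral>\<^sup>+x. ennreal (norm (cut h x (dlat s k))) \<partial>lborel)"
    proof (rule nn_integral_count_space_swap[symmetric, OF sigma_finite_lborel])
      fix k
      have "continuous_on UNIV (\<lambda>x. cut h x (dlat s k))"
        unfolding cut_def by (intro continuous_intros continuous_on_compose2[OF continuous_phi]) auto
      then have "(\<lambda>x. cut h x (dlat s k)) \<in> borel_measurable lborel"
        by (simp add: borel_measurable_continuous_onI)
      then show "(\<lambda>x. ennreal (norm (cut h x (dlat s k)))) \<in> borel_measurable lborel"
        by (rule measurable_ennreal_norm)
    qed
    \<comment> \<open>For a fixed lattice point, integrating |\<phi>(m - x)| over x gives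
      \<open>p\<close> by reflection and translation invariance.\<close>
    also have "\<dots> = (\<Sum>\<^sup>+ k. ennreal (norm (h (dlat s k))) * ennreal p)"
    proof (rule nn_integral_cong)
      fix k
      let ?t = "dlat s k"
      have pm: "(\<lambda>x. ennreal (norm (\<phi> x))) \<in> borel_measurable borel"
        by (rule measurable_ennreal_norm[OF measurable_phi])
      have "(\<integral>\<^sup>+x. ennreal (norm (\<phi> (?t - x))) \<partial>lborel) = (\<integral>\<^sup>+x. ennreal (norm (\<phi> x)) \<partial>lborel)"
        by (rule nn_integral_lborel_reflect[symmetric, OF pm])
      also have "\<dots> = ennreal p" unfolding p_def
        by (rule nn_integral_eq_integral[OF integrable_norm[OF integrable_phi]]) simp
      finally have "(\<integral>\<^sup>+x. ennreal (norm (\<phi> (?t - x))) \<partial>lborel) = ennreal p" .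
      moreover have "(\<lambda>x. ennreal (norm (\<phi> (?t - x)))) \<in> borel_measurable lborel"
        using measurable_compose[OF _ pm, of "\<lambda>x. ?t - x"] by simp
      moreover have "ennreal (norm (cut h x ?t)) = ennreal (norm (h ?t)) * ennreal (norm (\<phi> (?t
        - x)))" for x
        unfolding cut_def norm_mult complex_mod_cnj by (rule ennreal_mult) simp_all
      ultimately show "(\<integral>\<^sup>+x. ennreal (norm (cut h x ?t)) \<partial>lborel) = ennreal (norm (h ?t)) * ennreal p"
        using nn_integral_cmult[of "\<lambda>x. ennreal (norm (\<phi> (?t - x)))" lborel "ennreal (norm (h ?t))"]
          by presburger
    qed
    also have "\<dots> = (\<Sum>\<^sup>+ k. ennreal (norm (h (dlat s k)))) * ennreal p"
      by (rule nn_integral_multc) simp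
    also have "(\<Sum>\<^sup>+ k. ennreal (norm (h (dlat s k)))) = ennreal L"
      unfolding L_def by (rule nn_integral_eq_integral[OF integrable_norm[OF hL]]) simp
    also have "ennreal L * ennreal p = ennreal (L * p)" using L by (simp add: p_def ennreal_mult)
    finally have "norm (\<psi> h) / C' \<le> L * p" using L by (subst (asm) ennreal_le_iff) (auto simp: p_def)
    then show ?thesis using C' unfolding L_def[symmetric] by (simp add: divide_le_eq mult_ac)
  qed
  then show ?thesis by (intro exI[of _ "C' * p"]) (use C' in \<open>auto simp: p_def\<close>)
qed

end

section \<open>Compactly supported functions in \<open>M\<^sup>1\<close>\<close>

text \<open>Average the integral of \<open>K'\<close> over the translates by r v with r in [0, 1].
  By Fubini and the fundamental theorem along each segment this is the integral of K(t + v) - K(t),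
  which vanishes by translation invariance.\<close>

lemma integral_directional_derivative:
  fixes K K' :: "real^'n \<Rightarrow> complex"
  assumes d: "\<And>t. ((\<lambda>r. K (t + r *\<^sub>R v)) has_vector_derivative K' t) (at 0)"
    and K: "integrable lborel K" and K': "integrable lborel K'" "continuous_on UNIV K'"
  shows "integral\<^sup>L lborel K' = 0"
proof -
  have Km: "K \<in> borel_measurable borel" "K' \<in> borel_measurable borel" using K K' by auto
  have d': "((\<lambda>r. K (t + r *\<^sub>R v)) has_vector_derivative K' (t + r *\<^sub>R v)) (at r within S)" for t r S
  proof -
    have "((\<lambda>q. K (t + r *\<^sub>R v + q *\<^sub>R v)) has_vector_derivative K' (t + r *\<^sub>R v)) (at (r - r))"
      using d[of "t + r *\<^sub>R v"] by simp
    then have "(((\<lambda>q. K (t + r *\<^sub>R v + q *\<^sub>R v)) \<circ> (\<lambda>p. p - r)) has_vector_derivative 1 *\<^sub>R K' (t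
      + r *\<^sub>R v)) (at r)"
      by (intro vector_diff_chain_at) (auto intro!: derivative_eq_intros)
    moreover have "(\<lambda>q. K (t + r *\<^sub>R v + q *\<^sub>R v)) \<circ> (\<lambda>p. p - r) = (\<lambda>r. K (t + r *\<^sub>R v))"
      by (auto simp: fun_eq_iff scaleR_left_diff_distrib)
    ultimately show ?thesis by (simp add: has_vector_derivative_at_within)
  qed
  define H where "H = (\<lambda>(r, t). indicator {0..1::real} r *\<^sub>R K' (t + r *\<^sub>R v))"
  have Hc: "continuous_on UNIV (\<lambda>z. K' (snd z + fst z *\<^sub>R v))"
    by (rule continuous_on_compose2[OF K'(2)]) (auto intro!: continuous_intros)
  have Hm: "H \<in> borel_measurable (lborel \<Otimes>\<^sub>M lborel)"
  proof -
    have "(\<lambda>z. K' (snd z + fst z *\<^sub>R v)) \<in> borel_measurable (lborel \<Otimes>\<^sub>M lborel)"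
      using borel_measurable_continuous_onI[OF Hc] by (simp add: lborel_prod)
    moreover have "(\<lambda>z. indicator {0..1::real} (fst z) :: real) \<in> borel_measurable (lborel \<Otimes>\<^sub>M
      (lborel :: (real^'n) measure))"
      by (rule measurable_compose[OF measurable_fst borel_measurable_indicator]) simp
    ultimately show ?thesis unfolding H_def case_prod_unfold by (intro borel_measurable_scaleR)
  qed
  have shift: "(LINT t|lborel. K' (t + r *\<^sub>R v)) = integral\<^sup>L lborel K'" "(LINT t|lborel. norm (K' (t
    + r *\<^sub>R v))) = (LINT t|lborel. norm (K' t))"
    "integrable lborel (\<lambda>t. K' (t + r *\<^sub>R v))" for r
    using integral_lborel_shift[of K' "r *\<^sub>R v"] integral_lborel_shift[of "\<lambda>t. norm (K' t)" "r *\<^sub>R v"]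
      integrable_lborel_shift[OF K'(1), of "r *\<^sub>R v"] Km(2)
    by (simp_all add: add.commute)
  have Hi: "integrable (lborel \<Otimes>\<^sub>M lborel) H"
  proof (rule lborel_pair.Fubini_integrable[OF Hm])
    show "integrable lborel (\<lambda>r. LINT t|lborel. norm (H (r, t)))"
      by (simp add: H_def shift)
    show "AE r in lborel. integrable lborel (\<lambda>t. H (r, t))"
      by (intro AE_I2) (simp add: H_def shift)
  qed
  have "integral\<^sup>L lborel K' = (LINT r|lborel. indicator {0..1::real} r *\<^sub>R integral\<^sup>L lborel K')"
    by simp
  also have "\<dots> = (LINT r|lborel. LINT t|lborel. H (r, t))" by (simp add: H_def shift)
  also have "\<dots> = (LINT t|lborel. LINT r|lborel. H (r, t))"
    using lborel_pair.Fubini_integral[of "\<lambda>r t. H (r, t)"] Hi by simp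
  also have "\<dots> = (LINT t|lborel. K (t + v) - K t)"
  proof (rule Bochner_Integration.integral_cong[OF refl])
    fix t
    have "(LINT r|lborel. indicator {0..1} r *\<^sub>R K' (t + r *\<^sub>R v)) = K (t + 1 *\<^sub>R v) - K (t + 0 *\<^sub>R v)"
      by (rule integral_FTC_Icc[OF _ d'])
         (auto intro!: continuous_intros continuous_on_compose2[OF K'(2)])
    then show "(LINT r|lborel. H (r, t)) = K (t + v) - K t" by (simp add: H_def)
  qed
  also have "\<dots> = (LINT t|lborel. K (t + v)) - integral\<^sup>L lborel K"
    using integrable_lborel_shift[OF K, of v] K by (subst Bochner_Integration.integral_diff) (auto
      simp: add.commute)
  also have "\<dots> = 0" using integral_lborel_shift[OF Km(1), of v] by (simp add: add.commute)
  finally show ?thesis .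
qed

section \<open>Bump functions of finite smoothness\<close>

lemma DERIV_max_0_power:
  fixes x :: real
  assumes "m \<ge> 2"
  shows "((\<lambda>x. max 0 x ^ m) has_real_derivative real m * max 0 x ^ (m - 1)) (at x)"
proof -
  obtain k where m: "m = Suc (Suc k)" using assms by (metis Suc_le_D numeral_2_eq_2 Suc_le_mono)
  consider "x > 0" | "x < 0" | "x = 0" by linarith
  then show ?thesis
  proof cases
    case 1
    have "((\<lambda>x. x ^ m) has_real_derivative real m * max 0 x ^ (m - 1)) (at x)"
      using 1 by (auto intro!: derivative_eq_intros)
    then show ?thesis
      by (rule has_field_derivative_transform_within_open[where S = "{0<..}"]) (use 1 in auto)
  next
    case 2
    have "((\<lambda>x. 0) has_real_derivative real m * max 0 x ^ (m - 1)) (at x)"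
      using 2 m by simp
    then show ?thesis
      by (rule has_field_derivative_transform_within_open[where S = "{..<0}"]) (use 2 m in auto)
  next
    case 3
    have "((\<lambda>h. max 0 h ^ Suc k) \<longlongrightarrow> max 0 0 ^ Suc k) (at (0::real))"
      by (intro tendsto_intros)
    then have "((\<lambda>h. max 0 h ^ Suc k) \<longlongrightarrow> 0) (at (0::real))" by simp
    then have "((\<lambda>h. (max 0 (0 + h) ^ m - max 0 0 ^ m) / h) \<longlongrightarrow> 0) (at (0::real))"
      by (rule Lim_transform_eventually) (auto simp: m eventually_at_filter max_def)
    then show ?thesis using 3 m by (simp add: DERIV_def)
  qed
qed

lemma real_polynomial_directional_derivative:
  assumes "real_polynomial_function q"
  shows "\<exists>q'. real_polynomial_function q' \<and> (\<forall>t. ((\<lambda>r. q (t + r *\<^sub>R v))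
    has_real_derivative q' t) (at 0))"
  using assms
proof (induction q rule: real_polynomial_function.induct)
  case (linear f)
  then interpret bounded_linear f .
  have "((\<lambda>r. f (t + r *\<^sub>R v)) has_real_derivative f v) (at 0)" for t
    unfolding add scaleR by (auto intro!: derivative_eq_intros)
  then show ?case by (intro exI[of _ "\<lambda>_. f v"]) (auto intro: real_polynomial_function.intros(2))
next
  case (const c)
  then show ?case by (intro exI[of _ "\<lambda>_. 0"]) (auto intro: real_polynomial_function.intros(2))
next
  case (add f g)
  then obtain f' g' where "real_polynomial_function f'" "real_polynomial_function g'"
    "\<And>t. ((\<lambda>r. f (t + r *\<^sub>R v)) has_real_derivative f' t) (at 0)" "\<And>t. ((\<lambda>r. g (t + r *\<^sub>R v))
      has_real_derivative g' t) (at 0)" by blast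
  then show ?case by (intro exI[of _ "\<lambda>t. f' t + g' t"]) (auto intro!:
    real_polynomial_function.intros(3) DERIV_add)
next
  case (mult f g)
  then obtain f' g' where *: "real_polynomial_function f'" "real_polynomial_function g'"
    "\<And>t. ((\<lambda>r. f (t + r *\<^sub>R v)) has_real_derivative f' t) (at 0)" "\<And>t. ((\<lambda>r. g (t + r *\<^sub>R v))
      has_real_derivative g' t) (at 0)" by blast
  have "((\<lambda>r. f (t + r *\<^sub>R v) * g (t + r *\<^sub>R v)) has_real_derivative f' t * g t + g' t * f t) (at 0)"
    for t
    using DERIV_mult[OF *(3)[of t] *(4)[of t]] by simp
  then show ?case using * mult.hyps
    by (intro exI[of _ "\<lambda>t. f' t * g t + g' t * f t"]) (auto intro!:
      real_polynomial_function.intros(3,4))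
qed

text \<open>Support in the closed unit ball and k orders of coordinate derivatives. The recursion
  mirrors integration by parts: each differentiation hands over a derivative of one level less with
  the same support.\<close>

primrec smooth_bump :: "nat \<Rightarrow> (real^'n \<Rightarrow> real) \<Rightarrow> bool" where
  "smooth_bump 0 f \<longleftrightarrow> continuous_on UNIV f \<and> (\<forall>t. norm t \<ge> 1 \<longrightarrow> f t = 0)"
| "smooth_bump (Suc k) f \<longleftrightarrow> (continuous_on UNIV f \<and> (\<forall>t. norm t \<ge> 1 \<longrightarrow> f t = 0)) \<and>
     (\<forall>j. \<exists>f'. (\<forall>t. ((\<lambda>r. f (t + r *\<^sub>R axis j 1)) has_real_derivative f' t) (at 0)) \<and> smooth_bump k f')"

lemma smooth_bump_0: "smooth_bump k f \<Longrightarrow> smooth_bump 0 f"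
  by (cases k) auto

lemma smooth_bump_mono: "smooth_bump (Suc k) f \<Longrightarrow> smooth_bump k f"
proof (induction k arbitrary: f)
  case (Suc k)
  then show ?case unfolding smooth_bump.simps(2)[of "Suc k"] smooth_bump.simps(2)[of k] by meson
qed auto

text \<open>The polynomial factor makes the family closed under differentiation, at the cost of one
  power of the truncated quadratic per derivative. \<open>R\<close> \<ge> 1 keeps the support in the
  unit ball.\<close>

lemma smooth_bump_polynomial:
  fixes q :: "real^'n \<Rightarrow> real"
  assumes "real_polynomial_function q" "m \<ge> Suc k" and R: "R \<ge> 1"
  shows "smooth_bump k (\<lambda>t. q t * max 0 (1 - R * (t \<bullet> t)) ^ m)"
  using assms(1,2)
proof (induction k arbitrary: q m)
  have base: "continuous_on UNIV (\<lambda>t. q t * max 0 (1 - R * (t \<bullet> t)) ^ m) \<and> (\<forall>t. norm t \<ge> 1 \<longrightarrow> q t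
    * max 0 (1 - R * (t \<bullet> t)) ^ m = 0)"
    if q: "real_polynomial_function q" and m: "m \<ge> Suc 0" for q :: "real^'n \<Rightarrow> real" and m
  proof (intro conjI allI impI)
    show "continuous_on UNIV (\<lambda>t. q t * max 0 (1 - R * (t \<bullet> t)) ^ m)"
      using q by (intro continuous_intros continuous_on_polymonial_function) (simp add:
        real_polynomial_function_eq)
    fix t :: "real^'n" assume "norm t \<ge> 1"
    then have "t \<bullet> t \<ge> 1" by (simp add: dot_square_norm)
    then have "R * (t \<bullet> t) \<ge> 1" using R by (metis mult_mono' mult_1 zero_le_one)
    then have "max 0 (1 - R * (t \<bullet> t)) = 0" by simp
    then show "q t * max 0 (1 - R * (t \<bullet> t)) ^ m = 0" using m by simp
  qed
  {
    case 0
    then show ?case using base by simp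
  next
    case (Suc k)
    have "\<exists>f'. (\<forall>t. ((\<lambda>r. q (t + r *\<^sub>R axis j 1) * max 0 (1 - R * ((t + r *\<^sub>R axis j 1) \<bullet> (t
      + r *\<^sub>R axis j 1))) ^ m) has_real_derivative f' t) (at 0)) \<and> smooth_bump k f'" for j
    proof -
      obtain q' where q': "real_polynomial_function q'" "\<And>t. ((\<lambda>r. q (t + r *\<^sub>R axis j 1))
        has_real_derivative q' t) (at 0)"
        using real_polynomial_directional_derivative[OF Suc.prems(1)] by blast
      define A where "A t = 1 - R * (t \<bullet> t)" for t :: "real^'n"
      have line: "A (t + r *\<^sub>R axis j 1) = A t - 2 * R * t $ j * r - R * r\<^sup>2" for t r
        by (simp add: A_def inner_add_left inner_add_right inner_axis inner_axis' inner_axis_axis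
          algebra_simps power2_eq_square)
      have dA: "((\<lambda>r. A (t + r *\<^sub>R axis j 1)) has_real_derivative - 2 * R * t $ j) (at 0)" for t
        unfolding line by (auto intro!: derivative_eq_intros)
      \<comment> \<open>The product rule with max 0 A ^ (m - 1) factored out, using that max 0 A ^ m
        equals A times this power.\<close>
      define p where "p t = q' t * A t + q t * (real m * (- 2 * R * t $ j))" for t
      have "((\<lambda>r. q (t + r *\<^sub>R axis j 1) * max 0 (A (t + r *\<^sub>R axis j 1)) ^ m)
        has_real_derivative p t * max 0 (A t) ^ (m - 1)) (at 0)" for t
      proof -
        have "((\<lambda>x. max 0 x ^ m) has_real_derivative real m * max 0 (A (t + 0 *\<^sub>R axis j 1)) ^ (m
          - 1)) (at (A (t + 0 *\<^sub>R axis j 1)))"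
          using Suc.prems(2) by (intro DERIV_max_0_power) simp
        from DERIV_chain2[OF this dA[of t]]
        have "((\<lambda>r. max 0 (A (t + r *\<^sub>R axis j 1)) ^ m) has_real_derivative real m * max 0 (A t) ^ (m
          - 1) * (- 2 * R * t $ j)) (at 0)" by simp
        from DERIV_mult[OF q'(2)[of t] this]
        have "((\<lambda>r. q (t + r *\<^sub>R axis j 1) * max 0 (A (t + r *\<^sub>R axis j 1)) ^ m)
          has_real_derivative q' t * max 0 (A t) ^ m + real m * max 0 (A t) ^ (m - 1) * (- 2 * R
            * t $ j) * q t) (at 0)" by simp
        moreover have "max 0 (A t) ^ m = A t * max 0 (A t) ^ (m - 1)"
        proof -
          obtain i where i: "m = Suc (Suc i)" using Suc.prems(2) by (metis Suc_le_D Suc_le_mono)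
          show ?thesis unfolding i by (auto simp: max_def)
        qed
        ultimately show ?thesis by (simp add: p_def algebra_simps)
      qed
      moreover have "real_polynomial_function p"
      proof -
        have nth: "real_polynomial_function (\<lambda>t::real^'n. t $ i)" for i
          by (rule real_polynomial_function.intros(1)) (rule bounded_linear_vec_nth)
        have "real_polynomial_function A" unfolding A_def inner_vec_def
          by (auto intro!: real_polynomial_function.intros(2-4) nth real_polynomial_function_sum
            real_polynomial_function_diff)
        then show ?thesis unfolding p_def using q'(1) Suc.prems(1) nth
          by (intro real_polynomial_function.intros(2-4)) auto
      qed
      then have "smooth_bump k (\<lambda>t. p t * max 0 (1 - R * (t \<bullet> t)) ^ (m - 1))"
        using Suc.prems(2) by (intro Suc.IH) auto
      ultimately show ?thesis unfolding A_def
        by (intro exI[of _ "\<lambda>t. p t * max 0 (1 - R * (t \<bullet> t)) ^ (m - 1)"]) blast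
    qed
    then have a: "\<And>j. \<exists>f'. (\<forall>t. ((\<lambda>r. q (t + r *\<^sub>R axis j 1) * max 0 (1 - R * ((t + r *\<^sub>R axis j 1) \<bullet>
      (t + r *\<^sub>R axis j 1))) ^ m) has_real_derivative f' t) (at 0)) \<and> smooth_bump k f'" .
    have "m \<ge> Suc 0" using Suc.prems(2) by simp
    then show ?case unfolding smooth_bump.simps(2) by (intro conjI[OF base[OF Suc.prems(1)] allI[OF a]])
  }
qed

lemma smooth_bump_integrable:
  assumes "smooth_bump k f" shows "integrable lborel f"
proof -
  have f: "continuous_on UNIV f" "\<And>t. norm t \<ge> 1 \<Longrightarrow> f t = 0" using smooth_bump_0[OF assms] by auto
  have "integrable lborel (\<lambda>x. indicator (cball 0 1) x *\<^sub>R f x)"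
    by (rule borel_integrable_compact) (auto intro: continuous_on_subset[OF f(1)])
  moreover have "(\<lambda>x. indicator (cball 0 1) x *\<^sub>R f x) = f"
  proof
    fix x show "indicator (cball 0 1) x *\<^sub>R f x = f x"
      using f(2)[of x] by (cases "norm x \<le> 1") (auto simp: indicator_def)
  qed
  ultimately show ?thesis by simp
qed

section \<open>Decay of the short-time Fourier transform of a bump\<close>

context window begin

text \<open>With the empty list this is \<open>cut\<close> of the bump; longer lists record the
  derivatives that integration by parts moves onto the window.\<close>

definition cut_partial :: "(real^'n \<Rightarrow> real) \<Rightarrow> (real^'n) list \<Rightarrow> real^'n \<Rightarrow> real^'n \<Rightarrow> complex" where
  "cut_partial f bs x t = of_real (f t) * cnj (iter_partial bs \<phi> (t - x))"

lemma cut_partial_props: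
  assumes f: "smooth_bump k f" and bs: "bs \<in> lists Basis"
  shows "continuous_on UNIV (cut_partial f bs x)" "integrable lborel (cut_partial f bs x)"
proof -
  have fc: "continuous_on UNIV f" using smooth_bump_0[OF f] by simp
  have gc: "continuous_on UNIV (\<lambda>t. cnj (iter_partial bs \<phi> (t - x)))"
    by (intro continuous_intros continuous_on_compose2[OF schwartz_iter_partial(1)[OF phi(1) bs]]) auto
  show "continuous_on UNIV (cut_partial f bs x)" unfolding cut_partial_def[abs_def]
    using fc by (intro continuous_on_mult gc continuous_on_of_real)
  obtain B where B: "\<And>x. norm (iter_partial bs \<phi> x) \<le> B" using schwartz_iter_partial(2)[OF phi(1)
    bs, of 0] by auto
  show "integrable lborel (cut_partial f bs x)" unfolding cut_partial_def[abs_def]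
  proof (rule integrable_mult_bounded[where B = B])
    show "integrable lborel (\<lambda>t. complex_of_real (f t))" using smooth_bump_integrable[OF f] by simp
    show "(\<lambda>t. cnj (iter_partial bs \<phi> (t - x))) \<in> borel_measurable lborel"
      using borel_measurable_continuous_onI[OF gc] by simp
  qed (use B in simp)
qed

lemma iter_partial_line_derivative:
  assumes bs: "bs \<in> lists Basis"
  shows "((\<lambda>r. iter_partial bs \<phi> (y + r *\<^sub>R b)) has_vector_derivative iter_partial (b # bs) \<phi> y) (at 0)"
proof -
  have "(iter_partial bs \<phi> has_derivative frechet_derivative (iter_partial bs \<phi>) (at y)) (at y)"
    using schwartz_iter_partial(3)[OF phi(1) bs, of y] frechet_derivative_works by blast
  then have 1: "(iter_partial bs \<phi> has_derivative frechet_derivative (iter_partial bs \<phi>) (at y)) (at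
    (y + 0 *\<^sub>R b))" by simp
  have "((\<lambda>r. y + r *\<^sub>R b) has_derivative (\<lambda>r. r *\<^sub>R b)) (at 0)" by (auto intro!: derivative_eq_intros)
  from diff_chain_at[OF this 1]
  have "((\<lambda>r. iter_partial bs \<phi> (y + r *\<^sub>R b)) has_derivative (\<lambda>r. frechet_derivative (iter_partial
    bs \<phi>) (at y) (r *\<^sub>R b))) (at 0)"
    by (simp add: o_def)
  moreover have "frechet_derivative (iter_partial bs \<phi>) (at y) (r *\<^sub>R b)
    = r *\<^sub>R frechet_derivative (iter_partial bs \<phi>) (at y) b" for r
    using linear_frechet_derivative[OF schwartz_iter_partial(3)[OF phi(1) bs]] by (rule linear_cmul)
  ultimately show ?thesis by (simp add: has_vector_derivative_def)
qed

text \<open>Integration by parts in coordinate j: the exponential contributes the factor 2 pi w_j,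
  and the derivative falls either on the bump or on the window. The factor 2 pi is at least 1 and is
  dropped.\<close>

lemma fourier_cut_partial_step:
  assumes f: "smooth_bump k f" and f': "smooth_bump k' f'" and bs: "bs \<in> lists Basis"
    and d: "\<And>t. ((\<lambda>r. f (t + r *\<^sub>R axis j 1)) has_real_derivative f' t) (at 0)"
  shows "\<bar>w $ j\<bar> * norm (fourier (cut_partial f bs x) w)
     \<le> norm (fourier (cut_partial f' bs x) w) + norm (fourier (cut_partial f (axis j 1 # bs) x) w)"
proof -
  let ?b = "axis j 1 :: real^'n"
  have bs': "?b # bs \<in> lists Basis" using bs by (auto simp: axis_in_Basis_iff)
  define e where "e t = cis (- 2 * pi * (w \<bullet> t))" for t
  define a where "a = - 2 * pi * w $ j"
  have ec: "continuous_on UNIV e" unfolding e_def cis_conv_exp by (intro continuous_intros)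
  have ei: "integrable lborel (\<lambda>t. g t * e t)" if "integrable lborel g" for g
    unfolding e_def by (intro integrable_mult_cis that) simp
  note P = cut_partial_props[OF f bs, of x] cut_partial_props[OF f' bs, of x] cut_partial_props[OF f
    bs', of x]
  \<comment> \<open>The derivative of slice times exponential in direction j, by the product rule;
    its integral is zero.\<close>
  define K' where "K' t = cut_partial f' bs x t * e t + cut_partial f (?b # bs) x t * e t + \<i>
    * of_real a * (cut_partial f bs x t * e t)" for t
  have "integral\<^sup>L lborel K' = 0"
  proof (rule integral_directional_derivative[where v = ?b])
    show "integrable lborel (\<lambda>t. cut_partial f bs x t * e t)" by (intro ei P)
    show "integrable lborel K'" unfolding K'_def by (intro Bochner_Integration.integrable_add
      integrable_mult_right ei P)
    show "continuous_on UNIV K'" unfolding K'_def by (intro continuous_intros ec P)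
    fix t
    have de: "((\<lambda>r. e (t + r *\<^sub>R ?b)) has_vector_derivative e t * (\<i> * of_real a)) (at 0)"
    proof -
      have "e (t + r *\<^sub>R ?b) = e t * exp (\<i> * of_real a * of_real r)" for r
        by (simp add: e_def a_def inner_add_right inner_axis cis_conv_exp flip: exp_add) (simp add:
          algebra_simps)
      moreover have "((\<lambda>z. e t * exp (\<i> * of_real a * z)) has_field_derivative e t * (\<i>
        * of_real a)) (at (of_real 0))"
        by (auto intro!: derivative_eq_intros)
      from has_vector_derivative_real_field[OF this, of UNIV]
      have "((\<lambda>r. e t * exp (\<i> * of_real a * of_real r)) has_vector_derivative e t * (\<i>
        * of_real a)) (at 0)"
        by (simp add: o_def)
      ultimately show ?thesis by simp
    qed
    have df: "((\<lambda>r. complex_of_real (f (t + r *\<^sub>R ?b))) has_vector_derivative of_real (f' t)) (at 0)"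
      using d[of t] by (intro has_vector_derivative_of_real) (simp add:
        has_real_derivative_iff_has_vector_derivative)
    have "((\<lambda>r. iter_partial bs \<phi> ((t - x) + r *\<^sub>R ?b)) has_vector_derivative iter_partial (?b # bs)
      \<phi> (t - x)) (at 0)"
      by (rule iter_partial_line_derivative[OF bs])
    then have dg: "((\<lambda>r. cnj (iter_partial bs \<phi> (t + r *\<^sub>R ?b - x)))
      has_vector_derivative cnj (iter_partial (?b # bs) \<phi> (t - x))) (at 0)"
      by (intro has_vector_derivative_cnj) (simp add: diff_add_eq)
    from has_vector_derivative_mult[OF has_vector_derivative_mult[OF df dg] de]
    show "((\<lambda>r. cut_partial f bs x (t + r *\<^sub>R ?b) * e (t + r *\<^sub>R ?b)) has_vector_derivative K' t) (at 0)"
      unfolding cut_partial_def K'_def by (rule has_vector_derivative_eq_rhs) (simp add: algebra_simps)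
  qed
  also have "integral\<^sup>L lborel K' = fourier (cut_partial f' bs x) w + fourier (cut_partial f (?b #
    bs) x) w + \<i> * of_real a * fourier (cut_partial f bs x) w"
    unfolding K'_def fourier_def e_def[symmetric]
    by (simp add: ei P del: iter_partial.simps)
  finally have "norm (\<i> * of_real a * fourier (cut_partial f bs x) w)
    = norm (fourier (cut_partial f' bs x) w + fourier (cut_partial f (?b # bs) x) w)"
    by (metis add_eq_0_iff norm_minus_cancel)
  also have "\<dots> \<le> norm (fourier (cut_partial f' bs x) w) + norm (fourier (cut_partial f (?b # bs) x)
    w)" by (rule norm_triangle_ineq)
  finally have "\<bar>a\<bar> * norm (fourier (cut_partial f bs x) w) \<le> norm (fourier (cut_partial f' bs x) w)
    + norm (fourier (cut_partial f (?b # bs) x) w)"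
    by (simp add: norm_mult)
  moreover have "\<bar>w $ j\<bar> \<le> \<bar>a\<bar>"
  proof -
    have "1 * \<bar>w $ j\<bar> \<le> (2 * pi) * \<bar>w $ j\<bar>" using pi_ge_two by (intro mult_right_mono) auto
    then show ?thesis by (simp add: a_def abs_mult)
  qed
  ultimately show ?thesis by (meson mult_right_mono norm_ge_zero order_trans)
qed

text \<open>On the support of the bump norm t < 1, hence 1 + norm x \<le> 2 (1 + norm (t - x)), and
  the Schwartz decay of the window derivative at t - x becomes decay in x.\<close>

lemma fourier_cut_partial_base:
  assumes f: "smooth_bump k f" and bs: "bs \<in> lists Basis"
  shows "\<exists>C. \<forall>x w. norm (fourier (cut_partial f bs x) w) \<le> C / (1 + norm x) ^ M"
proof -
  obtain B where B: "B \<ge> 0" "\<And>y. norm (iter_partial bs \<phi> y) \<le> B / (1 + norm y) ^ M"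
    using schwartz_iter_partial(2)[OF phi(1) bs, of M] by auto
  have "norm (fourier (cut_partial f bs x) w) \<le> (B * 2 ^ M * (LINT t|lborel. \<bar>f t\<bar>)) / (1
    + norm x) ^ M" for x w
  proof -
    have "norm (fourier (cut_partial f bs x) w) \<le> (LINT t|lborel. norm (cut_partial f bs x t))"
      by (rule norm_fourier_le)
    also have "\<dots> \<le> (LINT t|lborel. \<bar>f t\<bar> * (B * 2 ^ M / (1 + norm x) ^ M))"
    proof (rule integral_mono)
      show "integrable lborel (\<lambda>t. norm (cut_partial f bs x t))"
        by (intro integrable_norm cut_partial_props[OF f bs])
      show "integrable lborel (\<lambda>t. \<bar>f t\<bar> * (B * 2 ^ M / (1 + norm x) ^ M))"
        using smooth_bump_integrable[OF f] by (intro integrable_mult_left integrable_abs)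
      fix t
      show "norm (cut_partial f bs x t) \<le> \<bar>f t\<bar> * (B * 2 ^ M / (1 + norm x) ^ M)"
      proof (cases "norm t \<ge> 1")
        case True
        then show ?thesis using smooth_bump_0[OF f] by (simp add: cut_partial_def)
      next
        case False
        have "norm x \<le> norm t + norm (t - x)" using norm_triangle_ineq4[of t "t - x"] by simp
        then have "1 + norm x \<le> 2 * (1 + norm (t - x))"
          using False by (smt (verit) norm_ge_zero)
        then have "(1 + norm x) ^ M \<le> 2 ^ M * (1 + norm (t - x)) ^ M"
          unfolding power_mult_distrib[symmetric] by (intro power_mono) auto
        then have "B * (1 + norm x) ^ M \<le> B * (2 ^ M * (1 + norm (t - x)) ^ M)" using B(1)
          by (rule mult_left_mono)
        then have "B / (1 + norm (t - x)) ^ M \<le> B * 2 ^ M / (1 + norm x) ^ M"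
          by (simp add: divide_simps add_pos_nonneg mult_ac zero_less_power)
        then have "norm (iter_partial bs \<phi> (t - x)) \<le> B * 2 ^ M / (1 + norm x) ^ M"
          using B(2)[of "t - x"] by linarith
        then show ?thesis unfolding cut_partial_def norm_mult norm_of_real complex_mod_cnj
          by (intro mult_left_mono) auto
      qed
    qed
    also have "\<dots> = (LINT t|lborel. \<bar>f t\<bar>) * (B * 2 ^ M / (1 + norm x) ^ M)"
      by (rule integral_mult_left_zero)
    finally show ?thesis by (simp add: mult_ac)
  qed
  then show ?thesis by blast
qed

text \<open>Each coordinate in \<open>A\<close> is paid for by two integrations by parts, which
  yield its factor 1 + w_j^2; hence smoothness of order 2 card A. Bump and derivative list vary in
  the induction, since the derivatives change both.\<close>

lemma fourier_cut_partial_decay: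
  assumes "finite A" "smooth_bump (2 * card A) f" "bs \<in> lists Basis"
  shows "\<exists>C. \<forall>x w. norm (fourier (cut_partial f bs x) w) * (\<Prod>j\<in>A. 1 + (w $ j)\<^sup>2) \<le> C / (1 + norm x) ^ M"
  using assms
proof (induction A arbitrary: f bs rule: finite_induct)
  case empty
  then show ?case using fourier_cut_partial_base[of 0 f bs M] by simp
next
  case (insert j A)
  let ?b = "axis j 1 :: real^'n"
  have f: "smooth_bump (Suc (Suc (2 * card A))) f" using insert.prems(1) insert.hyps by simp
  then obtain f1 where f1: "\<And>t. ((\<lambda>r. f (t + r *\<^sub>R ?b))
    has_real_derivative f1 t) (at 0)" "smooth_bump (Suc (2 * card A)) f1"
    unfolding smooth_bump.simps(2)[of "Suc (2 * card A)"] by blast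
  from f1(2) obtain f2 where f2: "\<And>t. ((\<lambda>r. f1 (t + r *\<^sub>R ?b))
    has_real_derivative f2 t) (at 0)" "smooth_bump (2 * card A) f2"
    unfolding smooth_bump.simps(2)[of "2 * card A"] by blast
  have f0: "smooth_bump (2 * card A) f" "smooth_bump (2 * card A) f1" using f f1 smooth_bump_mono
    by blast+
  have bs: "bs \<in> lists Basis" by fact
  have bs1: "?b # bs \<in> lists Basis" and bs2: "?b # ?b # bs \<in> lists Basis" using bs
    by (auto simp: axis_in_Basis_iff)
  define N where "N g cs x w = norm (fourier (cut_partial g cs x) w)" for g cs x w
  define P where "P w = (\<Prod>j\<in>A. 1 + (w $ j)\<^sup>2)" for w :: "real^'n"
  have P: "P w \<ge> 0" for w by (simp add: P_def prod_nonneg)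
  \<comment> \<open>The four terms of (1 + w_j^2) applied twice by parts: no derivative, both on the
    bump, one on each (this arises twice), both on the window.\<close>
  obtain C0 where C0: "\<And>x w. N f bs x w * P w \<le> C0 / (1 + norm x) ^ M"
    using insert.IH[OF f0(1) bs] unfolding N_def P_def by blast
  obtain C1 where C1: "\<And>x w. N f2 bs x w * P w \<le> C1 / (1 + norm x) ^ M"
    using insert.IH[OF f2(2) bs] unfolding N_def P_def by blast
  obtain C2 where C2: "\<And>x w. N f1 (?b # bs) x w * P w \<le> C2 / (1 + norm x) ^ M"
    using insert.IH[OF f0(2) bs1] unfolding N_def P_def by blast
  obtain C3 where C3: "\<And>x w. N f (?b # ?b # bs) x w * P w \<le> C3 / (1 + norm x) ^ M"
    using insert.IH[OF f0(1) bs2] unfolding N_def P_def by blast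
  have "N f bs x w * (\<Prod>j\<in>insert j A. 1 + (w $ j)\<^sup>2) \<le> (C0 + C1 + 2 * C2 + C3) / (1 + norm x) ^ M" for x w
  proof -
    let ?a = "\<bar>w $ j\<bar>"
    have s1: "?a * N f bs x w \<le> N f1 bs x w + N f (?b # bs) x w"
      unfolding N_def by (rule fourier_cut_partial_step[OF f0(1) f0(2) bs f1(1)])
    have s2: "?a * N f1 bs x w \<le> N f2 bs x w + N f1 (?b # bs) x w"
      unfolding N_def by (rule fourier_cut_partial_step[OF f0(2) f2(2) bs f2(1)])
    have s3: "?a * N f (?b # bs) x w \<le> N f1 (?b # bs) x w + N f (?b # ?b # bs) x w"
      unfolding N_def by (rule fourier_cut_partial_step[OF f0(1) f0(2) bs1 f1(1)])
    have "(w $ j)\<^sup>2 * N f bs x w = ?a * (?a * N f bs x w)"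
      by (simp add: power2_eq_square flip: mult.assoc)
    also have "\<dots> \<le> ?a * (N f1 bs x w + N f (?b # bs) x w)" by (intro mult_left_mono s1) simp
    also have "\<dots> \<le> N f2 bs x w + 2 * N f1 (?b # bs) x w + N f (?b # ?b # bs) x w"
      unfolding distrib_left using s2 s3 by linarith
    finally have "(1 + (w $ j)\<^sup>2) * N f bs x w \<le> N f bs x w + N f2 bs x w + 2 * N f1 (?b # bs) x w
      + N f (?b # ?b # bs) x w"
      by (simp add: distrib_right)
    then have "((1 + (w $ j)\<^sup>2) * N f bs x w) * P w \<le> (N f bs x w + N f2 bs x w + 2 * N f1 (?b # bs)
      x w + N f (?b # ?b # bs) x w) * P w"
      by (rule mult_right_mono[OF _ P])
    also have "\<dots> = N f bs x w * P w + N f2 bs x w * P w + 2 * (N f1 (?b # bs) x w * P w) + N f (?b #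
      ?b # bs) x w * P w"
      by (simp add: algebra_simps)
    also have "\<dots> \<le> C0 / (1 + norm x) ^ M + C1 / (1 + norm x) ^ M + 2 * (C2 / (1 + norm x) ^ M)
      + C3 / (1 + norm x) ^ M"
      using C0[of x w] C1[of x w] C2[of x w] C3[of x w] by linarith
    also have "\<dots> = (C0 + C1 + 2 * C2 + C3) / (1 + norm x) ^ M" by (simp add: add_divide_distrib)
    finally show ?thesis using insert.hyps by (simp add: P_def mult_ac)
  qed
  then show ?case unfolding N_def by blast
qed

text \<open>The decay bound separates into a function of x and a function of w, both integrable,
  which dominates \<open>V\<close> on the whole time-frequency space.\<close>

lemma smooth_bump_M1:
  assumes f: "smooth_bump (2 * CARD('n)) f"
  shows "(\<lambda>t. complex_of_real (f t)) \<in> M1 \<phi>"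
proof -
  let ?u = "\<lambda>t. complex_of_real (f t)"
  have uc: "continuous_on UNIV ?u" using smooth_bump_0[OF f] by (intro continuous_on_of_real) simp
  have ui: "integrable lborel ?u" using smooth_bump_integrable[OF f] by simp
  have cut: "cut ?u x = cut_partial f [] x" for x by (simp add: fun_eq_iff cut_def cut_partial_def)
  obtain C where C: "\<And>x w. norm (fourier (cut_partial f [] x) w) * (\<Prod>j\<in>UNIV. 1 + (w $ j)\<^sup>2)
    \<le> C / (1 + norm x) ^ (2 * CARD('n))"
    using fourier_cut_partial_decay[of UNIV f "[]" "2 * CARD('n)"] f by auto
  define g1 where "g1 x = complex_of_real (1 / (1 + norm x) ^ (2 * CARD('n)))" for x :: "real^'n"
  define g2 where "g2 w = complex_of_real (\<Prod>j\<in>UNIV. 1 / (1 + (w $ j)\<^sup>2))" for w :: "real^'n"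
  have gi: "integrable lborel g1" "integrable lborel g2"
    unfolding g1_def g2_def by (intro integrable_of_real integrable_decay integrable_vec_decay)+
  have "integrable lborel (V ?u)"
  proof (rule Bochner_Integration.integrable_bound)
    show "integrable lborel (\<lambda>z. C *\<^sub>R (case z of (x, w) \<Rightarrow> g1 x * g2 w))"
      using integrable_pair_mult[OF gi] by (simp add: lborel_prod)
    show "V ?u \<in> borel_measurable lborel"
    proof -
      have "continuous_on UNIV (\<lambda>p. ?u (snd p) * cnj (rho (fst p) \<phi> (snd p)))"
        unfolding rho_def cis_conv_exp
        by (intro continuous_intros continuous_on_compose2[OF uc] continuous_on_compose2[OF
          continuous_phi]) auto
      then have "(\<lambda>p. ?u (snd p) * cnj (rho (fst p) \<phi> (snd p))) \<in> borel_measurable (lborel \<Otimes>\<^sub>M lborel)"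
        by (simp add: lborel_prod borel_measurable_continuous_onI)
      then have "(\<lambda>z. LINT t|lborel. ?u t * cnj (rho z \<phi> t)) \<in> borel_measurable lborel"
        by (intro lborel.borel_measurable_lebesgue_integral) (simp add: case_prod_unfold)
      then show ?thesis unfolding V_def[abs_def] regular_distribution_def .
    qed
    show "AE z in lborel. norm (V ?u z) \<le> norm (C *\<^sub>R (case z of (x, w) \<Rightarrow> g1 x * g2 w))"
    proof (rule AE_I2, clarify)
      fix x w :: "real^'n"
      have pos: "(\<Prod>j\<in>UNIV. 1 + (w $ j)\<^sup>2) > 0" by (intro prod_pos) (auto simp: add_pos_nonneg)
      have C0: "C \<ge> 0"
      proof -
        have "0 \<le> C / (1 + norm x) ^ (2 * CARD('n))" by (rule order_trans[OF _ C[of x w]]) (use pos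
          in simp)
        then show ?thesis by (simp add: zero_le_divide_iff) (metis add_pos_nonneg norm_ge_zero
          not_less zero_less_one zero_less_power)
      qed
      have "norm (V ?u (x, w)) \<le> C / (1 + norm x) ^ (2 * CARD('n)) / (\<Prod>j\<in>UNIV. 1 + (w $ j)\<^sup>2)"
        using C[of x w] unfolding norm_V cut pos_le_divide_eq[OF pos] .
      also have "\<dots> = norm (C *\<^sub>R (g1 x * g2 w))"
        using C0 pos by (simp add: g1_def g2_def norm_mult prod_dividef norm_divide abs_of_pos
          norm_power add_pos_nonneg flip: of_real_prod of_real_power of_real_add)
      finally show "norm (V ?u (x, w)) \<le> norm (C *\<^sub>R (g1 x * g2 w))" .
    qed
  qed
  then show ?thesis using uc ui by (simp add: M1_iff)
qed

lemma lattice_delta_exists: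
  assumes s: "\<And>j. s j > 0"
  shows "\<exists>u\<in>M1 \<phi>. \<forall>k. u (dlat s k) = (if k = 0 then 1 else 0)"
proof -
  \<comment> \<open>A nonzero lattice point t has a coordinate of modulus at least 1 / s_j, so t
    \<bullet> t \<ge> 1 / (s_j)^2 \<ge> 1 / R and the bump vanishes there. The summand 1 secures R
    \<ge> 1.\<close>
  define R where "R = 1 + (\<Sum>j\<in>UNIV. (s j)\<^sup>2)"
  have R: "R \<ge> 1" by (simp add: R_def sum_nonneg)
  define f where "f t = 1 * max 0 (1 - R * (t \<bullet> t)) ^ Suc (2 * CARD('n))" for t :: "real^'n"
  have f: "smooth_bump (2 * CARD('n)) f"
    unfolding f_def using R by (intro smooth_bump_polynomial real_polynomial_function.intros(2)) auto
  have "f (dlat s k) = 0" if "k \<noteq> 0" for k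
  proof -
    from that obtain j where j: "k $ j \<noteq> 0" by (auto simp: vec_eq_iff)
    have "1 \<le> \<bar>real_of_int (k $ j)\<bar>" using j by linarith
    then have k1: "1 \<le> (real_of_int (k $ j))\<^sup>2" by (metis one_power2 power2_abs power_mono zero_le_one)
    have "(s j)\<^sup>2 \<le> (\<Sum>j\<in>UNIV. (s j)\<^sup>2)" by (intro member_le_sum) auto
    then have "(s j)\<^sup>2 \<le> R" by (simp add: R_def)
    moreover have "1 / (s j)\<^sup>2 \<le> dlat s k \<bullet> dlat s k"
    proof -
      have "1 / (s j)\<^sup>2 \<le> (dlat s k $ j)\<^sup>2" using k1 by (simp add: lat_def power_divide divide_right_mono)
      also have "\<dots> \<le> (\<Sum>i\<in>UNIV. (dlat s k $ i)\<^sup>2)" by (intro member_le_sum) auto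
      finally show ?thesis by (simp add: inner_vec_def power2_eq_square)
    qed
    ultimately have "(s j)\<^sup>2 * (1 / (s j)\<^sup>2) \<le> R * (dlat s k \<bullet> dlat s k)" using R
      by (intro mult_mono) auto
    then have "1 \<le> R * (dlat s k \<bullet> dlat s k)" using s[of j] by simp
    then have "max 0 (1 - R * (dlat s k \<bullet> dlat s k)) = 0" by simp
    then show ?thesis by (simp add: f_def)
  qed
  moreover have "f 0 = 1" by (simp add: f_def)
  ultimately show ?thesis using smooth_bump_M1[OF f] by (intro bexI[of _ "\<lambda>t. of_real (f t)"]) auto
qed

end

section \<open>Code states\<close>

locale code = window \<phi> for \<phi> :: "real^'n::finite \<Rightarrow> complex" +
  fixes d :: "'n \<Rightarrow> nat"
  assumes d_pos: "\<And>j. d j > 0"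
begin

definition s :: "'n \<Rightarrow> real" where "s j = sqrt (real (d j))"

lemma s_pos: "s j > 0"
  using d_pos by (simp add: s_def)

lemma dual_s_pos: "dual s j > 0"
  using s_pos by simp

lemma s_square: "s j * s j = real (d j)"
  by (simp add: s_def)

lemma Dhalf_eq: "Dhalf d k = lat s k"
  by (simp add: Dhalf_def lat_def s_def)

text \<open>\<open>idx r k\<close> is the index of the point \<open>\<delta>\<^sub>r - D\<^bsup>1/2\<^esup> k\<close> of the lattice \<open>D\<^bsup>-1/2\<^esup> \<int>\<^sup>n\<close>.\<close>

definition idx :: "nat^'n \<Rightarrow> int^'n \<Rightarrow> int^'n" where
  "idx r k = (\<chi> j. int (r $ j) - int (d j) * k $ j)"

lemma lat_idx: "dlat s (idx r k) = delta_shift d r - lat s k"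
proof -
  have "dlat s (idx r k) $ j = (delta_shift d r - lat s k) $ j" for j
  proof -
    have "dlat s (idx r k) $ j = (real (r $ j) - s j * s j * of_int (k $ j)) / s j"
      unfolding s_square by (simp add: lat_def idx_def)
    also have "\<dots> = real (r $ j) / s j - s j * of_int (k $ j)"
      using s_pos[of j] by (simp add: diff_divide_distrib)
    also have "\<dots> = (delta_shift d r - lat s k) $ j" by (simp add: delta_shift_def lat_def s_def)
    finally show ?thesis .
  qed
  then show ?thesis by (simp add: vec_eq_iff)
qed

lemma inj_idx: "inj (idx r)"
proof (rule injI)
  fix k l assume "idx r k = idx r l"
  then have "int (d j) * k $ j = int (d j) * l $ j" for j by (simp add: idx_def vec_eq_iff)
  then show "k = l" using d_pos by (simp add: vec_eq_iff) (metis less_irrefl)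
qed

text \<open>Reduction modulo d_j deletes the multiple of d_j and leaves the representative r_j <
  d_j. Together with \<open>idx_surj\<close> and \<open>inj_idx\<close>, the classes partition the
  lattice.\<close>

lemma idx_unique:
  assumes "idx r k = idx r' k'" "r \<in> Zd d" "r' \<in> Zd d"
  shows "r = r'"
proof -
  have "r $ j = r' $ j" for j
  proof -
    have "int (r $ j) - int (d j) * k $ j = int (r' $ j) - int (d j) * k' $ j"
      using assms(1) by (simp add: idx_def vec_eq_iff)
    then have e: "(int (r $ j) - int (d j) * k $ j) mod int (d j) = (int (r' $ j) - int (d j)
      * k' $ j) mod int (d j)" by simp
    have m: "(int a - int (d j) * x) mod int (d j) = int a" if "a < d j" for a x
    proof -
      have "(int a - int (d j) * x) mod int (d j) = (int a + int (d j) * (- x)) mod int (d j)"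
        by (simp only: mult_minus_right add_uminus_conv_diff)
      also have "\<dots> = int a mod int (d j)" by (rule mod_mult_self2)
      also have "\<dots> = int a" using that by (intro mod_pos_pos_trivial) auto
      finally show ?thesis .
    qed
    have "r $ j < d j" "r' $ j < d j" using assms(2,3) by (auto simp: Zd_def)
    from e[unfolded m[OF this(1)] m[OF this(2)]] show ?thesis by (simp only: of_nat_eq_iff)
  qed
  then show ?thesis by (simp add: vec_eq_iff)
qed

lemma idx_surj: obtains r k where "r \<in> Zd d" "idx r k = m"
proof
  have p: "0 \<le> m $ j mod int (d j)" "m $ j mod int (d j) < int (d j)" for j using d_pos[of j]
    by simp_all
  show "(\<chi> j. nat (m $ j mod int (d j))) \<in> Zd d"
    using p by (simp add: Zd_def nat_less_iff)
  show "idx (\<chi> j. nat (m $ j mod int (d j))) (\<chi> j. - (m $ j div int (d j))) = m"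
  proof -
    have "int (nat (m $ j mod int (d j))) - int (d j) * - (m $ j div int (d j)) = m $ j" for j
      using p(1)[of j] mod_mult_div_eq[of "m $ j" "int (d j)"]
        by (simp only: nat_0_le mult_minus_right minus_mult_right[symmetric] diff_minus_eq_add)
    then show ?thesis by (simp only: idx_def vec_eq_iff vec_lambda_beta) blast
  qed
qed

lemma finite_Zd: "finite (Zd d)"
proof -
  have "Zd d = {r. \<forall>j. r $ j \<in> {..<d j}}" by (auto simp: Zd_def)
  then show ?thesis using card_vec_box(1)[of "\<lambda>j. {..<d j}"] by simp
qed

lemma lattice_integrable: "h \<in> M1 \<phi> \<Longrightarrow> integrable counting (\<lambda>m. h (dlat s m))"
  using lattice_values_bound[of "dual s", OF dual_s_pos] by blast

section \<open>The Zak transform at the origin and its pairing\<close>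

definition zvec :: "(real^'n \<Rightarrow> complex) \<Rightarrow> nat^'n \<Rightarrow> complex" where
  "zvec h r = (\<Sum>\<^sup>L k. h (dlat s (idx r k)))"

lemma idx_integrable:
  fixes f :: "int^'n \<Rightarrow> 'b::{banach,second_countable_topology}"
  assumes f: "integrable counting f"
  shows "integrable counting (\<lambda>k. f (idx r k))"
proof -
  have "Infinite_Set_Sum.abs_summable_on f (range (idx r))"
    by (rule abs_summable_on_subset[of f UNIV]) (use f in \<open>auto simp: abs_summable_on_def\<close>)
  then show ?thesis using abs_summable_on_reindex_iff[OF inj_idx[of r], of f]
    by (simp add: abs_summable_on_def)
qed

lemma zvec_integrable: "h \<in> M1 \<phi> \<Longrightarrow> integrable counting (\<lambda>k. h (dlat s (idx r k)))"
  using idx_integrable[OF lattice_integrable] .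

text \<open>At the origin all phases are 1. Since the lattice values are absolutely summable, the
  unordered sum in \<open>zak\<close> agrees with the integral against counting measure.\<close>

lemma vzak_eq:
  assumes h: "h \<in> M1 \<phi>" shows "vzak d h (0, 0) = (\<lambda>r. if r \<in> Zd d then zvec h r else 0)"
proof -
  have inj: "inj (Dhalf d)"
  proof (rule injI)
    fix k l assume "Dhalf d k = Dhalf d l"
    then show "k = l" using s_pos by (simp add: Dhalf_eq lat_def vec_eq_iff) (metis less_irrefl)
  qed
  have "zak d h (delta_shift d r, 0) = zvec h r" for r
  proof -
    have "zak d h (delta_shift d r, 0) = infsum (\<lambda>\<gamma>. h (delta_shift d r - \<gamma>)) (range (Dhalf d))"
      by (simp add: zak_def)
    also have "\<dots> = infsum (\<lambda>k. h (dlat s (idx r k))) UNIV"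
      unfolding infsum_reindex[OF inj] by (simp add: o_def Dhalf_eq lat_idx)
    also have "\<dots> = infsetsum (\<lambda>k. h (dlat s (idx r k))) UNIV"
      by (rule infsetsum_infsum[symmetric]) (use zvec_integrable[OF h]
        in \<open>simp add: abs_summable_on_def\<close>)
    finally show ?thesis by (simp add: zvec_def infsetsum_def)
  qed
  then show ?thesis by (simp add: vzak_def fun_eq_iff)
qed

definition pair :: "(nat^'n \<Rightarrow> complex) \<Rightarrow> (real^'n \<Rightarrow> complex) \<Rightarrow> complex" where
  "pair c h = (\<Sum>r\<in>Zd d. c r * cnj (zvec h r))"

lemma delta0_vzak: "h \<in> M1 \<phi> \<Longrightarrow> delta0 d c (vzak d h) = pair c h"
  by (simp add: delta0_def Hd_inner_def pair_def vzak_eq)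

lemma zvec_add: "h \<in> M1 \<phi> \<Longrightarrow> g \<in> M1 \<phi> \<Longrightarrow> zvec (\<lambda>t. h t + g t) r = zvec h r + zvec g r"
  unfolding zvec_def by (rule Bochner_Integration.integral_add[OF zvec_integrable zvec_integrable])

lemma pair_antilinear: "antilinear_on (M1 \<phi>) (pair c)"
  unfolding antilinear_on_def
proof (intro conjI ballI allI)
  fix h g assume "h \<in> M1 \<phi>" "g \<in> M1 \<phi>"
  then show "pair c (\<lambda>t. h t + g t) = pair c h + pair c g"
    by (simp add: pair_def zvec_add distrib_left sum.distrib)
next
  fix a h
  have "zvec (\<lambda>t. a * h t) r = a * zvec h r" for r by (simp add: zvec_def)
  then show "pair c (\<lambda>t. a * h t) = cnj a * pair c h"
    by (simp add: pair_def sum_distrib_left mult_ac)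
qed

text \<open>Each component of the Zak vector sums \<open>h\<close> over one class only, so its
  modulus is at most the l1-norm over the full lattice.\<close>

lemma pair_bound:
  assumes h: "h \<in> M1 \<phi>"
  shows "norm (pair c h) \<le> (\<Sum>r\<in>Zd d. norm (c r)) * (\<Sum>\<^sup>L m. norm (h (dlat s m)))"
proof -
  let ?f = "\<lambda>m. norm (h (dlat s m))"
  have fi: "integrable counting ?f" by (rule integrable_norm[OF lattice_integrable[OF h]])
  have z: "norm (zvec h r) \<le> (\<Sum>\<^sup>L m. ?f m)" for r
  proof -
    have "norm (zvec h r) \<le> infsetsum (\<lambda>k. ?f (idx r k)) UNIV"
      unfolding zvec_def infsetsum_def by (rule integral_norm_bound)
    also have "\<dots> = infsetsum ?f (range (idx r))"
      by (rule infsetsum_reindex_bij_betw) (rule inj_on_imp_bij_betw[OF inj_idx])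
    also have "\<dots> \<le> infsetsum ?f UNIV"
    proof (rule infsetsum_mono_neutral_left)
      show fs: "Infinite_Set_Sum.abs_summable_on ?f UNIV" using fi unfolding abs_summable_on_def .
      show "Infinite_Set_Sum.abs_summable_on ?f (range (idx r))"
        by (rule abs_summable_on_subset[OF fs]) simp
    qed auto
    finally show ?thesis by (simp add: infsetsum_def)
  qed
  have "norm (pair c h) \<le> (\<Sum>r\<in>Zd d. norm (c r) * norm (zvec h r))"
    unfolding pair_def by (rule order_trans[OF norm_sum]) (simp add: norm_mult)
  also have "\<dots> \<le> (\<Sum>r\<in>Zd d. norm (c r) * (\<Sum>\<^sup>L m. ?f m))"
    by (intro sum_mono mult_left_mono z) simp
  finally show ?thesis by (simp add: sum_distrib_right)
qed

section \<open>Interpolation on the lattice\<close>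

definition spike :: "real^'n \<Rightarrow> complex" where
  "spike = (SOME u. u \<in> M1 \<phi> \<and> (\<forall>m. u (dlat s m) = (if m = 0 then 1 else 0)))"

lemma spike: "spike \<in> M1 \<phi>" "spike (dlat s m) = (if m = 0 then 1 else 0)"
proof -
  have "\<exists>u. u \<in> M1 \<phi> \<and> (\<forall>m. u (dlat s m) = (if m = 0 then 1 else 0))"
    using lattice_delta_exists[of s, OF s_pos] by blast
  from someI_ex[OF this] show "spike \<in> M1 \<phi>" "spike (dlat s m) = (if m = 0 then 1 else 0)"
    unfolding spike_def[symmetric] by auto
qed

definition spike_at :: "int^'n \<Rightarrow> real^'n \<Rightarrow> complex" where
  "spike_at m t = spike (t - dlat s m)"

lemma spike_at_M1: "spike_at m \<in> M1 \<phi>"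
proof -
  have "spike_at m = rho (dlat s m, 0) spike" by (simp add: spike_at_def rho_def fun_eq_iff)
  then show ?thesis using M1_rho[OF spike(1)] by simp
qed

lemma spike_at_lat: "spike_at m (dlat s l) = (if l = m then 1 else 0)"
  using spike(2)[of "l - m"] by (simp add: spike_at_def lat_diff)

text \<open>A spike sees a single lattice point, which belongs to exactly one class. Spikes thus
  read off the coordinates of \<open>c\<close>, which gives both the candidate vector and its
  uniqueness.\<close>

lemma pair_spike_at:
  assumes r: "r \<in> Zd d" shows "pair c (spike_at (idx r k)) = c r"
proof -
  have "zvec (spike_at (idx r k)) r' = (if r' = r then 1 else 0)" if r': "r' \<in> Zd d" for r'
  proof (cases "r' = r")
    case True
    have "idx r l = idx r k \<longleftrightarrow> l = k" for l using inj_idx[of r] by (auto dest: injD)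
    then have "zvec (spike_at (idx r k)) r = (\<Sum>\<^sup>L l. (if l = k then 1 else 0))"
      by (simp add: zvec_def spike_at_lat)
    also have "\<dots> = 1" by (subst lebesgue_integral_count_space_finite_support) auto
    finally show ?thesis using True by simp
  next
    case False
    then have "idx r' l \<noteq> idx r k" for l using idx_unique[OF _ r' r] by blast
    then show ?thesis using False by (simp add: zvec_def spike_at_lat)
  qed
  then have "pair c (spike_at (idx r k)) = (\<Sum>r'\<in>Zd d. if r' = r then c r else 0)"
    unfolding pair_def by (intro sum.cong) auto
  also have "\<dots> = c r" using r finite_Zd by simp
  finally show ?thesis .
qed

text \<open>The lattice values of \<open>h - (\<Sum>m\<in>F. h(m) spike_at m)\<close> are small for large finite \<open>F\<close>.\<close>

lemma lattice_bounded_zero: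
  assumes anti: "antilinear_on (M1 \<phi>) \<theta>"
    and bdd: "\<And>h. h \<in> M1 \<phi> \<Longrightarrow> norm (\<theta> h) \<le> K * (\<Sum>\<^sup>L m. norm (h (dlat s m)))"
    and zero: "\<And>m. \<theta> (spike_at m) = 0" and h: "h \<in> M1 \<phi>"
  shows "\<theta> h = 0"
proof (rule eq_0_if_norm_le_eps)
  fix e :: real assume e: "e > 0"
  define f where "f m = norm (h (dlat s m))" for m
  have fi: "integrable counting f"
    unfolding f_def by (rule integrable_norm[OF lattice_integrable[OF h]])
  \<comment> \<open>The summand 1 keeps the divisor positive whatever the value of
    \<open>K\<close>.\<close>
  define e' where "e' = e / (\<bar>K\<bar> + 1)"
  have e': "e' > 0" using e by (simp add: e'_def)
  have fs: "Infinite_Set_Sum.abs_summable_on f UNIV" using fi unfolding abs_summable_on_def .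
  have "f summable_on UNIV"
  proof -
    have "Infinite_Set_Sum.abs_summable_on (\<lambda>m. h (dlat s m)) UNIV"
      using lattice_integrable[OF h] unfolding abs_summable_on_def .
    moreover have "f = (\<lambda>m. norm (h (dlat s m)))" by (simp add: fun_eq_iff f_def)
    ultimately show ?thesis unfolding abs_summable_equivalent[symmetric] by simp
  qed
  then have "(f has_sum infsum f UNIV) UNIV" by (rule has_sum_infsum)
  then have "eventually (\<lambda>F. dist (sum f F) (infsum f UNIV) < e') (finite_subsets_at_top UNIV)"
    unfolding has_sum_def using e' by (rule tendstoD)
  then obtain F where F: "finite F" "dist (sum f F) (infsum f UNIV) < e'"
    unfolding eventually_finite_subsets_at_top by blast
  have If: "infsum f UNIV = (\<Sum>\<^sup>L m. f m)"
    using infsetsum_infsum[OF fs] by (simp add: infsetsum_def)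
  define g where "g = (\<lambda>t. h t + (- 1) * (\<Sum>m\<in>F. h (dlat s m) * spike_at m t))"
  have M: "(\<lambda>t. h (dlat s m) * spike_at m t) \<in> M1 \<phi>" for m by (intro M1_cmult spike_at_M1)
  have S: "(\<lambda>t. \<Sum>m\<in>F. h (dlat s m) * spike_at m t) \<in> M1 \<phi>" by (rule M1_sum[OF F(1) M])
  have gM: "g \<in> M1 \<phi>" unfolding g_def by (intro M1_add M1_cmult[of _ "- 1"] h S)
  have "\<theta> g = \<theta> h + cnj (- 1) * (\<Sum>m\<in>F. cnj (h (dlat s m)) * \<theta> (spike_at m))"
    unfolding g_def antilinear_add[OF anti h M1_cmult[OF S]] antilinear_cmult[OF anti S]
      antilinear_sum[OF anti F(1) M]
    by (simp add: antilinear_cmult[OF anti spike_at_M1])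
  then have "\<theta> h = \<theta> g" by (simp add: zero)
  \<comment> \<open>Subtracting the interpolant cancels the values on \<open>F\<close> and leaves
    all other lattice values untouched, so the l1-norm of \<open>g\<close> on the lattice is the
    tail of a convergent sum.\<close>
  have gv: "norm (g (dlat s l)) = f l - (if l \<in> F then f l else 0)" for l
  proof -
    have "(\<Sum>m\<in>F. h (dlat s m) * spike_at m (dlat s l)) = (\<Sum>m\<in>F. if m = l then h (dlat s l) else 0)"
      by (intro sum.cong) (auto simp: spike_at_lat)
    also have "\<dots> = (if l \<in> F then h (dlat s l) else 0)" using F(1) by simp
    finally show ?thesis by (simp add: g_def f_def)
  qed
  have Fi: "integrable counting (\<lambda>l. if l \<in> F then f l else 0)"
    by (rule Bochner_Integration.integrable_bound[OF fi]) auto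
  have "(\<Sum>\<^sup>L l. norm (g (dlat s l))) = (\<Sum>\<^sup>L m. f m) - (\<Sum>\<^sup>L l. (if l \<in> F then f l else 0))"
    unfolding gv by (rule Bochner_Integration.integral_diff[OF fi Fi])
  also have "(\<Sum>\<^sup>L l. (if l \<in> F then f l else 0)) = sum f F"
  proof -
    have sub: "{l \<in> UNIV. (if l \<in> F then f l else 0) \<noteq> 0} \<subseteq> F" by auto
    have "(\<Sum>\<^sup>L l. (if l \<in> F then f l else 0)) = (\<Sum>l\<in>{l \<in> UNIV. (if l \<in> F then f l else 0) \<noteq> 0}.
      if l \<in> F then f l else 0)"
      using finite_subset[OF sub F(1)] by (intro lebesgue_integral_count_space_finite_support) simp
    also have "\<dots> = (\<Sum>l\<in>F. if l \<in> F then f l else 0)" using F(1) by (intro sum.mono_neutral_left) auto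
    finally show ?thesis by simp
  qed
  finally have small: "(\<Sum>\<^sup>L l. norm (g (dlat s l))) < e'"
    using F(2) unfolding If by (simp add: dist_real_def)
  have "norm (\<theta> h) \<le> K * (\<Sum>\<^sup>L l. norm (g (dlat s l)))"
    using bdd[OF gM] \<open>\<theta> h = \<theta> g\<close> by simp
  also have "\<dots> \<le> (\<bar>K\<bar> + 1) * (\<Sum>\<^sup>L l. norm (g (dlat s l)))"
    by (intro mult_right_mono) auto
  also have "\<dots> \<le> (\<bar>K\<bar> + 1) * e'" using small by (intro mult_left_mono) auto
  also have "\<dots> = e" by (simp add: e'_def)
  finally show "norm (\<theta> h) \<le> e" .
qed

text \<open>If one of the two components is zero, \<open>chi_D\<close> equals 1. The index is
  negated because \<open>rho_dual z\<close> evaluates at \<open>rho (- z) h\<close>.\<close>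

lemma code_space_translation:
  assumes "\<psi> \<in> code_space d \<phi>"
  shows "\<psi> (rho (lat s k, 0) h) = \<psi> h" "\<psi> (rho (0, lat s k) h) = \<psi> h"
proof -
  have S: "S_op d a b \<psi> h = \<psi> h" for a b using assms by (simp add: code_space_def)
  show "\<psi> (rho (lat s k, 0) h) = \<psi> h"
    using S[of "- k" 0] by (simp add: S_op_def chi_D_def rho_dual_def Dhalf_eq lat_minus)
  show "\<psi> (rho (0, lat s k) h) = \<psi> h"
    using S[of 0 "- k"] by (simp add: S_op_def chi_D_def rho_dual_def Dhalf_eq lat_minus)
qed

lemma code_state_exists:
  assumes psi: "\<psi> \<in> code_space d \<phi>"
  shows "\<exists>c\<in>Hd d. \<forall>h\<in>M1 \<phi>. pair c h = \<psi> h"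
proof -
  have anti: "antilinear_on (M1 \<phi>) \<psi>" using psi by (simp add: code_space_def Minf_def)
  obtain C where C: "\<And>h. h \<in> M1 \<phi> \<Longrightarrow> norm (\<psi> h) \<le> C * M1_norm \<phi> h"
    using psi unfolding code_space_def Minf_def by blast
  obtain K where K: "\<And>h. h \<in> M1 \<phi> \<Longrightarrow> norm (\<psi> h) \<le> K * (\<Sum>\<^sup>L m. norm (h (dlat s m)))"
    using modulation_invariant_bound[of s, OF s_pos anti C code_space_translation(2)[OF psi]] by blast
  \<comment> \<open>Any point of the class would do in place of \<open>idx r 0\<close>, by
    translation invariance.\<close>
  define c where "c r = (if r \<in> Zd d then \<psi> (spike_at (idx r 0)) else 0)" for r
  have cH: "c \<in> Hd d" by (simp add: Hd_def c_def)
  define \<theta> where "\<theta> h = \<psi> h - pair c h" for h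
  have "\<theta> h = 0" if h: "h \<in> M1 \<phi>" for h
  proof (rule lattice_bounded_zero[OF _ _ _ h])
    show "antilinear_on (M1 \<phi>) \<theta>"
      using anti pair_antilinear[of c] unfolding antilinear_on_def \<theta>_def by (simp add: algebra_simps)
    show "norm (\<theta> h) \<le> (K + (\<Sum>r\<in>Zd d. norm (c r))) * (\<Sum>\<^sup>L m. norm (h (dlat s m)))" if "h \<in> M1 \<phi>" for h
      using norm_triangle_ineq4[of "\<psi> h" "pair c h"] K[OF that] pair_bound[OF that, of c]
      unfolding \<theta>_def distrib_right by linarith
    fix m
    obtain r k where r: "r \<in> Zd d" "idx r k = m" by (rule idx_surj)
    \<comment> \<open>Points of one class differ by a vector of D^(1/2) Z^n, so the two spikes are
      translates of each other and \<psi> takes the same value on them.\<close>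
    have "dlat s m = dlat s (idx r 0) - lat s k"
      unfolding r(2)[symmetric] lat_idx by simp
    then have e: "t - dlat s m = t + lat s k - dlat s (idx r 0)" for t by simp
    have "spike_at m t = rho (- lat s k, 0) (spike_at (idx r 0)) t" for t
      unfolding spike_at_def rho_def e by simp
    then have "spike_at m = rho (- lat s k, 0) (spike_at (idx r 0))" by blast
    then have "\<psi> (spike_at m) = \<psi> (spike_at (idx r 0))"
      using code_space_translation(1)[OF psi, of "- k"] by (simp add: lat_minus)
    then show "\<theta> (spike_at m) = 0"
      using pair_spike_at[OF r(1), of c k] r by (simp add: \<theta>_def c_def)
  qed
  then show ?thesis using cH by (intro bexI[of _ c]) (auto simp: \<theta>_def)
qed

lemma pair_unique:
  assumes "c \<in> Hd d" "c' \<in> Hd d" "\<And>h. h \<in> M1 \<phi> \<Longrightarrow> pair c h = pair c' h"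
  shows "c = c'"
proof
  fix r
  show "c r = c' r"
  proof (cases "r \<in> Zd d")
    case True
    then show ?thesis using assms(3)[OF spike_at_M1[of "idx r 0"]] by (simp add: pair_spike_at)
  next
    case False then show ?thesis using assms(1,2) by (simp add: Hd_def)
  qed
qed

section \<open>From vectors back to code states\<close>

lemma rho_inverse: "rho z (rho (- z) h) = h"
proof
  fix t
  have e: "- pi * (fst z \<bullet> snd z) + 2 * pi * (snd z \<bullet> t) + - pi * (fst z \<bullet> snd z) + - 2 * pi
    * (snd z \<bullet> (t - fst z)) = 0"
    by (simp add: inner_diff_right inner_commute[of "snd z" "fst z"] algebra_simps)
  have "rho z (rho (- z) h) t = cis (- pi * (fst z \<bullet> snd z)) * e2pi (snd z \<bullet> t) * cis (- pi
    * (fst z \<bullet> snd z)) * cis (- 2 * pi * (snd z \<bullet> (t - fst z))) * h t"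
    by (simp add: rho_def)
  also have "\<dots> = h t" unfolding cis_mult e by simp
  finally show "rho z (rho (- z) h) t = h t" .
qed

text \<open>Functionals take the value 0 outside \<open>M1\<close>. Invariance as an equality of
  functions therefore also requires that \<open>rho\<close> cannot carry a function from outside
  into \<open>M1\<close>.\<close>

lemma M1_rho_iff: "rho z h \<in> M1 \<phi> \<longleftrightarrow> h \<in> M1 \<phi>"
proof
  assume "rho z h \<in> M1 \<phi>"
  from M1_rho[OF this, of "- z"] show "h \<in> M1 \<phi>" using rho_inverse[of "- z" h]
    by (simp only: minus_minus)
qed (rule M1_rho)

text \<open>The sign in \<open>S_op\<close> is the symmetrising phase of \<open>rho\<close> at the
  lattice point: the inner product is an integer there, and only its parity counts.\<close>

lemma chi_D_cis: "chi_D d k l = cis (- pi * (lat s k \<bullet> lat s l))"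
proof -
  define N where "N = (\<Sum>j\<in>UNIV. k $ j * int (d j) * l $ j)"
  have e: "s j * of_int (k $ j) * (s j * of_int (l $ j)) = real_of_int (k $ j * int (d j) * l $ j)"
    for j
  proof -
    have "s j * of_int (k $ j) * (s j * of_int (l $ j)) = (s j * s j) * (of_int (k $ j) * of_int (l
      $ j))"
      by (simp only: mult_ac)
    then show ?thesis unfolding s_square by simp
  qed
  have i: "lat s k \<bullet> lat s l = real_of_int N"
    by (simp only: lat_def inner_vec_def N_def vec_lambda_beta inner_real_def of_int_sum e)
  have "cis (- pi * (lat s k \<bullet> lat s l)) = cis (of_int (- N) * pi)" by (simp add: i mult.commute)
  also have "\<dots> = cis pi powi (- N)" by (rule cis_power_int[symmetric])
  also have "\<dots> = (- 1) powi N" by (simp add: power_int_minus_one_minus)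
  finally show ?thesis by (simp add: chi_D_def N_def)
qed

text \<open>On D^(-1/2) Z^n the modulations by D^(1/2) Z^n are trivial, and the translations permute
  each class. Only the phase of \<open>rho\<close> survives, and it equals
  \<open>chi_D\<close>.\<close>

lemma zvec_rho: "zvec (rho (- (lat s a, lat s b)) h) r = chi_D d a b * zvec h r"
proof -
  have v: "rho (- (lat s a, lat s b)) h (dlat s (idx r k)) = chi_D d a b * h (dlat s (idx r (k
    - a)))" for k
  proof -
    have "lat s b \<bullet> dlat s (idx r k) = real_of_int (\<Sum>j\<in>UNIV. idx r k $ j * b $ j)"
      using lat_inner_dual[of s "idx r k" b, OF s_pos] by (simp add: inner_commute)
    then have "e2pi (lat s b \<bullet> dlat s (idx r k)) = 1" by (simp only: cis_2pi_int)
    then have "cis (- (2 * pi * (lat s b \<bullet> dlat s (idx r k)))) = 1"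
      by (simp flip: cis_cnj)
    moreover have "dlat s (idx r k) + lat s a = dlat s (idx r (k - a))"
      by (simp add: lat_idx lat_diff)
    ultimately show ?thesis by (simp add: rho_def chi_D_cis)
  qed
  have "bij_betw (\<lambda>k. k - a) UNIV UNIV" by (rule bij_betwI[where g = "\<lambda>k. k + a"]) auto
  from integral_bij_count_space[OF this, of "\<lambda>k. h (dlat s (idx r k))"]
  have "(\<Sum>\<^sup>L k. h (dlat s (idx r (k - a)))) = zvec h r" by (simp add: zvec_def)
  then show ?thesis unfolding zvec_def v by simp
qed

definition state :: "(nat^'n \<Rightarrow> complex) \<Rightarrow> (real^'n \<Rightarrow> complex) \<Rightarrow> complex" where
  "state c h = (if h \<in> M1 \<phi> then pair c h else 0)"

lemma state_code_space: "state c \<in> code_space d \<phi>"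
proof -
  obtain C where C: "\<And>h. h \<in> M1 \<phi> \<Longrightarrow> (\<Sum>\<^sup>L m. norm (h (dlat s m))) \<le> C * M1_norm \<phi> h"
    using lattice_values_bound[of "dual s", OF dual_s_pos] by blast
  have "norm (state c h) \<le> (\<Sum>r\<in>Zd d. norm (c r)) * C * M1_norm \<phi> h" if h: "h \<in> M1 \<phi>" for h
  proof -
    have "norm (state c h) \<le> (\<Sum>r\<in>Zd d. norm (c r)) * (\<Sum>\<^sup>L m. norm (h (dlat s m)))"
      using pair_bound[OF h] h by (simp add: state_def)
    also have "\<dots> \<le> (\<Sum>r\<in>Zd d. norm (c r)) * (C * M1_norm \<phi> h)"
      by (intro mult_left_mono C h sum_nonneg) simp
    finally show ?thesis by (simp add: mult.assoc)
  qed
  moreover have "antilinear_on (M1 \<phi>) (state c)"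
    using pair_antilinear[of c] unfolding antilinear_on_def by (simp add: state_def M1_add M1_cmult)
  ultimately have "state c \<in> Minf \<phi>" unfolding Minf_def by (auto simp: state_def)
  moreover have "S_op d a b (state c) h = state c h" for a b h
  proof (cases "h \<in> M1 \<phi>")
    case True
    \<comment> \<open>The phase from \<open>zvec_rho\<close> enters conjugated, since the pairing is
      antilinear in \<open>h\<close>, and cancels against the explicit sign in
      \<open>S_op\<close>.\<close>
    have chi: "chi_D d a b * cnj (chi_D d a b) = 1" by (simp add: chi_D_cis cis_cnj cis_mult)
    have "chi_D d a b * (c r * cnj (chi_D d a b * zvec h r)) = c r * cnj (zvec h r)" for r
    proof -
      have "chi_D d a b * (c r * cnj (chi_D d a b * zvec h r)) = (chi_D d a b * cnj (chi_D d a b))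
        * (c r * cnj (zvec h r))"
        by (simp only: complex_cnj_mult mult_ac)
      then show ?thesis unfolding chi by simp
    qed
    then have "chi_D d a b * pair c (rho (- (lat s a, lat s b)) h) = pair c h"
      by (simp only: pair_def zvec_rho sum_distrib_left)
    then show ?thesis using True M1_rho[OF True, of "- (lat s a, lat s b)"]
      by (simp add: S_op_def rho_dual_def Dhalf_eq state_def)
  next
    case False
    then have "rho (- (lat s a, lat s b)) h \<notin> M1 \<phi>" unfolding M1_rho_iff .
    then show ?thesis using False by (simp add: S_op_def rho_dual_def Dhalf_eq state_def)
  qed
  ultimately show ?thesis unfolding code_space_def by (auto simp: fun_eq_iff)
qed

lemma zak_dual_iff: "zak_dual d \<phi> \<psi> (delta0 d c) \<longleftrightarrow> (\<forall>h\<in>M1 \<phi>. pair c h = \<psi> h)"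
  by (simp add: zak_dual_def delta0_vzak)

lemma code_vector_ex1:
  assumes "\<psi> \<in> code_space d \<phi>"
  shows "\<exists>!c. c \<in> Hd d \<and> zak_dual d \<phi> \<psi> (delta0 d c)"
proof -
  obtain c where c: "c \<in> Hd d" "\<forall>h\<in>M1 \<phi>. pair c h = \<psi> h" using code_state_exists[OF assms] by blast
  show ?thesis
  proof (rule ex1I[of _ c])
    show "c' = c" if "c' \<in> Hd d \<and> zak_dual d \<phi> \<psi> (delta0 d c')" for c'
      using that c by (intro pair_unique) (auto simp: zak_dual_iff)
  qed (use c in \<open>simp add: zak_dual_iff\<close>)
qed

definition vec_of :: "((real^'n \<Rightarrow> complex) \<Rightarrow> complex) \<Rightarrow> nat^'n \<Rightarrow> complex" where
  "vec_of \<psi> = (THE c. c \<in> Hd d \<and> zak_dual d \<phi> \<psi> (delta0 d c))"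

lemma vec_of:
  assumes "\<psi> \<in> code_space d \<phi>"
  shows "vec_of \<psi> \<in> Hd d" "\<And>h. h \<in> M1 \<phi> \<Longrightarrow> pair (vec_of \<psi>) h = \<psi> h"
proof -
  have "vec_of \<psi> \<in> Hd d \<and> zak_dual d \<phi> \<psi> (delta0 d (vec_of \<psi>))"
    unfolding vec_of_def by (rule theI'[OF code_vector_ex1[OF assms]])
  then show "vec_of \<psi> \<in> Hd d" "\<And>h. h \<in> M1 \<phi> \<Longrightarrow> pair (vec_of \<psi>) h = \<psi> h"
    by (auto simp: zak_dual_iff)
qed

lemma vec_of_eqI:
  assumes "\<psi> \<in> code_space d \<phi>" "c \<in> Hd d" "\<And>h. h \<in> M1 \<phi> \<Longrightarrow> pair c h = \<psi> h"
  shows "vec_of \<psi> = c"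
  using vec_of[OF assms(1)] assms by (intro pair_unique) auto

text \<open>Equality holds for all arguments, not only on \<open>M1\<close>, because both sides take
  the default value 0 elsewhere.\<close>

lemma state_vec_of:
  assumes "\<psi> \<in> code_space d \<phi>" shows "state (vec_of \<psi>) = \<psi>"
proof
  fix h
  have "h \<notin> M1 \<phi> \<Longrightarrow> \<psi> h = 0" using assms by (simp add: code_space_def Minf_def)
  then show "state (vec_of \<psi>) h = \<psi> h" using vec_of(2)[OF assms, of h] by (simp add: state_def)
qed

lemma vec_of_state: "c \<in> Hd d \<Longrightarrow> vec_of (state c) = c"
  by (rule vec_of_eqI[OF state_code_space]) (simp_all add: state_def)

lemma state_add: "state (\<lambda>r. c r + c' r) = (\<lambda>h. state c h + state c' h)"
  by (simp add: fun_eq_iff state_def pair_def distrib_right sum.distrib)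

lemma state_cmult: "state (\<lambda>r. a * c r) = (\<lambda>h. a * state c h)"
  by (simp add: fun_eq_iff state_def pair_def sum_distrib_left mult.assoc)

lemma Hd_subspace: "fun_subspace (Hd d)"
  by (simp add: fun_subspace_def Hd_def)

text \<open>Linearity is evident for the inverse map \<open>state\<close>, and writing code states
  as values of \<open>state\<close> transfers it to \<open>vec_of\<close>. The same rewriting shows
  that the code space is a subspace.\<close>

lemma code_vector_isomorphism: "linear_isomorphism_on (code_space d \<phi>) (Hd d) vec_of"
proof -
  have add: "(\<lambda>h. \<psi> h + \<psi>' h) = state (\<lambda>r. vec_of \<psi> r + vec_of \<psi>' r)"
    if "\<psi> \<in> code_space d \<phi>" "\<psi>' \<in> code_space d \<phi>" for \<psi> \<psi>'
    unfolding state_add state_vec_of[OF that(1)] state_vec_of[OF that(2)] ..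
  have cmult: "(\<lambda>h. a * \<psi> h) = state (\<lambda>r. a * vec_of \<psi> r)" if "\<psi> \<in> code_space d \<phi>" for \<psi> a
    unfolding state_cmult state_vec_of[OF that] ..
  have zero: "(\<lambda>h. 0) = state (\<lambda>r. 0)" by (simp add: fun_eq_iff state_def pair_def)
  have H: "(\<lambda>r. c r + c' r) \<in> Hd d" "(\<lambda>r. a * c r) \<in> Hd d" if "c \<in> Hd d" "c' \<in> Hd d" for c c' a
    using Hd_subspace that unfolding fun_subspace_def by blast+
  have "fun_subspace (code_space d \<phi>)"
    unfolding fun_subspace_def by (auto simp: zero add cmult state_code_space)
  moreover have "bij_betw vec_of (code_space d \<phi>) (Hd d)"
    by (rule bij_betwI[where g = state]) (auto simp: vec_of state_code_space state_vec_of vec_of_state)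
  moreover have "vec_of (\<lambda>h. \<psi> h + \<psi>' h) = (\<lambda>r. vec_of \<psi> r + vec_of \<psi>' r)"
    if "\<psi> \<in> code_space d \<phi>" "\<psi>' \<in> code_space d \<phi>" for \<psi> \<psi>'
    unfolding add[OF that] by (intro vec_of_state H vec_of that)
  moreover have "vec_of (\<lambda>h. a * \<psi> h) = (\<lambda>r. a * vec_of \<psi> r)" if "\<psi> \<in> code_space d \<phi>" for \<psi> a
    unfolding cmult[OF that] by (intro vec_of_state H(2)[where c' = "vec_of \<psi>"] vec_of that)
  ultimately show ?thesis unfolding linear_isomorphism_on_def using Hd_subspace by blast
qed

end

theorem proposition4p4:
  fixes d :: "'n::{finite,linorder} \<Rightarrow> nat"
    and \<phi> :: "real^'n::{finite,linorder} \<Rightarrow> complex"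
  assumes d_pos: "\<And>j. d j > 0"
    and d_dvd: "\<And>i j. i \<le> j \<Longrightarrow> d i dvd d j"
    and phi: "\<phi> \<in> schwartz" "\<phi> \<noteq> (\<lambda>_. 0)"
  shows "(\<forall>\<psi>\<in>code_space d \<phi>. \<exists>!c. c \<in> Hd d \<and> zak_dual d \<phi> \<psi> (delta0 d c)) \<and>
         linear_isomorphism_on (code_space d \<phi>) (Hd d)
           (\<lambda>\<psi>. THE c. c \<in> Hd d \<and> zak_dual d \<phi> \<psi> (delta0 d c))"
proof -
  interpret code \<phi> d by unfold_locales (use phi d_pos in auto)
  show ?thesis
    using code_vector_ex1 code_vector_isomorphism unfolding vec_of_def[abs_def] by blast
qed

end
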